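(* Let $q$ be a prime power and $m$ a positive integer such that there is an elliptic normal basis of $\mathbb{F}_{q^m}$ over $\mathbb{F}_q$. Let $\mathcal{M}_{q^m}(m)$ denote the worst-case cost, in operations over $\mathbb{F}_q$, of multiplying two linearized polynomials over $\mathbb{F}_{q^m}$ of $q$-degree less than $m$. Then the multiplication of two matrices from $\mathbb{F}_q^{m\times m}$ can be implemented in $$\mathcal{O}(m^\omega)\subseteq\mathcal{O}\left(\mathcal{M}_{q^m}(m)\right)$$ operations over $\mathbb{F}_q$; that is, the cost $\mathcal{O}(m^\omega)$ of multiplying two $m\times m$ matrices over $\mathbb{F}_q$ is bounded by $\mathcal{O}(\mathcal{M}_{q^m}(m))$.
   Context: Write $[i]:=q^i$. A linearized polynomial over $\mathbb{F}_{q^m}$ is a polynomial $a=\sum_k a_k x^{[k]}$, $a_k\in\mathbb{F}_{q^m}$, with $q$-degree $\deg_q a=\max\{k:a_k\ne0\}$. Addition is coefficient-wise and multiplication is composition, $a\cdot b=\sum_i\left(\sum_{j=0}^i a_jb_{i-j}^{[j]}\right)x^{[i]}$. A normal basis of $\mathbb{F}_{q^m}$ over $\mathbb{F}_q$ is a basis of the form $\{\beta^{[0]},\dots,\beta^{[m-1]}\}$. $\omega\le 3$ is the matrix multiplication exponent ($N\times N$ matrices are multiplied with $\mathcal{O}(N^\omega)$ field operations). Implied constants are uniform over the pairs $(q,m)$ in question, and costs of size $m^2$ times logarithmic factors are regarded as dominated by $\mathcal{M}_{q^m}(m)$. Elliptic normal bases (Couveignes–Lercier): let $E/\mathbb{F}_q$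 be an elliptic curve with origin $O$ and a Weierstrass model with coordinates $X,Y$, let $t\in E(\mathbb{F}_q)$ be a point of order $m\ge2$, and let $b\in E(\overline{\mathbb{F}}_q)$ satisfy $\Phi(b)=b+t$ ($\Phi$ the $q$-Frobenius of $E$) and $m b\neq O$; then $b$ is defined over $\mathbb{F}_{q^m}$. For distinct points $A,B$ let $u_{A,B}$ be the function $C\mapsto \frac{Y(C-A)-Y(A-B)}{X(C-A)-X(A-B)}$ on $E$ (of degree two, with simple poles exactly at $A$ and $B$). Put $u_k=\mathfrak{a}\,u_{kt,(k+1)t}+\mathfrak{b}$, $k\in\mathbb{Z}/m\mathbb{Z}$, with constants $\mathfrak{a}\in\mathbb{F}_q^*,\mathfrak{b}\in\mathbb{F}_q$ such that $\sum_k u_k=1$. Then $(u_k(b))_{k\in\mathbb{Z}/m\mathbb{Z}}$ is a normal basis of $\mathbb{F}_{q^m}$ over $\mathbb{F}_q$; bases arising in this way are called elliptic normal bases. Their relevant property (a known result) is that elements represented in such a basis can be multiplied with $\mathcal{O}(m)$ operations over $\mathbb{F}_q$ up to logarithmic factors in $m$, while $\alpha\mapsto\alpha^q$ is a cyclic shift of coordinates. Elements of $\mathbb{F}_{q^m}$ are represented in such a basis. *)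

theory Defs
  imports "HOL-Algebra.Algebraic_Closure" "HOL-Library.Landau_Symbols"
begin

section \<open>Straight-line programs and their cost\<close>

text \<open>
  Costs are numbers of arithmetic operations over a field \<open>F\<close> in the (non-uniform) straight-line
  model: the registers initially hold the inputs, every instruction appends one result, constants
  from \<open>F\<close> and copying registers to the output are free. The number of operations does not depend
  on the input, so it is the worst-case cost as well. A division by zero, like a reference to a
  missing register, makes the whole run undefined (\<open>None\<close>).
\<close>

datatype 'a operand = Const 'a | Reg nat

datatype arith_op = Add | Sub | Mul | Div

datatype 'a instr = Instr arith_op "'a operand" "'a operand"

text \<open>The instruction list together with the list of outputs.\<close>

type_synonym 'a slp = "'a instr list \<times> 'a operand list"

fun operand_val :: "'a list \<Rightarrow> 'a operand \<Rightarrow> 'a option" where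
  "operand_val rs (Const c) = Some c"
| "operand_val rs (Reg i) = (if i < length rs then Some (rs ! i) else None)"

context
  fixes F :: "'a ring" (structure)
begin

fun arith :: "arith_op \<Rightarrow> 'a \<Rightarrow> 'a \<Rightarrow> 'a option" where
  "arith Add x y = Some (x \<oplus> y)"
| "arith Sub x y = Some (x \<ominus> y)"
| "arith Mul x y = Some (x \<otimes> y)"
| "arith Div x y = (if y = \<zero> then None else Some (x \<otimes> inv y))"

fun exec_instr :: "'a instr \<Rightarrow> 'a list \<Rightarrow> 'a list option" where
  "exec_instr (Instr f s t) rs =
     Option.bind (operand_val rs s) (\<lambda>x.
     Option.bind (operand_val rs t) (\<lambda>y.
     map_option (\<lambda>z. rs @ [z]) (arith f x y)))"

fun exec :: "'a instr list \<Rightarrow> 'a list \<Rightarrow> 'a list option" where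
  "exec [] rs = Some rs"
| "exec (i # is) rs = Option.bind (exec_instr i rs) (exec is)"

definition slp_run :: "'a slp \<Rightarrow> 'a list \<Rightarrow> 'a list option" where
  "slp_run P xs = Option.bind (exec (fst P) xs) (\<lambda>rs. those (map (operand_val rs) (snd P)))"

definition slp_over :: "'a slp \<Rightarrow> bool" where
  "slp_over P \<longleftrightarrow>
     (\<forall>i\<in>set (fst P). set_instr i \<subseteq> carrier F) \<and> (\<forall>s\<in>set (snd P). set_operand s \<subseteq> carrier F)"

text \<open>A computational problem is the relation between its inputs and its correct outputs.\<close>

definition slp_solves :: "'a slp \<Rightarrow> ('a list \<times> 'a list) set \<Rightarrow> bool" where
  "slp_solves P R \<longleftrightarrow>
     slp_over P \<and> (\<forall>xs\<in>Domain R. \<exists>ys. slp_run P xs = Some ys \<and> (xs, ys) \<in> R)"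

definition op_cost :: "('a list \<times> 'a list) set \<Rightarrow> nat" where
  "op_cost R = Inf {length (fst P) |P. slp_solves P R}"

end


section \<open>Matrix multiplication\<close>

definition flatten :: "nat \<Rightarrow> nat \<Rightarrow> (nat \<Rightarrow> nat \<Rightarrow> 'a) \<Rightarrow> 'a list" where
  "flatten r c A = concat (map (\<lambda>i. map (A i) [0..<c]) [0..<r])"

context
  fixes F :: "'a ring" (structure)
begin

definition mats :: "nat \<Rightarrow> nat \<Rightarrow> (nat \<Rightarrow> nat \<Rightarrow> 'a) set" where
  "mats r c = {A. \<forall>i<r. \<forall>j<c. A i j \<in> carrier F}"

definition mat_prod :: "nat \<Rightarrow> (nat \<Rightarrow> nat \<Rightarrow> 'a) \<Rightarrow> (nat \<Rightarrow> nat \<Rightarrow> 'a) \<Rightarrow> nat \<Rightarrow> nat \<Rightarrow> 'a" where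
  "mat_prod n A B i j = (\<Oplus>k\<in>{..<n}. A i k \<otimes> B k j)"

definition matmul_problem :: "nat \<Rightarrow> ('a list \<times> 'a list) set" where
  "matmul_problem n =
     {(flatten n n A @ flatten n n B, flatten n n (mat_prod n A B)) |A B.
        A \<in> mats n n \<and> B \<in> mats n n}"

definition matmul_cost :: "nat \<Rightarrow> nat" where
  "matmul_cost n = op_cost F (matmul_problem n)"

end


section \<open>Linearized polynomials\<close>

text \<open>
  Throughout, \<open>L\<close> is an algebraic closure of its finite subfield \<open>K\<close> with \<open>q = card K\<close> elements;
  \<open>ext_field K m\<close> is the subfield of \<open>L\<close> with \<open>q ^ m\<close> elements.
\<close>

context
  fixes L :: "'a ring" (structure)
begin

definition ext_field :: "'a set \<Rightarrow> nat \<Rightarrow> 'a set" where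
  "ext_field K m = {x \<in> carrier L. x [^] (card K ^ m) = x}"

text \<open>
  A linearized polynomial is given by its coefficients, \<open>a k\<close> being the coefficient
  of \<open>x ^ (q ^ k)\<close>. The following are those of \<open>q\<close>-degree less than \<open>n\<close>, including \<open>0\<close>.
\<close>

definition linpolys :: "'a set \<Rightarrow> nat \<Rightarrow> nat \<Rightarrow> (nat \<Rightarrow> 'a) set" where
  "linpolys K m n = {a. (\<forall>k. a k \<in> ext_field K m) \<and> (\<forall>k\<ge>n. a k = \<zero>)}"

definition linpoly_mult :: "'a set \<Rightarrow> (nat \<Rightarrow> 'a) \<Rightarrow> (nat \<Rightarrow> 'a) \<Rightarrow> nat \<Rightarrow> 'a" where
  "linpoly_mult K a b i = (\<Oplus>j\<in>{..i}. a j \<otimes> b (i - j) [^] (card K ^ j))"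

text \<open>
  Row \<open>i\<close> of \<open>x\<close> holds the coordinates over \<open>K\<close> of the coefficient \<open>a i\<close>
  in the basis \<open>u 0, \<dots>, u (m - 1)\<close>.
\<close>

definition represents ::
  "'a set \<Rightarrow> nat \<Rightarrow> (nat \<Rightarrow> 'a) \<Rightarrow> nat \<Rightarrow> (nat \<Rightarrow> nat \<Rightarrow> 'a) \<Rightarrow> (nat \<Rightarrow> 'a) \<Rightarrow> bool" where
  "represents K m u n x a \<longleftrightarrow>
     (\<forall>i<n. (\<forall>k<m. x i k \<in> K) \<and> a i = (\<Oplus>k\<in>{..<m}. x i k \<otimes> u k))"

definition linpoly_problem :: "'a set \<Rightarrow> nat \<Rightarrow> (nat \<Rightarrow> 'a) \<Rightarrow> ('a list \<times> 'a list) set" where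
  "linpoly_problem K m u =
     {(flatten m m x @ flatten m m y, flatten (2 * m - 1) m z) |x y z. \<exists>a b.
        a \<in> linpolys K m m \<and> b \<in> linpolys K m m \<and>
        represents K m u m x a \<and> represents K m u m y b \<and>
        represents K m u (2 * m - 1) z (linpoly_mult K a b)}"

definition linpoly_cost :: "'a set \<Rightarrow> nat \<Rightarrow> (nat \<Rightarrow> 'a) \<Rightarrow> nat" where
  "linpoly_cost K m u = op_cost (L\<lparr>carrier := K\<rparr>) (linpoly_problem K m u)"

text \<open>The normal basis is enumerated by \<open>u 0, \<dots>, u (m - 1)\<close>, in any order.\<close>

definition normal_basis :: "'a set \<Rightarrow> nat \<Rightarrow> (nat \<Rightarrow> 'a) \<Rightarrow> bool" where
  "normal_basis K m u \<longleftrightarrow>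
     ring.independent L K (map u [0..<m]) \<and>
     ring.Span L K (map u [0..<m]) = ext_field K m \<and>
     (\<exists>\<beta>. u ` {..<m} = {\<beta> [^] (card K ^ i) |i. i < m})"

end


section \<open>Elliptic curves\<close>

text \<open>Coefficients of \<open>y\<^sup>2 + a\<^sub>1 x y + a\<^sub>3 y = x\<^sup>3 + a\<^sub>2 x\<^sup>2 + a\<^sub>4 x + a\<^sub>6\<close>; any characteristic.\<close>

record 'a weierstrass =
  wa1 :: 'a
  wa2 :: 'a
  wa3 :: 'a
  wa4 :: 'a
  wa6 :: 'a

datatype 'a point = Origin | Affine 'a 'a

context
  fixes L :: "'a ring" (structure)
begin

fun on_curve :: "'a weierstrass \<Rightarrow> 'a point \<Rightarrow> bool" where
  "on_curve E Origin \<longleftrightarrow> True"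
| "on_curve E (Affine x y) \<longleftrightarrow> x \<in> carrier L \<and> y \<in> carrier L \<and>
     y [^] (2::nat) \<oplus> wa1 E \<otimes> x \<otimes> y \<oplus> wa3 E \<otimes> y =
     x [^] (3::nat) \<oplus> wa2 E \<otimes> x [^] (2::nat) \<oplus> wa4 E \<otimes> x \<oplus> wa6 E"

text \<open>
  The two partial derivatives of the Weierstrass equation at \<open>(x, y)\<close> are
  \<open>deriv_y\<close> and \<open>- deriv_x\<close>.
\<close>

definition deriv_x :: "'a weierstrass \<Rightarrow> 'a \<Rightarrow> 'a \<Rightarrow> 'a" where
  "deriv_x E x y =
     [(3::nat)] \<cdot> (x [^] (2::nat)) \<oplus> [(2::nat)] \<cdot> (wa2 E \<otimes> x) \<oplus> wa4 E \<ominus> wa1 E \<otimes> y"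

definition deriv_y :: "'a weierstrass \<Rightarrow> 'a \<Rightarrow> 'a \<Rightarrow> 'a" where
  "deriv_y E x y = [(2::nat)] \<cdot> y \<oplus> wa1 E \<otimes> x \<oplus> wa3 E"

text \<open>Defined over \<open>K\<close> and smooth; the point at infinity is always smooth.\<close>

definition elliptic_curve :: "'a set \<Rightarrow> 'a weierstrass \<Rightarrow> bool" where
  "elliptic_curve K E \<longleftrightarrow>
     {wa1 E, wa2 E, wa3 E, wa4 E, wa6 E} \<subseteq> K \<and>
     (\<forall>x y. on_curve E (Affine x y) \<longrightarrow> deriv_x E x y \<noteq> \<zero> \<or> deriv_y E x y \<noteq> \<zero>)"

fun point_neg :: "'a weierstrass \<Rightarrow> 'a point \<Rightarrow> 'a point" where
  "point_neg E Origin = Origin"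
| "point_neg E (Affine x y) = Affine x (\<ominus> y \<ominus> wa1 E \<otimes> x \<ominus> wa3 E)"

text \<open>The slope of the chord through two points, or of the tangent if they coincide.\<close>

definition slope :: "'a weierstrass \<Rightarrow> 'a \<Rightarrow> 'a \<Rightarrow> 'a \<Rightarrow> 'a \<Rightarrow> 'a" where
  "slope E x1 y1 x2 y2 =
     (if x1 = x2 then deriv_x E x1 y1 \<otimes> inv (deriv_y E x1 y1)
      else (y2 \<ominus> y1) \<otimes> inv (x2 \<ominus> x1))"

fun point_add :: "'a weierstrass \<Rightarrow> 'a point \<Rightarrow> 'a point \<Rightarrow> 'a point" where
  "point_add E Origin Q = Q"
| "point_add E P Origin = P"
| "point_add E (Affine x1 y1) (Affine x2 y2) =
     (if Affine x2 y2 = point_neg E (Affine x1 y1) then Origin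
      else
        let l = slope E x1 y1 x2 y2;
            x3 = l [^] (2::nat) \<oplus> wa1 E \<otimes> l \<ominus> wa2 E \<ominus> x1 \<ominus> x2
        in point_neg E (Affine x3 (y1 \<oplus> l \<otimes> (x3 \<ominus> x1))))"

definition point_diff :: "'a weierstrass \<Rightarrow> 'a point \<Rightarrow> 'a point \<Rightarrow> 'a point" where
  "point_diff E P Q = point_add E P (point_neg E Q)"

definition point_mult :: "'a weierstrass \<Rightarrow> nat \<Rightarrow> 'a point \<Rightarrow> 'a point" where
  "point_mult E n P = (point_add E P ^^ n) Origin"

fun point_frob :: "nat \<Rightarrow> 'a point \<Rightarrow> 'a point" where
  "point_frob q Origin = Origin"
| "point_frob q (Affine x y) = Affine (x [^] q) (y [^] q)"


section \<open>Elliptic normal bases\<close>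

text \<open>
  The value at \<open>C\<close> of the function \<open>u\<^sub>A\<^sub>,\<^sub>B\<close>. The quotient is meaningful unless \<open>C = A\<close> or
  \<open>C - A = \<plusminus>(A - B)\<close>, that is, unless \<open>C\<close> is one of \<open>A\<close>, \<open>B\<close>, \<open>2 A - B\<close>. With \<open>A = k t\<close> and
  \<open>B = (k + 1) t\<close> these are all multiples of \<open>t\<close>, so below it is only evaluated at \<open>C\<close> where it
  is the value of the function.
\<close>

definition u_fun :: "'a weierstrass \<Rightarrow> 'a point \<Rightarrow> 'a point \<Rightarrow> 'a point \<Rightarrow> 'a" where
  "u_fun E A B C =
     (case (point_diff E C A, point_diff E A B) of
        (Affine x1 y1, Affine x2 y2) \<Rightarrow> (y1 \<ominus> y2) \<otimes> inv (x1 \<ominus> x2)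
      | _ \<Rightarrow> undefined)"

definition u_shift :: "'a weierstrass \<Rightarrow> 'a point \<Rightarrow> 'a \<Rightarrow> 'a \<Rightarrow> nat \<Rightarrow> 'a point \<Rightarrow> 'a" where
  "u_shift E t \<a> \<b> k C = \<a> \<otimes> u_fun E (point_mult E k t) (point_mult E (k + 1) t) C \<oplus> \<b>"

text \<open>
  The identity \<open>\<Sum>\<^sub>k u\<^sub>k = 1\<close> of functions on the curve is stated at all points over the
  algebraically closed field \<open>L\<close> that are not multiples of \<open>t\<close>, where the summands have their poles.
\<close>

definition elliptic_normal_basis :: "'a set \<Rightarrow> nat \<Rightarrow> (nat \<Rightarrow> 'a) \<Rightarrow> bool" where
  "elliptic_normal_basis K m u \<longleftrightarrow>
     m \<ge> 2 \<and> normal_basis L K m u \<and>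
     (\<exists>E t b \<a> \<b>.
        elliptic_curve K E \<and>
        on_curve E t \<and> point_frob (card K) t = t \<and>
        point_mult E m t = Origin \<and> (\<forall>j. 0 < j \<and> j < m \<longrightarrow> point_mult E j t \<noteq> Origin) \<and>
        on_curve E b \<and> point_frob (card K) b = point_add E b t \<and> point_mult E m b \<noteq> Origin \<and>
        \<a> \<in> K - {\<zero>} \<and> \<b> \<in> K \<and>
        (\<forall>C. on_curve E C \<and> C \<notin> range (\<lambda>k. point_mult E k t) \<longrightarrow>
           (\<Oplus>k\<in>{..<m}. u_shift E t \<a> \<b> k C) = \<one>) \<and>
        (\<forall>k<m. u k = u_shift E t \<a> \<b> k b))"

end

text \<open>
  All \<open>(L, K, m, u)\<close> such that \<open>u\<close> is an elliptic normal basis over the field \<open>K\<close> with \<open>q\<close> elements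
  of the field with \<open>q ^ m\<close> elements. That \<open>q\<close> is a prime power follows from \<open>K\<close> being a finite field.
\<close>

definition enb_instances :: "('a ring \<times> 'a set \<times> nat \<times> (nat \<Rightarrow> 'a)) set" where
  "enb_instances =
     {(L, K, m, u). algebraic_closure L K \<and> finite K \<and> elliptic_normal_basis L K m u}"

end

theory Submission
  imports Defs
begin

text \<open>
  Only the linear independence and the span of the basis \<open>u\<close> matter. For an element \<open>\<beta>\<close> generating a
  normal basis and its dual element \<open>\<gamma>\<close>, that is \<open>Tr (\<gamma> \<beta>\<^sup>[\<^sup>d\<^sup>]) = \<delta>\<^sub>d\<^sub>0\<close>, the linear map sending \<open>\<beta>\<^sup>[\<^sup>k\<^sup>]\<close>
  to \<open>\<alpha> k\<close> is the linearized polynomial with coefficients \<open>a l = \<Sum>\<^sub>k \<alpha> k \<gamma>\<^sup>[\<^sup>k\<^sup>+\<^sup>l\<^sup>]\<close>, and conversely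
  \<open>\<alpha> k = \<Sum>\<^sub>l a l \<beta>\<^sup>[\<^sup>k\<^sup>+\<^sup>l\<^sup>]\<close>. Either transform is given by two products with constant polynomials
  modulo \<open>x\<^sup>[\<^sup>m\<^sup>] - x\<close>: placing \<open>\<alpha> (2 j + e)\<close> at position \<open>j\<close>, for \<open>e = 0, 1\<close>, and letting \<open>b l = \<gamma>\<^sup>[\<^sup>e\<^sup>-\<^sup>l\<^sup>]\<close>, the
  summand \<open>\<alpha> (2 j + e) (b (i - j))\<^sup>[\<^sup>j\<^sup>]\<close> of the product is \<open>\<alpha> (2 j + e) \<gamma>\<^sup>[\<^sup>2\<^sup>j\<^sup>+\<^sup>e\<^sup>-\<^sup>i\<^sup>]\<close>. Hence a matrix product takes
  eight products of linearized polynomials (three transforms, the composition, and the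
  passage from \<open>u\<close> to the normal basis) and \<open>O(m\<^sup>2)\<close> additions, which are dominated as well
  because \<open>m\<^sup>2\<close> outputs of the product must be computed.

  The definition of \<open>normal_basis\<close> does not force its generator into the carrier of \<open>L\<close>, where
  powers are junk, so \<open>u\<close> may be any basis and a normal one has to be constructed.
\<close>

section \<open>Straight-line programs\<close>

text \<open>Cost is an infimum over programs, so nothing can be said about it before a program is
  known to exist. Over a finite field every function of finitely many inputs is a polynomial, and
  interpolation supplies a program. The twist of the product dictates the shape of the transforms:
  the term of index j lowers the index in the second factor by j and also raises it to the power
  [j]. If the second factor lists conjugates of one element, the exponent thus moves by 2j, so a
  single product reaches only every second exponent, and even and odd positions take a product each.
  The normal basis comes from a descent on linear functionals together with counting: injective maps
  between sets of q^m elements are onto, and every self-map of a finite set has an idempotent power.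
  This takes the place of the structure theory of modules over K[X]. The final constant is 19 = 8 +
  11: eight products and at most 11 m^2 additions, where m^2 is at most the cost of one
  product.\<close>

text \<open>
  Programs are composed through the sets of functions of the input that they make available,
  which avoids renumbering registers.
\<close>

definition avail :: "'a ring \<Rightarrow> 'a list set \<Rightarrow> 'a instr list \<Rightarrow> ('a list \<Rightarrow> 'a) set" where
  "avail F D is = {v. \<exists>s. set_operand s \<subseteq> carrier F \<and>
     (\<forall>x\<in>D. \<exists>rs. exec F is x = Some rs \<and> operand_val rs s = Some (v x))}"

definition computable :: "'a ring \<Rightarrow> 'a list set \<Rightarrow> nat \<Rightarrow> ('a list \<Rightarrow> 'a) set \<Rightarrow> bool" where
  "computable F D c V \<longleftrightarrow>
     (\<exists>is. length is \<le> c \<and> (\<forall>i\<in>set is. set_instr i \<subseteq> carrier F) \<and>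
        (\<forall>x\<in>D. exec F is x \<noteq> None) \<and> V \<subseteq> avail F D is)"

section \<open>Runs of concatenated programs\<close>

lemma exec_append: "exec F (is @ js) rs = Option.bind (exec F is rs) (exec F js)"
  by (induction "is" arbitrary: rs) (auto split: Option.bind_splits)

lemma exec_instr_prefix:
  assumes "exec_instr F i rs = Some rs'"
  shows "\<exists>z. rs' = rs @ [z]"
  using assms by (cases i) (auto split: Option.bind_splits)

lemma exec_prefix:
  assumes "exec F is rs = Some rs'"
  shows "\<exists>zs. rs' = rs @ zs \<and> length zs = length is"
  using assms
proof (induction "is" arbitrary: rs)
  case (Cons i "is")
  then obtain rs1 where 1: "exec_instr F i rs = Some rs1" "exec F is rs1 = Some rs'"
    by (auto split: Option.bind_splits)
  then show ?case using exec_instr_prefix[OF 1(1)] Cons.IH[OF 1(2)] by auto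
qed simp

lemma operand_val_append:
  "operand_val rs s = Some v \<Longrightarrow> operand_val (rs @ zs) s = Some v"
  by (cases s) (auto simp: nth_append split: if_splits)

text \<open>Instructions only append registers, so an operand keeps its value when the program
  grows. The longer run has to be defined because \<open>avail\<close> asks for a successful
  run.\<close>

lemma avail_mono:
  assumes "\<forall>x\<in>D. exec F (is @ js) x \<noteq> None"
  shows "avail F D is \<subseteq> avail F D (is @ js)"
proof
  fix v assume "v \<in> avail F D is"
  then obtain s where s: "set_operand s \<subseteq> carrier F"
    "\<And>x. x \<in> D \<Longrightarrow> \<exists>rs. exec F is x = Some rs \<and> operand_val rs s = Some (v x)"
    unfolding avail_def by blast
  have "\<exists>rs. exec F (is @ js) x = Some rs \<and> operand_val rs s = Some (v x)" if x: "x \<in> D" for x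
  proof -
    obtain rs where rs: "exec F is x = Some rs" "operand_val rs s = Some (v x)"
      using s(2)[OF x] by blast
    obtain rs' where rs': "exec F (is @ js) x = Some rs'" using assms x by auto
    then have "exec F js rs = Some rs'" using rs by (simp add: exec_append)
    from exec_prefix[OF this] show ?thesis using rs rs' operand_val_append by fastforce
  qed
  then show "v \<in> avail F D (is @ js)" using s(1) unfolding avail_def by blast
qed

lemma avail_cong: "v \<in> avail F D is \<Longrightarrow> (\<And>x. x \<in> D \<Longrightarrow> w x = v x) \<Longrightarrow> w \<in> avail F D is"
  unfolding avail_def by force

lemma avail_const: "k \<in> carrier F \<Longrightarrow> (\<lambda>_. k) \<in> avail F D []"
  unfolding avail_def by (auto intro!: exI[of _ "Const k"])

lemma avail_input: "\<forall>x\<in>D. i < length x \<Longrightarrow> (\<lambda>x. x ! i) \<in> avail F D []"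
  unfolding avail_def by (auto intro!: exI[of _ "Reg i"])

lemma computable_base: "computable F D 0 (avail F D [])"
  unfolding computable_def by auto

lemma computable_mono: "computable F D c V \<Longrightarrow> c \<le> c' \<Longrightarrow> W \<subseteq> V \<Longrightarrow> computable F D c' W"
  unfolding computable_def by (meson order_trans)

lemma computable_Un_base: "computable F D c V \<Longrightarrow> computable F D c (V \<union> avail F D [])"
  unfolding computable_def using avail_mono[of D F "[]"] by (metis Un_least append_Nil)

lemma computable_cong:
  assumes "computable F D c V" "\<And>w. w \<in> W \<Longrightarrow> \<exists>v\<in>V. \<forall>x\<in>D. w x = v x"
  shows "computable F D c (V \<union> W)"
proof -
  have "w \<in> avail F D is" if "V \<subseteq> avail F D is" "w \<in> W" for "is" w
  proof -
    obtain v where "v \<in> V" "\<forall>x\<in>D. w x = v x" using assms(2)[OF \<open>w \<in> W\<close>] by blast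
    then show ?thesis using that(1) avail_cong by (metis subsetD)
  qed
  then show ?thesis using assms(1) unfolding computable_def by blast
qed

text \<open>A common input length \<open>n\<close> puts the new result into register
  \<open>n + length is\<close> for every input, and an operand must be the same for all
  inputs.\<close>

lemma computable_arith:
  assumes "computable F D c V" "v \<in> V" "w \<in> V" "\<forall>x\<in>D. length x = n"
    and z: "\<And>x. x \<in> D \<Longrightarrow> arith F f (v x) (w x) = Some (z x)"
  shows "computable F D (Suc c) (insert z V)"
proof -
  obtain "is" where "is": "length is \<le> c" "\<forall>i\<in>set is. set_instr i \<subseteq> carrier F"
    "\<forall>x\<in>D. exec F is x \<noteq> None" "V \<subseteq> avail F D is"
    using assms(1) unfolding computable_def by blast
  from \<open>v \<in> V\<close> "is"(4) obtain s where s: "set_operand s \<subseteq> carrier F"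
    "\<And>x. x \<in> D \<Longrightarrow> \<exists>rs. exec F is x = Some rs \<and> operand_val rs s = Some (v x)"
    unfolding avail_def by blast
  from \<open>w \<in> V\<close> "is"(4) obtain t where t: "set_operand t \<subseteq> carrier F"
    "\<And>x. x \<in> D \<Longrightarrow> \<exists>rs. exec F is x = Some rs \<and> operand_val rs t = Some (w x)"
    unfolding avail_def by blast
  let ?js = "is @ [Instr f s t]"
  have ex: "\<exists>rs. exec F ?js x = Some (rs @ [z x]) \<and> length rs = n + length is" if x: "x \<in> D" for x
  proof -
    obtain rs where rs: "exec F is x = Some rs" using "is"(3) x by blast
    have "operand_val rs s = Some (v x)" "operand_val rs t = Some (w x)"
      using s(2)[OF x] t(2)[OF x] rs by auto
    then have "exec F ?js x = Some (rs @ [z x])" using rs z[OF x] by (simp add: exec_append)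
    moreover have "length rs = n + length is" using exec_prefix[OF rs] assms(4) x by auto
    ultimately show ?thesis by blast
  qed
  then have def: "\<forall>x\<in>D. exec F ?js x \<noteq> None" by (metis option.distinct(1))
  have "z \<in> avail F D ?js"
    unfolding avail_def using ex
    by (fastforce intro!: exI[of _ "Reg (n + length is)"] simp: nth_append)
  moreover have "V \<subseteq> avail F D ?js" using "is"(4) avail_mono[OF def] by blast
  ultimately show ?thesis
    unfolding computable_def using "is"(1,2) s(1) t(1) def
    by (intro exI[of _ ?js]) auto
qed

lemma computable_add:
  assumes "finite I" "computable F D c V" "\<forall>x\<in>D. length x = n"
    and "\<And>i. i \<in> I \<Longrightarrow> v i \<in> V" "\<And>i. i \<in> I \<Longrightarrow> w i \<in> V"
  shows "computable F D (c + card I) (V \<union> (\<lambda>i x. v i x \<oplus>\<^bsub>F\<^esub> w i x) ` I)"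
  using assms(1,4,5)
proof (induction I rule: finite_induct)
  case empty
  then show ?case using assms(2) by simp
next
  case (insert i I)
  have "computable F D (Suc (c + card I))
      (insert (\<lambda>x. v i x \<oplus>\<^bsub>F\<^esub> w i x) (V \<union> (\<lambda>i x. v i x \<oplus>\<^bsub>F\<^esub> w i x) ` I))"
    using insert by (intro computable_arith[where v = "v i" and w = "w i" and f = Add, OF _ _ _ assms(3)]) auto
  then show ?case using insert by simp
qed

text \<open>A subroutine call by symbolic execution: each register of the called program is
  represented by a function of the outer input, so the list \<open>rs\<close> plays the role of its
  register list and grows with every instruction.\<close>

lemma computable_exec:
  assumes "computable F D c V" "\<forall>x\<in>D. length x = n" "set rs \<subseteq> V"
    and "\<forall>i\<in>set is. set_instr i \<subseteq> carrier F"
    and "\<forall>x\<in>D. exec F is (map (\<lambda>v. v x) rs) \<noteq> None"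
  shows "\<exists>rs'. computable F D (c + length is) (V \<union> set rs') \<and>
           (\<forall>x\<in>D. exec F is (map (\<lambda>v. v x) rs) = Some (map (\<lambda>v. v x) rs'))"
  using assms(1,3-)
proof (induction "is" arbitrary: c V rs)
  case Nil
  then show ?case by (intro exI[of _ rs]) (auto simp: Un_absorb2)
next
  case (Cons i "is")
  obtain f s t where i: "i = Instr f s t" by (cases i)
  define val where
    "val s = (case s of Const k \<Rightarrow> (\<lambda>x. k) | Reg j \<Rightarrow> rs ! j)" for s :: "'a operand"
  let ?z = "\<lambda>x. the (arith F f (val s x) (val t x))"
  let ?V = "V \<union> avail F D []"
  have step: "val s \<in> ?V \<and> val t \<in> ?V \<and>
      exec_instr F i (map (\<lambda>v. v x) rs) = Some (map (\<lambda>v. v x) (rs @ [?z])) \<and>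
      arith F f (val s x) (val t x) = Some (?z x)" if x: "x \<in> D" for x
  proof -
    obtain rs1 where "exec_instr F i (map (\<lambda>v. v x) rs) = Some rs1"
      using Cons.prems(4) x by (fastforce split: Option.bind_splits)
    then obtain a b where ab: "operand_val (map (\<lambda>v. v x) rs) s = Some a"
      "operand_val (map (\<lambda>v. v x) rs) t = Some b" "arith F f a b \<noteq> None"
      "exec_instr F i (map (\<lambda>v. v x) rs) = Some (map (\<lambda>v. v x) rs @ [the (arith F f a b)])"
      unfolding i by (auto split: Option.bind_splits)
    have *: "val s x = a \<and> val s \<in> ?V"
      if "operand_val (map (\<lambda>v. v x) rs) s = Some a" "set_operand s \<subseteq> carrier F" for s a
      using that Cons.prems(2) avail_const[of _ F D]
      by (cases s) (auto simp: val_def split: if_splits)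
    show ?thesis using *[OF ab(1)] *[OF ab(2)] ab(3,4) Cons.prems(3) i by auto
  qed
  show ?case
  \<comment> \<open>That the operands refer to existing registers is learnt from a successful run,
    and an empty \<open>D\<close> offers none.\<close>
  proof (cases "D = {}")
    case True
    with Cons.prems(1) show ?thesis
      by (intro exI[of _ "[]"]) (auto intro: computable_mono)
  next
    case False
    then have vals: "val s \<in> ?V" "val t \<in> ?V" using step by blast+
    have "computable F D (Suc c) (insert ?z ?V)"
      by (rule computable_arith[OF computable_Un_base[OF Cons.prems(1)] vals assms(2)])
        (use step in blast)
    then have "computable F D (Suc c) (insert ?z V)"
      by (rule computable_mono) auto
    moreover have "\<forall>x\<in>D. exec F is (map (\<lambda>v. v x) (rs @ [?z])) \<noteq> None"
    proof
      fix x assume x: "x \<in> D"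
      with Cons.prems(4) have "exec F (i # is) (map (\<lambda>v. v x) rs) \<noteq> None" by blast
      then show "exec F is (map (\<lambda>v. v x) (rs @ [?z])) \<noteq> None" using step[OF x] by simp
    qed
    ultimately obtain rs' where rs': "computable F D (Suc c + length is) (insert ?z V \<union> set rs')"
      "\<forall>x\<in>D. exec F is (map (\<lambda>v. v x) (rs @ [?z])) = Some (map (\<lambda>v. v x) rs')"
      using Cons.IH[of "Suc c" "insert ?z V" "rs @ [?z]"] Cons.prems(2,3) by auto
    show ?thesis
    proof (intro exI[of _ rs'] conjI ballI)
      show "computable F D (c + length (i # is)) (V \<union> set rs')"
        using rs'(1) by (rule computable_mono) auto
      fix x assume x: "x \<in> D"
      show "exec F (i # is) (map (\<lambda>v. v x) rs) = Some (map (\<lambda>v. v x) rs')"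
        using step[OF x] rs'(2) x by simp
    qed
  qed
qed

lemma those_map_eq_Some:
  "those (map f xs) = Some ys \<longleftrightarrow> map f xs = map Some ys"
  by (induction xs arbitrary: ys) (auto split: option.splits simp: map_eq_Cons_conv)

text \<open>Embeds a solver of \<open>R\<close> into a larger program at the price of its
  instructions alone. \<open>R\<close> may admit several outputs, so the functions \<open>ws\<close>
  are characterised only by being related to the input at each point.\<close>

lemma computable_solve:
  assumes "computable F D c V" "\<forall>x\<in>D. length x = n" "set vs \<subseteq> V" "slp_solves F P R"
    and dom: "\<forall>x\<in>D. map (\<lambda>v. v x) vs \<in> Domain R"
  shows "\<exists>ws. computable F D (c + length (fst P)) (V \<union> set ws) \<and>
           (\<forall>x\<in>D. (map (\<lambda>v. v x) vs, map (\<lambda>v. v x) ws) \<in> R)"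
proof (cases "D = {}")
  case True
  with assms(1) show ?thesis by (intro exI[of _ "[]"]) (auto intro: computable_mono)
next
  case False
  have run: "\<exists>ys rs. exec F (fst P) (map (\<lambda>v. v x) vs) = Some rs \<and>
     map (operand_val rs) (snd P) = map Some ys \<and> (map (\<lambda>v. v x) vs, ys) \<in> R" if "x \<in> D" for x
    using dom that assms(4) unfolding slp_solves_def slp_run_def
    by (fastforce simp: bind_eq_Some_conv those_map_eq_Some)
  have over: "\<forall>i\<in>set (fst P). set_instr i \<subseteq> carrier F" "\<forall>s\<in>set (snd P). set_operand s \<subseteq> carrier F"
    using assms(4) unfolding slp_solves_def slp_over_def by auto
  have "\<forall>x\<in>D. exec F (fst P) (map (\<lambda>v. v x) vs) \<noteq> None"
    using run by force
  then obtain rs' where rs': "computable F D (c + length (fst P)) (V \<union> set rs')"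
      "\<And>x. x \<in> D \<Longrightarrow> exec F (fst P) (map (\<lambda>v. v x) vs) = Some (map (\<lambda>v. v x) rs')"
    using computable_exec[OF assms(1-3) over(1)] by blast
  define val where
    "val s = (case s of Const k \<Rightarrow> (\<lambda>x. k) | Reg j \<Rightarrow> rs' ! j)" for s :: "'a operand"
  have ops: "operand_val (map (\<lambda>v. v x) rs') s = Some (val s x) \<and> val s \<in> V \<union> set rs' \<union> avail F D []"
    if x: "x \<in> D" and s: "s \<in> set (snd P)" for s x
  proof -
    have "operand_val (map (\<lambda>v. v x) rs') s \<noteq> None"
      using run[OF x] rs'(2)[OF x] s by (metis map_eq_conv list.set_map imageE image_eqI option.distinct(1) option.inject)
    then show ?thesis using over(2) s avail_const[of _ F D]
      by (cases s) (auto simp: val_def split: if_splits)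
  qed
  show ?thesis
  proof (intro exI[of _ "map val (snd P)"] conjI ballI)
    show "computable F D (c + length (fst P)) (V \<union> set (map val (snd P)))"
      using computable_Un_base[OF rs'(1)] by (rule computable_mono) (use ops False in auto)
    fix x assume x: "x \<in> D"
    from run[OF x] rs'(2)[OF x] obtain ys where
      ys: "map (operand_val (map (\<lambda>v. v x) rs')) (snd P) = map Some ys" "(map (\<lambda>v. v x) vs, ys) \<in> R"
      by auto
    have "map Some (map (\<lambda>s. val s x) (snd P)) = map (operand_val (map (\<lambda>v. v x) rs')) (snd P)"
      using ops[OF x] by (simp cong: map_cong)
    then have "map Some (map (\<lambda>s. val s x) (snd P)) = map Some ys" using ys(1) by simp
    then have "map (\<lambda>s. val s x) (snd P) = ys"
      by (metis (no_types, lifting) inj_map_eq_map inj_Some)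
    then show "(map (\<lambda>v. v x) vs, map (\<lambda>v. v x) (map val (snd P))) \<in> R"
      using ys(2) by (simp add: comp_def)
  qed
qed

text \<open>The way back to programs: choosing one operand for each function in \<open>ws\<close>
  yields the output list, which costs nothing.\<close>

lemma computable_imp_slp:
  assumes "computable F (Domain R) c V" "set ws \<subseteq> V"
    and "\<And>x. x \<in> Domain R \<Longrightarrow> (x, map (\<lambda>v. v x) ws) \<in> R"
  shows "\<exists>P. slp_solves F P R \<and> length (fst P) \<le> c"
proof -
  obtain "is" where "is": "length is \<le> c" "\<forall>i\<in>set is. set_instr i \<subseteq> carrier F"
    "\<forall>x\<in>Domain R. exec F is x \<noteq> None" "V \<subseteq> avail F (Domain R) is"
    using assms(1) unfolding computable_def by blast
  have "\<forall>w\<in>set ws. \<exists>s. set_operand s \<subseteq> carrier F \<and>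
     (\<forall>x\<in>Domain R. \<exists>rs. exec F is x = Some rs \<and> operand_val rs s = Some (w x))"
    using assms(2) "is"(4) unfolding avail_def by blast
  then obtain op where op: "\<And>w. w \<in> set ws \<Longrightarrow> set_operand (op w) \<subseteq> carrier F"
    "\<And>w x. w \<in> set ws \<Longrightarrow> x \<in> Domain R \<Longrightarrow>
       \<exists>rs. exec F is x = Some rs \<and> operand_val rs (op w) = Some (w x)"
    by metis
  let ?P = "(is, map op ws)"
  have "slp_run F ?P x = Some (map (\<lambda>v. v x) ws)" if x: "x \<in> Domain R" for x
  proof -
    obtain rs where rs: "exec F is x = Some rs" using "is"(3) x by blast
    with op(2)[OF _ x] have "map (operand_val rs) (map op ws) = map Some (map (\<lambda>v. v x) ws)"
      by auto
    then show ?thesis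
      unfolding slp_run_def by (simp only: fst_conv snd_conv rs bind.simps those_map_eq_Some)
  qed
  then have "slp_solves F ?P R"
    unfolding slp_solves_def slp_over_def using "is"(2) op(1) assms(3) by auto
  then show ?thesis using "is"(1) by auto
qed

lemma op_cost_le: "slp_solves F P R \<Longrightarrow> op_cost F R \<le> length (fst P)"
  unfolding op_cost_def by (intro cInf_lower) blast+

text \<open>The infimum of an empty set of naturals carries no information, hence the given program;
  a nonempty set of naturals contains its infimum.\<close>

lemma op_cost_attained:
  assumes "slp_solves F P R"
  shows "\<exists>P. slp_solves F P R \<and> length (fst P) = op_cost F R"
proof -
  have "op_cost F R \<in> {length (fst P) |P. slp_solves F P R}"
    unfolding op_cost_def using assms by (intro Inf_nat_def1) blast
  then show ?thesis by auto
qed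

section \<open>Interpolation over finite fields\<close>

text \<open>Costs are forgotten, only the existence of a program counts. Quantifying over
  \<open>V\<close> keeps values computed earlier while further ones are added.\<close>

definition adjoinable :: "'a ring \<Rightarrow> 'a list set \<Rightarrow> ('a list \<Rightarrow> 'a) \<Rightarrow> bool" where
  "adjoinable F D v \<longleftrightarrow> (\<forall>c V. computable F D c V \<longrightarrow> (\<exists>c'. computable F D c' (insert v V)))"

lemma adjoinable_base: "v \<in> avail F D [] \<Longrightarrow> adjoinable F D v"
  unfolding adjoinable_def by (blast intro: computable_Un_base computable_mono)

lemma adjoinable_cong:
  assumes "adjoinable F D v" "\<And>x. x \<in> D \<Longrightarrow> w x = v x"
  shows "adjoinable F D w"
  unfolding adjoinable_def
proof (intro allI impI)
  fix c V assume "computable F D c V"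
  then obtain c' where "computable F D c' (insert v V)"
    using assms(1) unfolding adjoinable_def by blast
  then have "computable F D c' (insert v V \<union> {w})"
    by (rule computable_cong) (use assms(2) in auto)
  then show "\<exists>c'. computable F D c' (insert w V)"
    by (blast intro: computable_mono)
qed

lemma adjoinable_arith:
  assumes "adjoinable F D v" "adjoinable F D w" "\<forall>x\<in>D. length x = n"
    and "\<And>x. x \<in> D \<Longrightarrow> arith F f (v x) (w x) = Some (z x)"
  shows "adjoinable F D z"
  unfolding adjoinable_def
proof (intro allI impI)
  fix c V assume "computable F D c V"
  then obtain c' where "computable F D c' (insert v V)"
    using assms(1) unfolding adjoinable_def by blast
  then obtain c'' where "computable F D c'' (insert w (insert v V))"
    using assms(2) unfolding adjoinable_def by blast
  from computable_arith[OF this, of v w n f z]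
  have "computable F D (Suc c'') (insert z (insert w (insert v V)))"
    using assms(3,4) by blast
  then show "\<exists>c'. computable F D c' (insert z V)"
    by (blast intro: computable_mono)
qed

lemma adjoinable_imp_computable:
  assumes "finite V" "\<And>v. v \<in> V \<Longrightarrow> adjoinable F D v"
  shows "\<exists>c. computable F D c V"
  using assms
proof (induction V rule: finite_induct)
  case empty
  then show ?case using computable_mono[OF computable_base] by blast
next
  case (insert v V)
  then show ?case unfolding adjoinable_def by blast
qed

context
  fixes F :: "'a ring" (structure)
  assumes F: "field F"
begin

interpretation field F by (rule F)

context
  fixes D :: "'a list set" and n :: nat
  assumes D: "\<And>x. x \<in> D \<Longrightarrow> length x = n \<and> set x \<subseteq> carrier F"
begin

lemma adjoinable_const: "k \<in> carrier F \<Longrightarrow> adjoinable F D (\<lambda>_. k)"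
  by (intro adjoinable_base avail_const)

lemma adjoinable_input: "i < n \<Longrightarrow> adjoinable F D (\<lambda>x. x ! i)"
  using D by (intro adjoinable_base avail_input) auto

lemma adjoinable_add:
  "adjoinable F D v \<Longrightarrow> adjoinable F D w \<Longrightarrow> adjoinable F D (\<lambda>x. v x \<oplus> w x)"
  by (rule adjoinable_arith[where f = Add and n = n]) (use D in auto)

lemma adjoinable_minus:
  "adjoinable F D v \<Longrightarrow> adjoinable F D w \<Longrightarrow> adjoinable F D (\<lambda>x. v x \<ominus> w x)"
  by (rule adjoinable_arith[where f = Sub and n = n]) (use D in auto)

lemma adjoinable_mult:
  "adjoinable F D v \<Longrightarrow> adjoinable F D w \<Longrightarrow> adjoinable F D (\<lambda>x. v x \<otimes> w x)"
  by (rule adjoinable_arith[where f = Mul and n = n]) (use D in auto)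

lemma adjoinable_finsum:
  assumes "finite A" "\<And>a. a \<in> A \<Longrightarrow> adjoinable F D (g a)"
    and "\<And>a x. a \<in> A \<Longrightarrow> x \<in> D \<Longrightarrow> g a x \<in> carrier F"
  shows "adjoinable F D (\<lambda>x. \<Oplus>a\<in>A. g a x)"
  using assms
proof (induction A rule: finite_induct)
  case empty
  then show ?case using adjoinable_const[of \<zero>] by simp
next
  case (insert a A)
  then have "adjoinable F D (\<lambda>x. g a x \<oplus> (\<Oplus>a\<in>A. g a x))"
    by (intro adjoinable_add) auto
  then show ?case
    by (rule adjoinable_cong) (use insert in \<open>auto intro!: finsum_insert\<close>)
qed

text \<open>\<open>h\<close> is a product of linear factors, one for each element of
  \<open>A\<close>; it has no further zeros since a field has no zero divisors.\<close>

lemma adjoinable_vanishing: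
  assumes "finite A" "A \<subseteq> carrier F" "i < n"
  shows "\<exists>h. adjoinable F D (\<lambda>x. h (x ! i)) \<and>
           (\<forall>y\<in>carrier F. h y \<in> carrier F \<and> (h y = \<zero> \<longleftrightarrow> y \<in> A))"
  using assms
proof (induction A rule: finite_induct)
  case empty
  then show ?case using adjoinable_const[of \<one>] by (intro exI[of _ "\<lambda>_. \<one>"]) auto
next
  case (insert a A)
  then obtain h where h: "adjoinable F D (\<lambda>x. h (x ! i))"
    "\<And>y. y \<in> carrier F \<Longrightarrow> h y \<in> carrier F \<and> (h y = \<zero> \<longleftrightarrow> y \<in> A)"
    by auto
  have "adjoinable F D (\<lambda>x. (x ! i \<ominus> a) \<otimes> h (x ! i))"
    using insert.prems h(1)
    by (intro adjoinable_mult adjoinable_minus adjoinable_input adjoinable_const) auto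
  moreover have "(y \<ominus> a) \<otimes> h y \<in> carrier F \<and> ((y \<ominus> a) \<otimes> h y = \<zero> \<longleftrightarrow> y \<in> insert a A)"
    if "y \<in> carrier F" for y
    using that insert.prems(1) h(2)[OF that] by (auto simp: integral_iff)
  ultimately show ?case by (intro exI[of _ "\<lambda>y. (y \<ominus> a) \<otimes> h y"]) auto
qed

text \<open>The factor for coordinate \<open>k\<close> is a polynomial vanishing on all field
  elements but \<open>d ! k\<close>, divided by its value there. Prefixes \<open>take k\<close> let
  the product be formed one coordinate at a time.\<close>

lemma adjoinable_indicator:
  assumes "finite (carrier F)" "d \<in> D" "k \<le> n"
  shows "adjoinable F D (\<lambda>x. if take k x = take k d then \<one> else \<zero>)"
  using assms(3)
proof (induction k)
  case 0
  then show ?case using adjoinable_const[of \<one>] by simp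
next
  case (Suc k)
  have dk: "d ! k \<in> carrier F" using D[OF assms(2)] Suc.prems by auto
  obtain h where h: "adjoinable F D (\<lambda>x. h (x ! k))"
    "\<And>y. y \<in> carrier F \<Longrightarrow> h y \<in> carrier F \<and> (h y = \<zero> \<longleftrightarrow> y \<in> carrier F - {d ! k})"
    using adjoinable_vanishing[of "carrier F - {d ! k}" k] assms(1) Suc.prems by auto
  have hd: "h (d ! k) \<in> carrier F - {\<zero>}" using h(2)[OF dk] by auto
  have "adjoinable F D (\<lambda>x. (if take k x = take k d then \<one> else \<zero>) \<otimes> (h (x ! k) \<otimes> inv (h (d ! k))))"
    using Suc h(1) hd by (intro adjoinable_mult adjoinable_const) (auto simp: field_Units)
  then show ?case
  proof (rule adjoinable_cong)
    fix x assume x: "x \<in> D"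
    then have xk: "x ! k \<in> carrier F" "k < length x" "k < length d"
      using D[OF x] D[OF assms(2)] Suc.prems by auto
    have "h (x ! k) \<otimes> inv (h (d ! k)) = (if x ! k = d ! k then \<one> else \<zero>)"
      using h(2)[OF xk(1)] hd xk(1) by (auto simp: field_Units)
    then show "(if take (Suc k) x = take (Suc k) d then \<one> else \<zero>) =
      (if take k x = take k d then \<one> else \<zero>) \<otimes> (h (x ! k) \<otimes> inv (h (d ! k)))"
      using xk by (auto simp: take_Suc_conv_app_nth)
  qed
qed

text \<open>Lagrange interpolation in several variables: lists of fixed length over a finite field
  are finite in number, and summing \<open>f d\<close> times the indicator of \<open>d\<close>
  reproduces \<open>f\<close> on \<open>D\<close>.\<close>

lemma adjoinable_any:
  assumes "finite (carrier F)" "\<And>x. x \<in> D \<Longrightarrow> f x \<in> carrier F"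
  shows "adjoinable F D f"
proof -
  have "D \<subseteq> {x. set x \<subseteq> carrier F \<and> length x = n}" using D by auto
  then have fin: "finite D" using finite_lists_length_eq[OF assms(1)] finite_subset by blast
  have "adjoinable F D (\<lambda>x. \<Oplus>d\<in>D. f d \<otimes> (if take n x = take n d then \<one> else \<zero>))"
    using assms fin
    by (intro adjoinable_finsum adjoinable_mult adjoinable_const adjoinable_indicator) auto
  then show ?thesis
  proof (rule adjoinable_cong)
    fix x assume x: "x \<in> D"
    have "(\<Oplus>d\<in>D. f d \<otimes> (if take n x = take n d then \<one> else \<zero>)) =
          (\<Oplus>d\<in>D. if x = d then f d else \<zero>)"
      using D x assms(2) by (intro finsum_cong') (auto simp: simp_implies_def)
    also have "\<dots> = f x" using finsum_singleton[OF x fin, of f] assms(2) by auto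
    finally show "f x = (\<Oplus>d\<in>D. f d \<otimes> (if take n x = take n d then \<one> else \<zero>))" ..
  qed
qed

end

text \<open>Choosing one correct output per input gives a function, and each of its \<open>p\<close>
  coordinates is interpolated. The program may be huge; it serves to make the set of costs
  nonempty.\<close>

lemma finite_field_slp_exists:
  assumes "finite (carrier F)"
    and dom: "\<And>x. x \<in> Domain Q \<Longrightarrow> length x = n \<and> set x \<subseteq> carrier F"
    and out: "\<And>x. x \<in> Domain Q \<Longrightarrow> \<exists>y. (x, y) \<in> Q \<and> length y = p \<and> set y \<subseteq> carrier F"
  shows "\<exists>P. slp_solves F P Q"
proof -
  obtain y where y: "\<And>x. x \<in> Domain Q \<Longrightarrow> (x, y x) \<in> Q \<and> length (y x) = p \<and> set (y x) \<subseteq> carrier F"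
    using out by metis
  define ws where "ws = map (\<lambda>j x. y x ! j) [0..<p]"
  have "\<exists>c. computable F (Domain Q) c (set ws)"
    by (intro adjoinable_imp_computable adjoinable_any[OF dom assms(1)])
      (use y nth_mem in \<open>fastforce simp: ws_def\<close>)+
  moreover have "map (\<lambda>v. v x) ws = y x" if "x \<in> Domain Q" for x
    using y[OF that] by (auto simp: ws_def intro: nth_equalityI)
  ultimately show ?thesis using computable_imp_slp[of F Q _ "set ws" ws] y by force
qed

end

section \<open>Finite subfields and the Frobenius map\<close>

lemma (in ring) eval_map_rev_upt:
  assumes "x \<in> carrier R" "\<And>k. c k \<in> carrier R"
  shows "eval (map c (rev [0..<Suc n])) x = (\<Oplus>k\<in>{..n}. c k \<otimes> x [^] k)"
proof (induction n)
  case (Suc n)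
  have "eval (map c (rev [0..<Suc (Suc n)])) x =
      c (Suc n) \<otimes> x [^] Suc n \<oplus> eval (map c (rev [0..<Suc n])) x"
    by simp
  also have "\<dots> = (\<Oplus>k\<in>{..Suc n}. c k \<otimes> x [^] k)"
    unfolding Suc using assms by (subst finsum_Suc) auto
  finally show ?case .
qed (use assms in simp)

text \<open>A nonzero polynomial has at most as many roots as its degree. This count is applied four
  times: to binomial coefficients, to the fixed field of Frobenius, to the trace form and to kernels
  of polynomials in Frobenius.\<close>

lemma (in field) vanishing_finsum_coeffs_zero:
  assumes c: "\<And>k. c k \<in> carrier R" and A: "A \<subseteq> carrier R" "finite A" "n < card A"
    and zero: "\<And>x. x \<in> A \<Longrightarrow> (\<Oplus>k\<in>{..n}. c k \<otimes> x [^] k) = \<zero>"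
    and "k \<le> n"
  shows "c k = \<zero>"
proof (rule ccontr)
  assume "c k \<noteq> \<zero>"
  define p where "p = map c (rev [0..<Suc n])"
  have p: "set p \<subseteq> carrier R" "length p = Suc n" "c k \<in> set p"
    using c \<open>k \<le> n\<close> by (auto simp: p_def less_Suc_eq_le simp del: upt_Suc)
  \<comment> \<open>Leading coefficients may be zero, and \<open>roots\<close> expects a polynomial
    without leading zeros.\<close>
  define P where "P = normalize p"
  have P: "P \<in> carrier (poly_ring R)"
    unfolding P_def univ_poly_carrier[symmetric] using normalize_gives_polynomial[OF p(1)] .
  have "P \<noteq> []"
  proof
    assume "P = []"
    then have "p = replicate (Suc n) \<zero>"
      using normalize_trick[of p] p(2) by (simp add: P_def)
    then show False using p(3) \<open>c k \<noteq> \<zero>\<close> by (metis in_set_replicate)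
  qed
  have "A \<subseteq> set_mset (roots P)"
  proof
    fix x assume x: "x \<in> A"
    have "eval P x = \<zero>"
      using eval_normalize[OF p(1), of x] x A(1) zero[OF x] eval_map_rev_upt[of x c n] c
      by (auto simp: P_def p_def)
    then show "x \<in># roots P"
      using roots_mem_iff_is_root[OF P] \<open>P \<noteq> []\<close> x A(1) by (auto simp: is_root_def)
  qed
  then have "card A \<le> card (set_mset (roots P))"
    by (intro card_mono) auto
  also have "\<dots> \<le> size (roots P)"
    by (metis mset_set_set_mset_msubset finite_set_mset size_mset_mono size_mset_set)
  also have "\<dots> \<le> degree P" by (rule size_roots_le_degree[OF P])
  also have "\<dots> \<le> n" using normalize_length_le[of p] p(2) by (simp add: P_def)
  finally show False using A(3) by simp
qed

text \<open>The binomial theorem with second summand 1; homogeneity later reduces sums in a field to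
  this case.\<close>

lemma (in cring) one_plus_pow:
  assumes x: "x \<in> carrier R"
  shows "(x \<oplus> \<one>) [^] n = (\<Oplus>k\<in>{..n}. [(n choose k)] \<cdot> (x [^] k))"
proof (induction n)
  case (Suc n)
  let ?b = "\<lambda>n k. [(n choose k)] \<cdot> (x [^] k)"
  have "(\<Oplus>k\<in>{..Suc n}. ?b (Suc n) k) = (\<Oplus>k\<in>{..n}. ?b (Suc n) (Suc k)) \<oplus> ?b (Suc n) 0"
    using x by (subst finsum_Suc2) auto
  also have "(\<Oplus>k\<in>{..n}. ?b (Suc n) (Suc k)) =
      (\<Oplus>k\<in>{..n}. ?b n k \<otimes> x \<oplus> ?b n (Suc k))"
    using x by (intro finsum_cong') (auto simp: add.nat_pow_mult[symmetric] add_pow_ldistr)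
  also have "\<dots> = (\<Oplus>k\<in>{..n}. ?b n k \<otimes> x) \<oplus> (\<Oplus>k\<in>{..n}. ?b n (Suc k))"
    using x by (intro finsum_addf) auto
  also have "(\<Oplus>k\<in>{..n}. ?b n k \<otimes> x) = (\<Oplus>k\<in>{..n}. ?b n k) \<otimes> x"
    using x by (intro finsum_ldistr[symmetric]) auto
  also have "(\<Oplus>k\<in>{..n}. ?b n k) \<otimes> x \<oplus> (\<Oplus>k\<in>{..n}. ?b n (Suc k)) \<oplus> ?b (Suc n) 0 =
      (\<Oplus>k\<in>{..n}. ?b n k) \<otimes> x \<oplus> ((\<Oplus>k\<in>{..n}. ?b n (Suc k)) \<oplus> ?b n 0)"
    using x by (subst a_assoc) auto
  also have "(\<Oplus>k\<in>{..n}. ?b n (Suc k)) \<oplus> ?b n 0 = (\<Oplus>k\<in>{..Suc n}. ?b n k)"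
    using x by (subst finsum_Suc2) auto
  also have "\<dots> = (\<Oplus>k\<in>{..n}. ?b n k)"
    using x by (subst finsum_Suc) (auto simp: binomial_eq_0)
  also have "(\<Oplus>k\<in>{..n}. ?b n k) \<otimes> x \<oplus> (\<Oplus>k\<in>{..n}. ?b n k) = (x \<oplus> \<one>) [^] Suc n"
    using x Suc by (simp add: r_distr)
  finally show ?case ..
qed (use x in simp)

locale finite_subfield = field L for L :: "'a ring" (structure) and K +
  assumes K: "subfield K L" and finite_K: "finite K"
begin

abbreviation q :: nat where "q \<equiv> card K"

lemmas K_closed = subfieldE(3)[OF K, THEN subsetD]

lemmas K_subring = subfieldE(1)[OF K]

lemma q_gt_1: "1 < q"
proof -
  have "card {\<zero>, \<one>} \<le> q"
    using subringE(2,3)[OF subfieldE(1)[OF K]] by (intro card_mono finite_K) auto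
  then show ?thesis by simp
qed

lemma K_pow: 
  assumes "x \<in> K" shows "x [^] q = x"
proof (cases "x = \<zero>")
  case True
  then show ?thesis using q_gt_1 by (simp add: nat_pow_zero)
next
  case False
  interpret F: field "L\<lparr>carrier := K\<rparr>" using subfield_iff(2)[OF K] .
  interpret G: group "Multiplicative_Group.mult_of (L\<lparr>carrier := K\<rparr>)" by (rule F.field_mult_group)
  have "x [^]\<^bsub>Multiplicative_Group.mult_of (L\<lparr>carrier := K\<rparr>)\<^esub> order (Multiplicative_Group.mult_of (L\<lparr>carrier := K\<rparr>)) = \<one>"
    using G.pow_order_eq_1[of x] assms False by simp
  then have "x [^]\<^bsub>L\<lparr>carrier := K\<rparr>\<^esub> (q - 1) = \<one>"
    using F.order_mult_of finite_K by (simp add: order_def Multiplicative_Group.nat_pow_mult_of)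
  then have "x [^] (q - 1) = \<one>" by (subst nat_pow_consistent[of x "q - 1" K])
  then show ?thesis
    using q_gt_1 assms K_closed nat_pow_Suc[of x "q - 1"] by simp
qed

text \<open>For x in \<open>K\<close> both x + 1 and x are fixed by the power \<open>q\<close>, so
  the middle terms of the expansion of (x + 1)^q cancel. They form a polynomial of degree below
  \<open>q\<close> with \<open>q\<close> roots, hence with zero coefficients. In this way
  \<open>q\<close> need not be identified as a power of the characteristic.\<close>

lemma binomial_zero:
  assumes "0 < k" "k < q"
  shows "[(q choose k)] \<cdot> \<one> = \<zero>"
proof -
  define c where "c k = (if k = 0 then \<zero> else [(q choose k)] \<cdot> \<one>)" for k
  have c: "c k \<in> carrier L" for k by (auto simp: c_def)
  have "(\<Oplus>k\<in>{..q - 1}. c k \<otimes> x [^] k) = \<zero>" if x: "x \<in> K" for x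
  proof -
    have xc: "x \<in> carrier L" using x K_closed by blast
    have "x \<oplus> \<one> \<in> K" using x subringE(3,7)[OF subfieldE(1)[OF K]] by blast
    then have "x \<oplus> \<one> = (x \<oplus> \<one>) [^] q" by (rule K_pow[symmetric])
    also have "\<dots> = (\<Oplus>k\<in>{..Suc (q - 1)}. [(q choose k)] \<cdot> (x [^] k))"
      using one_plus_pow[OF xc, of q] q_gt_1 by simp
    also have "\<dots> = x [^] q \<oplus> (\<Oplus>k\<in>{..q - 1}. [(q choose k)] \<cdot> (x [^] k))"
      using xc q_gt_1 by (subst finsum_Suc) auto
    also have "(\<Oplus>k\<in>{..q - 1}. [(q choose k)] \<cdot> (x [^] k)) =
        (\<Oplus>k\<in>{..q - 1}. c k \<otimes> x [^] k \<oplus> (if 0 = k then \<one> else \<zero>))"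
      using xc by (intro finsum_cong') (auto simp: c_def add_pow_ldistr)
    also have "\<dots> = (\<Oplus>k\<in>{..q - 1}. c k \<otimes> x [^] k) \<oplus> (\<Oplus>k\<in>{..q - 1}. if 0 = k then \<one> else \<zero>)"
      using xc c by (intro finsum_addf) auto
    also have "(\<Oplus>k\<in>{..q - 1}. if 0 = k then \<one> else \<zero>) = \<one>"
      by (rule finsum_singleton[where f = "\<lambda>_. \<one>"]) auto
    finally have "x \<oplus> \<one> = x \<oplus> ((\<Oplus>k\<in>{..q - 1}. c k \<otimes> x [^] k) \<oplus> \<one>)"
      using K_pow[OF x] by simp
    moreover have S: "(\<Oplus>k\<in>{..q - 1}. c k \<otimes> x [^] k) \<in> carrier L"
      using xc c by (intro finsum_closed) auto
    ultimately have "\<zero> \<oplus> \<one> = (\<Oplus>k\<in>{..q - 1}. c k \<otimes> x [^] k) \<oplus> \<one>"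
      using xc by (simp add: add.l_cancel)
    then show ?thesis using S by (simp del: l_zero)
  qed
  then have "c k = \<zero>"
    using vanishing_finsum_coeffs_zero[of c K "q - 1" k] c finite_K K_closed q_gt_1 assms
    by (auto simp: subset_iff)
  then show ?thesis using assms by (simp add: c_def)
qed

text \<open>\<open>binomial_zero\<close> speaks of multiples of 1 and so applies to elements outside
  \<open>K\<close> as well. For nonzero y, write x + y = (x / y + 1) y.\<close>

lemma frobenius_add:
  assumes x: "x \<in> carrier L" and y: "y \<in> carrier L"
  shows "(x \<oplus> y) [^] q = x [^] q \<oplus> y [^] q"
proof (cases "y = \<zero>")
  case True
  then show ?thesis using x q_gt_1 by (simp add: nat_pow_zero)
next
  case False
  have one: "(z \<oplus> \<one>) [^] q = z [^] q \<oplus> \<one>" if z: "z \<in> carrier L" for z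
  proof -
    have "(\<Oplus>k\<in>{..q - 1}. [(q choose k)] \<cdot> (z [^] k)) = (\<Oplus>k\<in>{..q - 1}. if 0 = k then \<one> else \<zero>)"
    proof (intro finsum_cong')
      fix k assume "k \<in> {..q - 1}"
      moreover have "[(q choose k)] \<cdot> (z [^] k) = ([(q choose k)] \<cdot> \<one>) \<otimes> z [^] k"
        using z by (simp add: add_pow_ldistr)
      ultimately show "[(q choose k)] \<cdot> (z [^] k) = (if 0 = k then \<one> else \<zero>)"
        using z binomial_zero[of k] q_gt_1 by (cases "k = 0") auto
    qed auto
    also have "\<dots> = \<one>"
      by (rule finsum_singleton[where f = "\<lambda>_. \<one>"]) auto
    finally have "(\<Oplus>k\<in>{..q - 1}. [(q choose k)] \<cdot> (z [^] k)) = \<one>" .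
    moreover have "(z \<oplus> \<one>) [^] q = (\<Oplus>k\<in>{..Suc (q - 1)}. [(q choose k)] \<cdot> (z [^] k))"
      using one_plus_pow[OF z, of q] q_gt_1 by simp
    moreover have "\<dots> = z [^] q \<oplus> (\<Oplus>k\<in>{..q - 1}. [(q choose k)] \<cdot> (z [^] k))"
      using z q_gt_1 by (subst finsum_Suc) auto
    ultimately show ?thesis by simp
  qed
  define z where "z = x \<otimes> inv y"
  have "y \<in> Units L" using y False by (simp add: field_Units)
  then have z: "z \<in> carrier L" "x = z \<otimes> y" using x y by (simp_all add: z_def m_assoc)
  have "x \<oplus> y = (z \<oplus> \<one>) \<otimes> y" using z y by (simp add: l_distr)
  then have "(x \<oplus> y) [^] q = (z [^] q \<oplus> \<one>) \<otimes> y [^] q"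
    using z y one[OF z(1)] by (simp add: nat_pow_distrib)
  also have "\<dots> = x [^] q \<oplus> y [^] q" using z y by (simp add: l_distr nat_pow_distrib)
  finally show ?thesis .
qed

lemma pow_q_Suc: "x \<in> carrier L \<Longrightarrow> x [^] (q ^ Suc j) = (x [^] (q ^ j)) [^] q"
  by (simp add: nat_pow_pow mult.commute)

lemma frobenius_pow_add:
  assumes "x \<in> carrier L" "y \<in> carrier L"
  shows "(x \<oplus> y) [^] (q ^ j) = x [^] (q ^ j) \<oplus> y [^] (q ^ j)"
proof (induction j)
  case (Suc j)
  then show ?case using assms by (simp only: pow_q_Suc a_closed frobenius_add nat_pow_closed)
qed (use assms in simp)

lemma frobenius_pow_finsum:
  assumes "finite A" "f \<in> A \<rightarrow> carrier L"
  shows "(\<Oplus>a\<in>A. f a) [^] (q ^ j) = (\<Oplus>a\<in>A. f a [^] (q ^ j))"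
  using assms
proof (induction A rule: finite_induct)
  case empty
  have "q ^ j \<noteq> 0" using q_gt_1 by simp
  then show ?case by (simp add: nat_pow_zero)
next
  case (insert a A)
  then show ?case by (simp add: Pi_iff frobenius_pow_add)
qed

lemma K_pow_pow: "x \<in> K \<Longrightarrow> x [^] (q ^ j) = x"
  by (induction j) (simp_all only: pow_q_Suc K_closed K_pow, simp add: K_closed)

text \<open>Otherwise y^q - y, of degree \<open>q\<close>, would vanish at the q + 1 elements of
  \<open>insert x K\<close>.\<close>

lemma fixed_in_K:
  assumes x: "x \<in> carrier L" "x [^] q = x"
  shows "x \<in> K"
proof (rule ccontr)
  assume "x \<notin> K"
  define c where "c k = (if k = q then \<one> else if k = 1 then \<ominus> \<one> else \<zero>)" for k :: nat
  have c: "c k \<in> carrier L" for k by (auto simp: c_def)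
  have "(\<Oplus>k\<in>{..q}. c k \<otimes> y [^] k) = \<zero>" if "y \<in> insert x K" for y
  proof -
    have y: "y \<in> carrier L" "y [^] q = y" using that x K_closed K_pow by auto
    have "(\<Oplus>k\<in>{..q}. c k \<otimes> y [^] k) =
        (\<Oplus>k\<in>{..q}. (if q = k then y [^] k else \<zero>) \<oplus> (if 1 = k then \<ominus> (y [^] k) else \<zero>))"
      using y q_gt_1 by (intro finsum_cong') (auto simp: c_def l_minus)
    also have "\<dots> = (\<Oplus>k\<in>{..q}. if q = k then y [^] k else \<zero>) \<oplus>
        (\<Oplus>k\<in>{..q}. if 1 = k then \<ominus> (y [^] k) else \<zero>)"
      using y by (intro finsum_addf) auto
    also have "(\<Oplus>k\<in>{..q}. if q = k then y [^] k else \<zero>) = y [^] q"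
      using y by (intro finsum_singleton) auto
    also have "(\<Oplus>k\<in>{..q}. if 1 = k then \<ominus> (y [^] k) else \<zero>) = \<ominus> (y [^] (1::nat))"
      using y q_gt_1 by (intro finsum_singleton[where f = "\<lambda>k. \<ominus> (y [^] k)"]) auto
    finally show ?thesis using y by (simp add: r_neg)
  qed
  then have "c q = \<zero>"
    using vanishing_finsum_coeffs_zero[of c "insert x K" q q] c x finite_K K_closed \<open>x \<notin> K\<close>
    by auto
  then show False by (simp add: c_def)
qed

end

section \<open>Trace form\<close>

lemma (in abelian_monoid) finsum_bij_betw:
  assumes "bij_betw h A B" "\<And>b. b \<in> B \<Longrightarrow> f b \<in> carrier G"
  shows "(\<Oplus>a\<in>A. f (h a)) = (\<Oplus>b\<in>B. f b)"
  using assms finsum_reindex[of f h A] by (auto simp: bij_betw_def)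

lemma (in abelian_monoid) finsum_swap:
  assumes "finite A" "finite B" "\<And>a b. a \<in> A \<Longrightarrow> b \<in> B \<Longrightarrow> f a b \<in> carrier G"
  shows "(\<Oplus>a\<in>A. \<Oplus>b\<in>B. f a b) = (\<Oplus>b\<in>B. \<Oplus>a\<in>A. f a b)"
  using assms(1,3)
proof (induction A rule: finite_induct)
  case (insert a A)
  have "(\<Oplus>a\<in>insert a A. \<Oplus>b\<in>B. f a b) = (\<Oplus>b\<in>B. f a b) \<oplus> (\<Oplus>b\<in>B. \<Oplus>a\<in>A. f a b)"
    using insert assms(2) by (subst finsum_insert) auto
  also have "\<dots> = (\<Oplus>b\<in>B. f a b \<oplus> (\<Oplus>a\<in>A. f a b))"
    using insert by (intro finsum_addf[symmetric]) auto
  also have "\<dots> = (\<Oplus>b\<in>B. \<Oplus>a\<in>insert a A. f a b)"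
    using insert by (intro finsum_cong') (auto intro!: finsum_insert[symmetric])
  finally show ?case .
qed simp

lemma bij_betw_add_mod: "bij_betw (\<lambda>k. (i + k) mod m) {..<m} {..<m :: nat}"
proof -
  have inj: "inj_on (\<lambda>k. (i + k) mod m) {..<m}"
  proof (rule linorder_inj_onI')
    fix k l assume "k \<in> {..<m}" "l \<in> {..<m}" "k < l"
    then have "\<not> m dvd (i + l) - (i + k)" by (auto dest: dvd_imp_le)
    then show "(i + k) mod m \<noteq> (i + l) mod m"
      using \<open>k < l\<close> mod_eq_dvd_iff_nat[of "i + k" "i + l" m] by auto
  qed
  then show ?thesis
    unfolding bij_betw_def
    by (intro conjI endo_inj_surj) (auto intro: mod_less_divisor)
qed

locale basis_extension = finite_subfield L K for L :: "'a ring" (structure) and K +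
  fixes m :: nat and u :: "nat \<Rightarrow> 'a"
  assumes m_pos: "0 < m"
    and indep: "independent K (map u [0..<m])"
    and span: "Span K (map u [0..<m]) = ext_field L K m"
begin

abbreviation E :: "'a set" where "E \<equiv> ext_field L K m"

abbreviation fr :: "nat \<Rightarrow> 'a \<Rightarrow> 'a" where "fr j x \<equiv> x [^] (q ^ j)"

section \<open>Coordinates in the basis\<close>

definition val :: "(nat \<Rightarrow> 'a) \<Rightarrow> 'a" where "val x = (\<Oplus>k\<in>{..<m}. x k \<otimes> u k)"

lemma u_closed: "k < m \<Longrightarrow> u k \<in> carrier L"
  using independent_in_carrier[OF indep] by auto

lemma u_in_E: "k < m \<Longrightarrow> u k \<in> E"
  unfolding span[symmetric] using u_closed by (intro Span_base_incl[OF K, THEN subsetD]) auto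

lemma combine_eq_finsum:
  assumes "\<And>k. k < n \<Longrightarrow> x k \<in> carrier L" "\<And>k. k < n \<Longrightarrow> v k \<in> carrier L"
  shows "combine (map x [0..<n]) (map v [0..<n]) = (\<Oplus>k\<in>{..<n}. x k \<otimes> v k)"
  using assms
proof (induction n)
  case (Suc n)
  have "combine (map x [0..<Suc n]) (map v [0..<Suc n]) =
      combine (map x [0..<n]) (map v [0..<n]) \<oplus> combine [x n] [v n]"
    using Suc.prems by (subst combine_append) (auto intro: less_SucI)
  then show ?case
    using Suc by (simp add: lessThan_Suc a_comm Pi_iff)
qed simp

lemma val_eq_combine: "(\<And>k. k < m \<Longrightarrow> x k \<in> K) \<Longrightarrow> val x = combine (map x [0..<m]) (map u [0..<m])"
  unfolding val_def using u_closed K_closed by (intro combine_eq_finsum[symmetric]) auto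

lemma val_closed: "(\<And>k. k < m \<Longrightarrow> x k \<in> K) \<Longrightarrow> val x \<in> E"
proof -
  assume x: "\<And>k. k < m \<Longrightarrow> x k \<in> K"
  have "set (map x [0..<m]) \<subseteq> K" using x by auto
  then have "val x \<in> Span K (map u [0..<m])"
    using val_eq_combine[OF x] u_closed
    by (intro iffD2[OF Span_mem_iff_length_version[OF K]] exI[of _ "map x [0..<m]"]) auto
  then show ?thesis using span by simp
qed

lemma coords_exist:
  assumes "y \<in> E"
  shows "\<exists>x. (\<forall>k. x k \<in> K) \<and> val x = y"
proof -
  obtain Ks where Ks: "set Ks \<subseteq> K" "length Ks = m" "y = combine Ks (map u [0..<m])"
    using assms Span_mem_iff_length_version[OF K, of "map u [0..<m]" y] u_closed
    unfolding span[symmetric] by (auto simp del: Span.simps simp: image_subset_iff)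
  define x where "x k = (if k < m then Ks ! k else \<zero>)" for k
  have x: "x k \<in> K" for k
    using Ks subringE(2)[OF K_subring] nth_mem by (fastforce simp: x_def)
  have "map x [0..<m] = Ks" using Ks(2) by (auto simp: x_def intro: nth_equalityI)
  then have "val x = y" using val_eq_combine[OF x] Ks(3) by simp
  then show ?thesis using x by blast
qed

lemma val_minus:
  assumes "\<And>k. k < m \<Longrightarrow> x k \<in> K" "\<And>k. k < m \<Longrightarrow> y k \<in> K"
  shows "val (\<lambda>k. x k \<ominus> y k) \<oplus> val y = val x"
proof -
  have "val (\<lambda>k. x k \<ominus> y k) \<oplus> val y = (\<Oplus>k\<in>{..<m}. (x k \<ominus> y k) \<otimes> u k \<oplus> y k \<otimes> u k)"
    unfolding val_def using assms u_closed K_closed by (intro finsum_addf[symmetric]) auto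
  also have "\<dots> = val x"
    unfolding val_def using assms u_closed K_closed
    by (intro finsum_cong') (auto simp: l_distr[symmetric] minus_eq a_assoc l_neg)
  finally show ?thesis .
qed

lemma coords_unique:
  assumes x: "\<And>k. k < m \<Longrightarrow> x k \<in> K" and y: "\<And>k. k < m \<Longrightarrow> y k \<in> K"
    and "val x = val y" "k < m"
  shows "x k = y k"
proof -
  let ?d = "\<lambda>k. x k \<ominus> y k"
  have d: "?d k \<in> K" if "k < m" for k
    using x[OF that] y[OF that] subringE(5,7)[OF K_subring] by (auto simp: minus_eq)
  have cl: "val v \<in> carrier L" if "\<And>k. k < m \<Longrightarrow> v k \<in> K" for v
    unfolding val_def using that u_closed K_closed by (intro finsum_closed) auto
  have "val ?d \<in> carrier L" by (rule cl) (rule d)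
  moreover have "val y \<in> carrier L" by (rule cl) (rule y)
  moreover have "val ?d \<oplus> val y = val y"
    unfolding assms(3)[symmetric] by (rule val_minus[of x y, unfolded assms(3)[symmetric]]) (fact x y)+
  ultimately have "val ?d = \<zero>"
    using add.right_cancel[of "val y" "val ?d" \<zero>] by (metis l_zero zero_closed)
  then have "combine (map ?d [0..<m]) (map u [0..<m]) = \<zero>"
    using val_eq_combine[of ?d] d by metis
  then have "set (map ?d [0..<m]) \<subseteq> {\<zero>}"
    using independent_imp_trivial_combine[OF K indep, of "map ?d [0..<m]"] d
    by (auto simp: image_subset_iff)
  then have "?d k = \<zero>" using \<open>k < m\<close> by (auto simp: image_subset_iff)
  then show ?thesis using x y \<open>k < m\<close> K_closed by auto
qed

section \<open>Arithmetic of the extension field\<close>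

lemma E_closed: "x \<in> E \<Longrightarrow> x \<in> carrier L" and fr_m: "x \<in> E \<Longrightarrow> fr m x = x"
  by (auto simp: ext_field_def)

lemma fr_add: "x \<in> carrier L \<Longrightarrow> fr i (fr j x) = fr (i + j) x"
  by (simp add: nat_pow_pow power_add mult.commute)

lemma fr_mult: "x \<in> carrier L \<Longrightarrow> y \<in> carrier L \<Longrightarrow> fr i (x \<otimes> y) = fr i x \<otimes> fr i y"
  by (rule nat_pow_distrib)

lemma fr_zero: "fr i \<zero> = \<zero>"
  using q_gt_1 by (simp add: nat_pow_zero)

lemma fr_closed: "x \<in> E \<Longrightarrow> fr i x \<in> E"
  using fr_add[of x m i] fr_add[of x i m] by (auto simp: ext_field_def add.commute)

lemma E_mult: "x \<in> E \<Longrightarrow> y \<in> E \<Longrightarrow> x \<otimes> y \<in> E"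
  by (auto simp: ext_field_def fr_mult)

lemma E_add: "x \<in> E \<Longrightarrow> y \<in> E \<Longrightarrow> x \<oplus> y \<in> E"
  by (auto simp: ext_field_def frobenius_pow_add)

lemma E_zero: "\<zero> \<in> E" and E_one: "\<one> \<in> E"
  using fr_zero by (auto simp: ext_field_def)

lemma minus_add_cancel: "x \<in> carrier L \<Longrightarrow> y \<in> carrier L \<Longrightarrow> (x \<ominus> y) \<oplus> y = x"
  by (simp add: minus_eq a_assoc l_neg)

text \<open>Additivity of Frobenius is known for sums, so the difference is treated by adding y back
  and cancelling.\<close>

lemma E_minus:
  assumes "x \<in> E" "y \<in> E"
  shows "x \<ominus> y \<in> E"
proof -
  note c = E_closed[OF assms(1)] E_closed[OF assms(2)]
  have "fr m (x \<ominus> y) \<oplus> fr m y = fr m ((x \<ominus> y) \<oplus> y)"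
    using c by (intro frobenius_pow_add[symmetric]) auto
  also have "\<dots> = x" unfolding minus_add_cancel[OF c] by (rule fr_m[OF assms(1)])
  also have "\<dots> = (x \<ominus> y) \<oplus> fr m y" unfolding fr_m[OF assms(2)] by (rule minus_add_cancel[OF c, symmetric])
  finally have "fr m (x \<ominus> y) = x \<ominus> y" using c by (subst (asm) add.right_cancel) auto
  then show ?thesis using c by (auto simp: ext_field_def)
qed

lemma E_finsum: "finite A \<Longrightarrow> (\<And>a. a \<in> A \<Longrightarrow> f a \<in> E) \<Longrightarrow> (\<Oplus>a\<in>A. f a) \<in> E"
proof (induction A rule: finite_induct)
  case (insert a A)
  then show ?case by (subst finsum_insert) (auto simp: E_add E_closed)
qed (simp add: E_zero)

lemma K_subset_E: "x \<in> K \<Longrightarrow> x \<in> E"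
  using K_pow_pow K_closed by (auto simp: ext_field_def)

lemma fr_mod: "x \<in> E \<Longrightarrow> fr (i mod m) x = fr i x"
proof (induction i rule: less_induct)
  case (less i)
  show ?case
  proof (cases "i < m")
    case False
    then have "fr i x = fr (i - m) (fr m x)" using fr_add[of x m "i - m"] E_closed[OF less.prems]
      by (simp add: add.commute)
    also have "\<dots> = fr (i mod m) x"
      using less False m_pos by (simp add: fr_m le_mod_geq)
    finally show ?thesis ..
  qed simp
qed

lemma fr_cong: "x \<in> E \<Longrightarrow> i mod m = j mod m \<Longrightarrow> fr i x = fr j x"
  using fr_mod[of x i] fr_mod[of x j] by simp

lemma card_E: "card E = q ^ m"
proof -
  have "bij_betw val ({..<m} \<rightarrow>\<^sub>E K) E"
    unfolding bij_betw_def
  proof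
    show "inj_on val ({..<m} \<rightarrow>\<^sub>E K)"
    proof (rule inj_onI)
      fix x y assume x: "x \<in> {..<m} \<rightarrow>\<^sub>E K" and y: "y \<in> {..<m} \<rightarrow>\<^sub>E K" and eq: "val x = val y"
      show "x = y"
        by (rule PiE_ext[OF x y], rule coords_unique[OF _ _ eq]) (use x y in auto)
    qed
    show "val ` ({..<m} \<rightarrow>\<^sub>E K) = E"
    proof
      show "E \<subseteq> val ` ({..<m} \<rightarrow>\<^sub>E K)"
      proof
        fix y assume "y \<in> E"
        then obtain x where x: "\<And>k. x k \<in> K" "val x = y" using coords_exist by blast
        moreover have "val (restrict x {..<m}) = val x"
          unfolding val_def using x u_closed K_closed by (intro finsum_cong') auto
        ultimately show "y \<in> val ` ({..<m} \<rightarrow>\<^sub>E K)" 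

          by (intro image_eqI[of _ _ "restrict x {..<m}"]) (simp_all add: restrict_PiE_iff)
      qed
    qed (auto intro: val_closed)
  qed
  then show ?thesis using bij_betw_same_card card_PiE[of "{..<m}" "\<lambda>_. K"] by fastforce
qed

lemma finite_E: "finite E"
  using card_E q_gt_1 by (metis card.infinite gr_implies_not0 power_eq_0_iff)

section \<open>The trace from \<open>E\<close> to \<open>K\<close>\<close>

definition tr :: "'a \<Rightarrow> 'a" where "tr x = (\<Oplus>k\<in>{..<m}. fr k x)"

lemma tr_shift:
  assumes "x \<in> E"
  shows "(\<Oplus>k\<in>{..<m}. fr (i + k) x) = tr x"
proof -
  have "(\<Oplus>k\<in>{..<m}. fr (i + k) x) = (\<Oplus>k\<in>{..<m}. fr ((i + k) mod m) x)"
    using assms E_closed by (intro finsum_cong') (auto simp: fr_mod)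
  also have "\<dots> = tr x"
    unfolding tr_def using assms E_closed
    by (intro finsum_bij_betw[OF bij_betw_add_mod, where f = "\<lambda>k. fr k x"]) auto
  finally show ?thesis .
qed

lemma fr_tr:
  assumes "x \<in> E"
  shows "fr i (tr x) = tr x"
proof -
  have "fr i (tr x) = (\<Oplus>k\<in>{..<m}. fr i (fr k x))"
    unfolding tr_def using assms E_closed by (intro frobenius_pow_finsum) auto
  also have "\<dots> = (\<Oplus>k\<in>{..<m}. fr (i + k) x)"
    using assms E_closed by (intro finsum_cong') (auto simp: fr_add)
  finally show ?thesis using tr_shift[OF assms] by simp
qed

lemma tr_in_K: "x \<in> E \<Longrightarrow> tr x \<in> K"
  using fr_tr[of x 1] E_closed by (intro fixed_in_K) (auto simp: tr_def)

lemma tr_add: "x \<in> E \<Longrightarrow> y \<in> E \<Longrightarrow> tr (x \<oplus> y) = tr x \<oplus> tr y"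
proof -
  assume "x \<in> E" "y \<in> E"
  then have "tr (x \<oplus> y) = (\<Oplus>k\<in>{..<m}. fr k x \<oplus> fr k y)"
    unfolding tr_def using E_closed by (intro finsum_cong') (auto simp: frobenius_pow_add)
  also have "\<dots> = tr x \<oplus> tr y"
    unfolding tr_def using \<open>x \<in> E\<close> \<open>y \<in> E\<close> E_closed by (intro finsum_addf) auto
  finally show ?thesis .
qed

lemma tr_smult: "c \<in> K \<Longrightarrow> x \<in> E \<Longrightarrow> tr (c \<otimes> x) = c \<otimes> tr x"
proof -
  assume "c \<in> K" "x \<in> E"
  then have "tr (c \<otimes> x) = (\<Oplus>k\<in>{..<m}. c \<otimes> fr k x)"
    unfolding tr_def using E_closed K_closed K_pow_pow by (intro finsum_cong') (auto simp: fr_mult)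
  also have "\<dots> = c \<otimes> tr x"
    unfolding tr_def using \<open>c \<in> K\<close> \<open>x \<in> E\<close> E_closed K_closed by (intro finsum_rdistr[symmetric]) auto
  finally show ?thesis .
qed

lemma tr_finsum:
  assumes "finite A" "\<And>a. a \<in> A \<Longrightarrow> f a \<in> E"
  shows "tr (\<Oplus>a\<in>A. f a) = (\<Oplus>a\<in>A. tr (f a))"
  using assms
proof (induction A rule: finite_induct)
  case empty
  show ?case by (simp add: tr_def fr_zero)
next
  case (insert a A)
  then have "tr (\<Oplus>a\<in>insert a A. f a) = tr (f a \<oplus> (\<Oplus>a\<in>A. f a))"
    using E_closed by (subst finsum_insert) auto
  also have "\<dots> = tr (f a) \<oplus> (\<Oplus>a\<in>A. tr (f a))"
    using insert by (subst tr_add) (auto intro!: E_finsum)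
  also have "\<dots> = (\<Oplus>a\<in>insert a A. tr (f a))"
    using insert tr_in_K K_closed by (subst finsum_insert) auto
  finally show ?case .
qed

text \<open>As a polynomial in y, the trace of d y has degree at most q^(m - 1) and the coefficient
  d^(q^k) at y^(q^k). It vanishes at the q^m elements of \<open>E\<close>, so all coefficients
  vanish, among them d itself at y^1.\<close>

lemma tr_nondegenerate:
  assumes d: "d \<in> E" and zero: "\<And>y. y \<in> E \<Longrightarrow> tr (d \<otimes> y) = \<zero>"
  shows "d = \<zero>"
proof -
  let ?P = "(\<lambda>k. q ^ k) ` {..<m}"
  define c where "c n = (if n \<in> ?P then d [^] n else \<zero>)" for n :: nat
  have dc: "d \<in> carrier L" using d E_closed by blast
  then have c: "c n \<in> carrier L" for n by (auto simp: c_def)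
  have P: "?P \<subseteq> {..q ^ (m - 1)}" using q_gt_1 m_pos by (auto intro!: power_increasing)
  have "(\<Oplus>n\<in>{..q ^ (m - 1)}. c n \<otimes> y [^] n) = \<zero>" if y: "y \<in> E" for y
  proof -
    have yc: "y \<in> carrier L" using y E_closed by blast
    have "(\<Oplus>n\<in>{..q ^ (m - 1)}. c n \<otimes> y [^] n) = (\<Oplus>n\<in>?P. c n \<otimes> y [^] n)"
      using P yc c by (intro add.finprod_mono_neutral_cong_right) (auto simp: c_def)
    also have "\<dots> = (\<Oplus>n\<in>?P. (d \<otimes> y) [^] n)"
      using yc dc by (intro finsum_cong') (auto simp: c_def nat_pow_distrib)
    also have "\<dots> = (\<Oplus>k\<in>{..<m}. fr k (d \<otimes> y))"
      using yc dc q_gt_1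
      by (intro finsum_bij_betw[symmetric, of "\<lambda>k. q ^ k"]) (auto simp: bij_betw_def inj_on_def)
    finally show ?thesis using zero[OF y] by (simp add: tr_def)
  qed
  moreover have "q ^ (m - 1) < card E"
    using card_E q_gt_1 m_pos by (simp add: power_strict_increasing)
  ultimately have "c 1 = \<zero>"
    using vanishing_finsum_coeffs_zero[of c E "q ^ (m - 1)" 1] c finite_E E_closed q_gt_1
    by (auto simp: Suc_le_eq)
  moreover have "1 \<in> ?P" using m_pos by (auto intro: image_eqI[of _ _ 0])
  ultimately show ?thesis using dc by (simp add: c_def)
qed

text \<open>Nondegeneracy makes g determined by its traces against the basis. There are q^m elements
  g and q^m value vectors, so every vector occurs.\<close>

lemma tr_form_surj:
  assumes t: "\<And>k. k < m \<Longrightarrow> t k \<in> K"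
  shows "\<exists>g\<in>E. \<forall>k<m. tr (g \<otimes> u k) = t k"
proof -
  note u = u_in_E
  let ?F = "\<lambda>g. \<lambda>k\<in>{..<m}. tr (g \<otimes> u k)"
  have "inj_on ?F E"
  proof (rule inj_onI)
    fix g h assume g: "g \<in> E" and h: "h \<in> E" and eq: "?F g = ?F h"
    have d: "g \<ominus> h \<in> E" using g h by (rule E_minus)
    have "tr ((g \<ominus> h) \<otimes> u k) = \<zero>" if k: "k < m" for k
    proof -
      have "tr ((g \<ominus> h) \<otimes> u k) \<oplus> tr (h \<otimes> u k) = tr ((g \<ominus> h) \<otimes> u k \<oplus> h \<otimes> u k)"
        using tr_add E_mult d h u[OF k] by simp
      also have "(g \<ominus> h) \<otimes> u k \<oplus> h \<otimes> u k = g \<otimes> u k"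
        using g h E_closed u_closed[OF k] by (simp add: l_distr[symmetric] minus_eq a_assoc l_neg)
      also have "tr (g \<otimes> u k) = \<zero> \<oplus> tr (h \<otimes> u k)"
        using fun_cong[OF eq, of k] k tr_in_K K_closed E_mult h u[OF k] by simp
      finally show ?thesis
        using tr_in_K K_closed E_mult h d u[OF k] by (metis add.right_cancel zero_closed)
    qed
    then have "tr ((g \<ominus> h) \<otimes> y) = \<zero>" if "y \<in> E" for y
    proof -
      obtain x where x: "\<And>k. x k \<in> K" "val x = y" using coords_exist[OF \<open>y \<in> E\<close>] by blast
      have "(g \<ominus> h) \<otimes> y = (\<Oplus>k\<in>{..<m}. (g \<ominus> h) \<otimes> (x k \<otimes> u k))"
        unfolding x(2)[symmetric] val_def
        using x(1) K_closed u_closed E_closed[OF d] by (intro finsum_rdistr) auto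
      also have "\<dots> = (\<Oplus>k\<in>{..<m}. x k \<otimes> ((g \<ominus> h) \<otimes> u k))"
        using x(1) K_closed u_closed E_closed[OF d] by (intro finsum_cong') (auto simp: m_lcomm)
      also have "tr \<dots> = (\<Oplus>k\<in>{..<m}. tr (x k \<otimes> ((g \<ominus> h) \<otimes> u k)))"
        using x(1) K_subset_E E_mult u d by (intro tr_finsum) auto
      also have "\<dots> = (\<Oplus>k\<in>{..<m}. \<zero>)"
        using x(1) E_mult u d K_closed \<open>\<And>k. k < m \<Longrightarrow> tr ((g \<ominus> h) \<otimes> u k) = \<zero>\<close>
        by (intro finsum_cong') (auto simp: tr_smult)
      finally show ?thesis by simp
    qed
    from tr_nondegenerate[OF d this] show "g = h" using g h E_closed by simp
  qed
  moreover have "?F ` E \<subseteq> {..<m} \<rightarrow>\<^sub>E K"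
    by (rule image_subsetI) (simp add: restrict_PiE_iff tr_in_K E_mult u)
  moreover have "card E = card ({..<m} \<rightarrow>\<^sub>E K)"
    using card_E by (simp add: card_PiE)
  ultimately have "?F ` E = {..<m} \<rightarrow>\<^sub>E K"
    by (metis card_image card_subset_eq finite_K finite_PiE finite_lessThan)
  moreover have "restrict t {..<m} \<in> {..<m} \<rightarrow>\<^sub>E K" by (simp add: restrict_PiE_iff t)
  ultimately have "restrict t {..<m} \<in> ?F ` E" by (simp only:)
  then obtain g where g: "g \<in> E" "restrict t {..<m} = ?F g" by (rule imageE)
  have "tr (g \<otimes> u k) = t k" if "k < m" for k
    using fun_cong[OF g(2), of k] that by simp
  then show ?thesis using g(1) by blast
qed

section \<open>Normal basis theorem\<close>


text \<open>These are the submodules of \<open>E\<close> when the variable of K[X] acts as the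
  Frobenius map.\<close>

definition frob_subspace :: "'a set \<Rightarrow> bool" where
  "frob_subspace W \<longleftrightarrow> W \<subseteq> E \<and> \<zero> \<in> W \<and> (\<forall>x\<in>W. \<forall>y\<in>W. x \<oplus> y \<in> W) \<and>
     (\<forall>c\<in>K. \<forall>x\<in>W. c \<otimes> x \<in> W) \<and> (\<forall>x\<in>W. fr 1 x \<in> W)"

definition functional :: "('a \<Rightarrow> 'a) \<Rightarrow> bool" where
  "functional \<phi> \<longleftrightarrow> (\<forall>x\<in>E. \<phi> x \<in> K) \<and> (\<forall>x\<in>E. \<forall>y\<in>E. \<phi> (x \<oplus> y) = \<phi> x \<oplus> \<phi> y) \<and>
     (\<forall>c\<in>K. \<forall>x\<in>E. \<phi> (c \<otimes> x) = c \<otimes> \<phi> x)"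

text \<open>For linear \<open>\<phi>\<close> this is the largest Frobenius-stable subspace inside
  its kernel. Once it is zero, the element representing \<open>\<phi>\<close> by the trace form
  generates a normal basis.\<close>

definition orbit_ker :: "('a \<Rightarrow> 'a) \<Rightarrow> 'a set" where
  "orbit_ker \<phi> = {x \<in> E. \<forall>d. \<phi> (fr d x) = \<zero>}"

text \<open>The action on x of an ordinary polynomial with coefficients c. Coefficients from
  \<open>K\<close> are fixed by Frobenius, so the operator is linear over \<open>K\<close> and
  commutes with Frobenius.\<close>

definition frob_poly :: "(nat \<Rightarrow> 'a) \<Rightarrow> nat \<Rightarrow> 'a \<Rightarrow> 'a" where
  "frob_poly c n x = (\<Oplus>i\<in>{..n}. c i \<otimes> fr i x)"

lemma functional_zero: "functional \<phi> \<Longrightarrow> \<phi> \<zero> = \<zero>"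
proof -
  assume "functional \<phi>"
  then have "\<phi> (\<zero> \<otimes> \<zero>) = \<zero> \<otimes> \<phi> \<zero>" "\<phi> \<zero> \<in> K"
    using E_zero subringE(2)[OF K_subring] by (auto simp: functional_def simp del: l_null r_null)
  then show ?thesis using K_closed by simp
qed

lemma frob_subspace_fr: "frob_subspace W \<Longrightarrow> x \<in> W \<Longrightarrow> fr d x \<in> W"
proof (induction d)
  case 0
  then show ?case using E_closed by (auto simp: frob_subspace_def)
next
  case (Suc d)
  then have "fr d x \<in> W" "x \<in> E" by (auto simp: frob_subspace_def)
  then have "fr 1 (fr d x) \<in> W" using Suc.prems(1) by (auto simp: frob_subspace_def)
  then show ?case using fr_add[OF E_closed[OF \<open>x \<in> E\<close>], of d 1] by simp
qed

lemma frob_subspace_finsum: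
  assumes "frob_subspace W" "finite A" "\<And>a. a \<in> A \<Longrightarrow> f a \<in> W"
  shows "(\<Oplus>a\<in>A. f a) \<in> W"
  using assms(2,1,3)
proof (induction A rule: finite_induct)
  case empty
  then show ?case by (simp add: frob_subspace_def)
next
  case (insert a A)
  then have "f x \<in> carrier L" if "x \<in> insert a A" for x
    using that E_closed by (auto simp: frob_subspace_def)
  with insert show ?case by (subst finsum_insert) (auto simp: frob_subspace_def)
qed

lemma frob_subspace_frob_poly:
  assumes "frob_subspace W" "x \<in> W" "\<And>i. c i \<in> K"
  shows "frob_poly c n x \<in> W"
  unfolding frob_poly_def using assms frob_subspace_fr[OF assms(1,2)]
  by (intro frob_subspace_finsum) (auto simp: frob_subspace_def)

lemma frob_subspace_E: "frob_subspace E"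
  unfolding frob_subspace_def
  by (auto simp: E_zero intro: E_add E_mult K_subset_E fr_closed[of _ 1, simplified])

lemma frob_poly_closed: "(\<And>i. c i \<in> K) \<Longrightarrow> x \<in> E \<Longrightarrow> frob_poly c n x \<in> E"
  using frob_subspace_frob_poly[OF frob_subspace_E] by blast

lemma frob_subspace_minus:
  assumes "frob_subspace W" "x \<in> W" "y \<in> W"
  shows "x \<ominus> y \<in> W"
proof -
  have "\<ominus> \<one> \<otimes> y \<in> W"
    using assms subringE(3,5)[OF K_subring] by (auto simp: frob_subspace_def)
  moreover have "\<ominus> \<one> \<otimes> y = \<ominus> y"
    using assms E_closed by (auto simp: frob_subspace_def l_minus)
  ultimately show ?thesis using assms by (auto simp: frob_subspace_def minus_eq)
qed

lemma frob_subspace_Int: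
  "frob_subspace V \<Longrightarrow> frob_subspace W \<Longrightarrow> frob_subspace (V \<inter> W)"
  by (auto simp: frob_subspace_def)

lemma frob_poly_add:
  assumes c: "\<And>i. c i \<in> K" and "x \<in> E" "y \<in> E"
  shows "frob_poly c n (x \<oplus> y) = frob_poly c n x \<oplus> frob_poly c n y"
proof -
  note cl = c[THEN K_closed] assms(2,3)[THEN E_closed]
  have "frob_poly c n (x \<oplus> y) = (\<Oplus>i\<in>{..n}. c i \<otimes> fr i x \<oplus> c i \<otimes> fr i y)"
    unfolding frob_poly_def using cl by (intro finsum_cong') (auto simp: frobenius_pow_add r_distr)
  also have "\<dots> = frob_poly c n x \<oplus> frob_poly c n y"
    unfolding frob_poly_def using cl by (intro finsum_addf) auto
  finally show ?thesis .
qed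

lemma frob_poly_smult:
  assumes c: "\<And>i. c i \<in> K" and "k \<in> K" "x \<in> E"
  shows "frob_poly c n (k \<otimes> x) = k \<otimes> frob_poly c n x"
proof -
  note cl = c[THEN K_closed] K_closed[OF assms(2)] assms(3)[THEN E_closed]
  have "frob_poly c n (k \<otimes> x) = (\<Oplus>i\<in>{..n}. k \<otimes> (c i \<otimes> fr i x))"
    unfolding frob_poly_def using cl K_pow_pow[OF assms(2)]
    by (intro finsum_cong') (auto simp: fr_mult m_lcomm)
  also have "\<dots> = k \<otimes> frob_poly c n x"
    unfolding frob_poly_def using cl by (intro finsum_rdistr[symmetric]) auto
  finally show ?thesis .
qed

lemma frob_poly_fr:
  assumes c: "\<And>i. c i \<in> K" and "x \<in> E"
  shows "frob_poly c n (fr d x) = fr d (frob_poly c n x)"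
proof -
  note cl = c[THEN K_closed] assms(2)[THEN E_closed]
  have "fr d (frob_poly c n x) = (\<Oplus>i\<in>{..n}. fr d (c i \<otimes> fr i x))"
    unfolding frob_poly_def using cl by (intro frobenius_pow_finsum) auto
  also have "\<dots> = frob_poly c n (fr d x)"
    unfolding frob_poly_def using cl K_pow_pow[OF c]
    by (intro finsum_cong') (auto simp: fr_mult fr_add add.commute simp del: nat_pow_pow)
  finally show ?thesis ..
qed

lemma frob_poly_zero: "(\<And>i. c i \<in> K) \<Longrightarrow> frob_poly c n \<zero> = \<zero>"
  using frob_poly_smult[of c \<zero> \<zero> n] E_zero subringE(2)[OF K_subring]
    E_closed[OF frob_poly_closed[of c \<zero> n]] by simp

text \<open>Written out in x, the operator is an ordinary polynomial of degree q^n, which bounds its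
  number of roots.\<close>

lemma card_frob_poly_ker:
  assumes c: "\<And>i. c i \<in> K" and "c n \<noteq> \<zero>"
  shows "card {x \<in> E. frob_poly c n x = \<zero>} \<le> q ^ n"
proof (rule ccontr)
  assume "\<not> card {x \<in> E. frob_poly c n x = \<zero>} \<le> q ^ n"
  then have big: "q ^ n < card {x \<in> E. frob_poly c n x = \<zero>}" by simp
  let ?P = "(\<lambda>k. q ^ k) ` {..n}"
  have inj: "inj_on (\<lambda>k. q ^ k) {..n}" using q_gt_1 by (auto simp: inj_on_def)
  define p where "p l = (if l \<in> ?P then c (the_inv_into {..n} (\<lambda>k. q ^ k) l) else \<zero>)" for l
  have pc: "p l \<in> carrier L" for l using c K_closed by (auto simp: p_def)
  have pq: "p (q ^ k) = c k" if "k \<le> n" for k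
    using that the_inv_into_f_f[OF inj] by (auto simp: p_def)
  have P: "?P \<subseteq> {..q ^ n}" using q_gt_1 by (auto intro!: power_increasing)
  have "(\<Oplus>l\<in>{..q ^ n}. p l \<otimes> x [^] l) = \<zero>" if x: "x \<in> {x \<in> E. frob_poly c n x = \<zero>}" for x
  proof -
    have xc: "x \<in> carrier L" using x E_closed by blast
    have "(\<Oplus>l\<in>{..q ^ n}. p l \<otimes> x [^] l) = (\<Oplus>l\<in>?P. p l \<otimes> x [^] l)"
      using P xc pc by (intro add.finprod_mono_neutral_cong_right) (auto simp: p_def)
    also have "\<dots> = (\<Oplus>k\<in>{..n}. p (q ^ k) \<otimes> fr k x)"
      using xc pc inj
      by (intro finsum_bij_betw[symmetric, of "\<lambda>k. q ^ k"]) (auto simp: bij_betw_def)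
    also have "\<dots> = frob_poly c n x"
      unfolding frob_poly_def using xc c K_closed by (intro finsum_cong') (auto simp: pq)
    finally show ?thesis using x by simp
  qed
  then have "p (q ^ n) = \<zero>"
    using vanishing_finsum_coeffs_zero[of p "{x \<in> E. frob_poly c n x = \<zero>}" "q ^ n" "q ^ n"]
      pc finite_E E_closed big by auto
  then show False using pq[of n] assms(2) by simp
qed

lemma orbit_ker_subspace:
  assumes "functional \<phi>"
  shows "frob_subspace (orbit_ker \<phi>)"
  unfolding frob_subspace_def
proof (intro conjI ballI)
  have \<phi>: "\<And>x y. x \<in> E \<Longrightarrow> y \<in> E \<Longrightarrow> \<phi> (x \<oplus> y) = \<phi> x \<oplus> \<phi> y"
    "\<And>c x. c \<in> K \<Longrightarrow> x \<in> E \<Longrightarrow> \<phi> (c \<otimes> x) = c \<otimes> \<phi> x"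
    using assms by (auto simp: functional_def)
  show "orbit_ker \<phi> \<subseteq> E" by (auto simp: orbit_ker_def)
  show "\<zero> \<in> orbit_ker \<phi>" using functional_zero[OF assms] E_zero fr_zero by (auto simp: orbit_ker_def)
  fix x assume x: "x \<in> orbit_ker \<phi>"
  then have xE: "x \<in> E" "x \<in> carrier L" using E_closed by (auto simp: orbit_ker_def)
  { fix y assume "y \<in> orbit_ker \<phi>"
    then show "x \<oplus> y \<in> orbit_ker \<phi>"
      using x E_closed by (auto simp: orbit_ker_def E_add frobenius_pow_add \<phi> fr_closed) }
  show "fr 1 x \<in> orbit_ker \<phi>"
    using x fr_add[OF xE(2), of 1] fr_closed[OF xE(1), of 1]
    unfolding orbit_ker_def by (simp only: mem_Collect_eq simp_thms)
  fix c assume "c \<in> K"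
  then show "c \<otimes> x \<in> orbit_ker \<phi>"
    using x xE K_closed by (auto simp: orbit_ker_def E_mult K_subset_E fr_mult K_pow_pow \<phi> fr_closed)
qed

text \<open>
  Let \<open>S\<close> be a minimal subspace stable under Frobenius in the kernel, \<open>s\<close> a nonzero element of it and
  \<open>r\<close> a polynomial in Frobenius of least degree \<open>n\<close> with \<open>r s = 0\<close>. Both \<open>S\<close> and \<open>ker r\<close> have \<open>q\<^sup>n\<close>
  elements, so they are equal. For an idempotent power \<open>h\<close> of \<open>r\<close>, the functional
  \<open>\<phi> \<circ> h + \<psi> \<circ> (1 - h)\<close> with \<open>\<psi> s \<noteq> 0\<close> loses \<open>S\<close> from its kernel and gains nothing.
\<close>

lemma functional_avoiding:
  assumes \<phi>: "functional \<phi>" and "orbit_ker \<phi> \<noteq> {\<zero>}"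
  shows "\<exists>\<phi>'. functional \<phi>' \<and> orbit_ker \<phi>' \<subset> orbit_ker \<phi>"
proof -
  let ?W = "orbit_ker \<phi>"
  let ?P = "\<lambda>S. frob_subspace S \<and> S \<subseteq> ?W \<and> S \<noteq> {\<zero>}"
  define S where "S = arg_min card ?P"
  have "?P ?W" using orbit_ker_subspace[OF \<phi>] assms(2) by blast
  then have S: "frob_subspace S" "S \<subseteq> ?W" "S \<noteq> {\<zero>}"
    and min: "\<And>T. ?P T \<Longrightarrow> card S \<le> card T"
    unfolding S_def using arg_min_natI[of ?P ?W card] arg_min_nat_le[of ?P _ card] by blast+
  have SE: "S \<subseteq> E" using S(1) by (auto simp: frob_subspace_def)
  \<comment> \<open>\<open>T \<inter> S\<close> is again stable and has a nonzero element, so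
    minimal cardinality makes it all of \<open>S\<close>.\<close>
  have minimal: "S \<subseteq> T" if T: "frob_subspace T" "x \<in> T" "x \<in> S" "x \<noteq> \<zero>" for T x
  proof -
    have "card S \<le> card (T \<inter> S)"
      using S T by (intro min conjI frob_subspace_Int) auto
    then have "T \<inter> S = S"
      using SE finite_E by (intro card_seteq) (auto intro: finite_subset)
    then show ?thesis by blast
  qed
  obtain s where s: "s \<in> S" "s \<noteq> \<zero>" using S(1,3) by (auto simp: frob_subspace_def)
  have sE: "s \<in> E" "s \<in> carrier L" using s SE E_closed by auto
  let ?Q = "\<lambda>n. \<exists>c. (\<forall>i. c i \<in> K) \<and> c n \<noteq> \<zero> \<and> frob_poly c n s = \<zero>"
  have "?Q m"
  proof -
    \<comment> \<open>The polynomial X^m - 1 annihilates \<open>E\<close>, since \<open>fr m\<close>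
      is the identity there.\<close>
    define c where "c i = (if i = m then \<one> else if i = 0 then \<ominus> \<one> else \<zero>)" for i
    have c: "c i \<in> K" for i using subringE(2,3,5)[OF K_subring] by (auto simp: c_def)
    have "frob_poly c m s = (\<Oplus>i\<in>{..m}. (if m = i then s else \<zero>) \<oplus> (if 0 = i then \<ominus> s else \<zero>))"
      unfolding frob_poly_def using sE m_pos fr_m[OF sE(1)]
      by (intro finsum_cong') (auto simp: c_def l_minus)
    also have "\<dots> = (\<Oplus>i\<in>{..m}. if m = i then s else \<zero>) \<oplus> (\<Oplus>i\<in>{..m}. if 0 = i then \<ominus> s else \<zero>)"
      using sE by (intro finsum_addf) auto
    also have "(\<Oplus>i\<in>{..m}. if m = i then s else \<zero>) = s"
      using sE by (intro finsum_singleton[where f = "\<lambda>_. s"]) auto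
    also have "(\<Oplus>i\<in>{..m}. if 0 = i then \<ominus> s else \<zero>) = \<ominus> s"
      using sE by (intro finsum_singleton[where f = "\<lambda>_. \<ominus> s"]) auto
    finally have "frob_poly c m s = \<zero>" using sE by (simp add: r_neg)
    moreover have "c m \<noteq> \<zero>" by (simp add: c_def)
    ultimately show ?thesis using c by blast
  qed
  define n where "n = (LEAST n. ?Q n)"
  obtain c where c: "\<And>i. c i \<in> K" "c n \<noteq> \<zero>" "frob_poly c n s = \<zero>"
    using LeastI[of ?Q, OF \<open>?Q m\<close>] unfolding n_def by blast
  have least: "n \<le> k" if "?Q k" for k unfolding n_def using that by (rule Least_le)
  let ?r = "frob_poly c n"
  let ?N = "{x \<in> E. ?r x = \<zero>}"
  have sub_ker: "frob_subspace ?N"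
    unfolding frob_subspace_def
    using frob_poly_zero[OF c(1)] E_zero E_add E_mult K_subset_E fr_closed[of _ 1] fr_zero[of 1]
    by (auto simp: frob_poly_add c(1) frob_poly_smult frob_poly_fr[OF c(1), where d = 1, simplified] K_closed)
  have "S \<subseteq> ?N" using minimal[OF sub_ker, of s] s sE c(3) by auto
  have "q ^ n \<le> card S"
  proof -
    let ?f = "\<lambda>k. \<Oplus>i\<in>{..<n}. k i \<otimes> fr i s"
    have "inj_on ?f ({..<n} \<rightarrow>\<^sub>E K)"
    proof (rule inj_onI, rule ccontr)
      fix k l assume k: "k \<in> {..<n} \<rightarrow>\<^sub>E K" and l: "l \<in> {..<n} \<rightarrow>\<^sub>E K" and eq: "?f k = ?f l" and "k \<noteq> l"
      have kl: "k i \<in> K" "l i \<in> K" if "i < n" for i using k l that by auto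
      define D where "D = {i. i < n \<and> k i \<noteq> l i}"
      have "D \<noteq> {}" using PiE_ext[OF k l] \<open>k \<noteq> l\<close> by (auto simp: D_def)
      have "finite D" by (simp add: D_def)
      \<comment> \<open>At the last index where \<open>k\<close> and \<open>l\<close> differ, their
        difference has its leading coefficient; it would annihilate \<open>s\<close> with degree
        below the least one.\<close>
      define t where "t = Max D"
      have "t \<in> D" unfolding t_def using \<open>finite D\<close> \<open>D \<noteq> {}\<close> by (rule Max_in)
      then have t: "t < n" "k t \<noteq> l t" by (auto simp: D_def)
      have top: "k i = l i" if "t < i" "i < n" for i
        using that Max_ge[OF \<open>finite D\<close>, of i] by (fastforce simp: t_def D_def)
      define d where "d i = (if i < n then k i \<ominus> l i else \<zero>)" for i
      have d: "d i \<in> K" for i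
        using kl[of i] subringE(2,5,7)[OF K_subring] by (auto simp: d_def minus_eq)
      have "?f k = (\<Oplus>i\<in>{..<n}. d i \<otimes> fr i s \<oplus> l i \<otimes> fr i s)"
        using kl K_closed sE
        by (intro finsum_cong') (auto simp: d_def l_distr[symmetric] minus_add_cancel)
      also have "\<dots> = (\<Oplus>i\<in>{..<n}. d i \<otimes> fr i s) \<oplus> ?f l"
        using kl K_closed sE d by (intro finsum_addf) auto
      finally have "?f l = (\<Oplus>i\<in>{..<n}. d i \<otimes> fr i s) \<oplus> ?f l" unfolding eq .
      moreover have "?f l \<in> carrier L" using kl K_closed sE by (intro finsum_closed) auto
      moreover have "(\<Oplus>i\<in>{..<n}. d i \<otimes> fr i s) \<in> carrier L"
        using K_closed[OF d] sE by (intro finsum_closed) auto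
      ultimately have "(\<Oplus>i\<in>{..<n}. d i \<otimes> fr i s) = \<zero>"
        using add.right_cancel[of "?f l" "\<Oplus>i\<in>{..<n}. d i \<otimes> fr i s" \<zero>] by simp
      moreover have "(\<Oplus>i\<in>{..<n}. d i \<otimes> fr i s) = frob_poly d t s"
        unfolding frob_poly_def using K_closed[OF d] sE t top K_closed[OF kl(2)]
        by (intro add.finprod_mono_neutral_cong_right) (auto simp: d_def not_le minus_eq r_neg)
      moreover have "d t \<noteq> \<zero>" using t kl[OF t(1)] K_closed by (auto simp: d_def)
      ultimately have "?Q t" using d by auto
      then show False using least[of t] t by simp
    qed
    moreover have "?f ` ({..<n} \<rightarrow>\<^sub>E K) \<subseteq> S"
    proof (rule image_subsetI)
      fix k assume "k \<in> {..<n} \<rightarrow>\<^sub>E K"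
      then have "k i \<in> K" if "i < n" for i using that by auto
      then show "?f k \<in> S"
        using S(1) frob_subspace_fr[OF S(1) s(1)]
        by (intro frob_subspace_finsum) (auto simp: frob_subspace_def)
    qed
    ultimately have "card ({..<n} \<rightarrow>\<^sub>E K) \<le> card S"
      using SE finite_E by (intro card_inj_on_le) (auto intro: finite_subset)
    then show ?thesis by (simp add: card_PiE)
  qed
  then have "card ?N \<le> card S" using card_frob_poly_ker[of c n] c(1,2) by force
  then have ker: "?N = S"
    using \<open>S \<subseteq> ?N\<close> finite_E by (intro card_seteq[symmetric]) auto
  have rE: "?r x \<in> E" if "x \<in> E" for x using frob_poly_closed c(1) that by blast
  have rpE: "(?r ^^ k) x \<in> E" if "x \<in> E" for k x using that by (induction k) (auto simp: rE)
  have rp_add: "(?r ^^ k) (x \<oplus> y) = (?r ^^ k) x \<oplus> (?r ^^ k) y" if "x \<in> E" "y \<in> E" for k x y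
    using that by (induction k) (auto simp: frob_poly_add c(1) rpE)
  have rp_smult: "(?r ^^ k) (a \<otimes> x) = a \<otimes> (?r ^^ k) x" if "a \<in> K" "x \<in> E" for k a x
    using that by (induction k) (auto simp: frob_poly_smult c(1) rpE)
  have rp_fr: "(?r ^^ k) (fr d x) = fr d ((?r ^^ k) x)" if "x \<in> E" for k d x
    using that by (induction k) (auto simp: frob_poly_fr c(1) rpE)
  have rp_zero: "(?r ^^ k) \<zero> = \<zero>" for k
    by (induction k) (auto simp: frob_poly_zero c(1))
  have rp_sub: "(?r ^^ k) x \<in> V" if "frob_subspace V" "x \<in> V" for k x V
    using that by (induction k) (auto intro: frob_subspace_frob_poly c(1))
  obtain N where N: "0 < N" "\<And>x. x \<in> E \<Longrightarrow> (?r ^^ N) ((?r ^^ N) x) = (?r ^^ N) x"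
  proof -
    have "\<not> inj (\<lambda>k. restrict (?r ^^ k) E)"
    proof
      assume "inj (\<lambda>k. restrict (?r ^^ k) E)"
      moreover have "range (\<lambda>k. restrict (?r ^^ k) E) \<subseteq> E \<rightarrow>\<^sub>E E"
        by (rule image_subsetI) (simp add: restrict_PiE_iff rpE)
      moreover have "finite (E \<rightarrow>\<^sub>E E)" using finite_E by (simp add: finite_PiE)
      ultimately show False by (metis finite_subset infinite_UNIV_nat finite_imageD)
    qed
    then obtain i j where ij: "i < j" "restrict (?r ^^ i) E = restrict (?r ^^ j) E"
      using linorder_injI[of "\<lambda>k. restrict (?r ^^ k) E"] by blast
    define p where "p = j - i"
    have per: "(?r ^^ (k + p)) x = (?r ^^ k) x" if "x \<in> E" "i \<le> k" for k x
    proof -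
      have "(?r ^^ (k + p)) x = (?r ^^ (k - i)) ((?r ^^ j) x)"
        using that ij(1) by (simp add: p_def flip: funpow_add[THEN fun_cong, unfolded comp_def])
      also have "(?r ^^ j) x = (?r ^^ i) x" using fun_cong[OF ij(2), of x] that by simp
      also have "(?r ^^ (k - i)) ((?r ^^ i) x) = (?r ^^ k) x"
        using that by (simp flip: funpow_add[THEN fun_cong, unfolded comp_def])
      finally show ?thesis .
    qed
    have pers: "(?r ^^ (k + l * p)) x = (?r ^^ k) x" if "x \<in> E" "i \<le> k" for k l x
    proof (induction l)
      case (Suc l)
      then show ?case using per[of x "k + l * p"] that by (simp add: ac_simps)
    qed simp
    \<comment> \<open>The iterates of \<open>?r\<close> have period \<open>p\<close> from index
      \<open>i\<close> on. \<open>?M\<close> is a multiple of \<open>p\<close> not below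
      \<open>i\<close>, so doubling it changes nothing.\<close>
    let ?M = "Suc i * p"
    have "0 < p" using ij(1) by (simp add: p_def)
    then have "i \<le> ?M" by (cases p) auto
    then have "(?r ^^ ?M) ((?r ^^ ?M) x) = (?r ^^ ?M) x" if "x \<in> E" for x
      using pers[OF that, of ?M "Suc i"] by (simp only: funpow_add comp_def)
    then show thesis using that[of ?M] \<open>0 < p\<close> by simp
  qed
  let ?h = "?r ^^ N"
  obtain \<delta> where \<delta>: "\<delta> \<in> E" "tr (\<delta> \<otimes> s) \<noteq> \<zero>"
    using tr_nondegenerate[OF sE(1)] s(2) sE(2) E_closed m_comm by metis
  define \<psi> where "\<psi> x = tr (\<delta> \<otimes> x)" for x
  \<comment> \<open>\<open>?h\<close> is a projection: \<open>\<phi>'\<close> agrees with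
    \<open>\<phi>\<close> where \<open>?h x = x\<close> and with \<open>\<psi>\<close> where
    \<open>?h x = \<zero>\<close>.\<close>
  define \<phi>' where "\<phi>' x = \<phi> (?h x) \<oplus> \<psi> (x \<ominus> ?h x)" for x
  have \<phi>E: "\<And>x. x \<in> E \<Longrightarrow> \<phi> x \<in> K" "\<And>x y. x \<in> E \<Longrightarrow> y \<in> E \<Longrightarrow> \<phi> (x \<oplus> y) = \<phi> x \<oplus> \<phi> y"
    "\<And>c x. c \<in> K \<Longrightarrow> x \<in> E \<Longrightarrow> \<phi> (c \<otimes> x) = c \<otimes> \<phi> x"
    using \<phi> by (auto simp: functional_def)
  have \<psi>E: "\<And>x. x \<in> E \<Longrightarrow> \<psi> x \<in> K" "\<And>x y. x \<in> E \<Longrightarrow> y \<in> E \<Longrightarrow> \<psi> (x \<oplus> y) = \<psi> x \<oplus> \<psi> y"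
    "\<And>c x. c \<in> K \<Longrightarrow> x \<in> E \<Longrightarrow> \<psi> (c \<otimes> x) = c \<otimes> \<psi> x"
    unfolding \<psi>_def using \<delta>(1) E_mult tr_in_K tr_add tr_smult E_closed K_closed
    by (auto simp: r_distr m_lcomm)
  have \<psi>_zero: "\<psi> \<zero> = \<zero>" using \<delta>(1) E_closed by (simp add: \<psi>_def tr_def fr_zero)
  note cl = E_closed E_closed[OF rpE]
  have \<phi>': "functional \<phi>'"
    unfolding functional_def
  proof (intro conjI ballI)
    fix x assume x: "x \<in> E"
    show "\<phi>' x \<in> K"
      using x \<phi>E(1) \<psi>E(1) rpE E_minus subringE(7)[OF K_subring] by (auto simp: \<phi>'_def)
    { fix y assume y: "y \<in> E"
      have "(x \<oplus> y) \<ominus> ?h (x \<oplus> y) = (x \<ominus> ?h x) \<oplus> (y \<ominus> ?h y)"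
        using cl x y by (simp add: rp_add minus_eq minus_add a_ac)
      then show "\<phi>' (x \<oplus> y) = \<phi>' x \<oplus> \<phi>' y"
        using x y \<phi>E \<psi>E rpE E_minus K_closed by (simp add: \<phi>'_def rp_add a_ac) }
    fix k assume k: "k \<in> K"
    have "k \<otimes> x \<ominus> ?h (k \<otimes> x) = k \<otimes> (x \<ominus> ?h x)"
      using cl x k K_closed by (simp add: rp_smult minus_eq r_distr r_minus)
    then show "\<phi>' (k \<otimes> x) = k \<otimes> \<phi>' x"
      using x k \<phi>E \<psi>E rpE E_minus K_closed by (simp add: \<phi>'_def rp_smult r_distr)
  qed
  let ?W' = "orbit_ker \<phi>'"
  have W'E: "x \<in> E" if "x \<in> ?W'" for x using that by (simp add: orbit_ker_def)
  have \<psi>_vanish: "\<psi> (fr d x) = \<zero>" if "x \<in> ?W'" "?h x = \<zero>" for d x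
  proof -
    have "x \<in> E" "\<phi>' (fr d x) = \<zero>" using that(1) by (auto simp: orbit_ker_def)
    moreover have "?h (fr d x) = \<zero>" using rp_fr[OF \<open>x \<in> E\<close>] that(2) fr_zero by simp
    ultimately show ?thesis
      using functional_zero[OF \<phi>] K_closed[OF \<psi>E(1)] cl fr_closed[OF \<open>x \<in> E\<close>]
      by (simp add: \<phi>'_def minus_eq)
  qed
  have trivial: "x = \<zero>" if x: "x \<in> ?W'" "?h x = \<zero>" for x
  proof (rule ccontr)
    assume "x \<noteq> \<zero>"
    let ?T = "?W' \<inter> {x \<in> E. ?h x = \<zero>}"
    have "?h (fr 1 y) = fr 1 (?h y)" if "y \<in> E" for y using that by (rule rp_fr)
    then have "frob_subspace {x \<in> E. ?h x = \<zero>}"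
      unfolding frob_subspace_def
      using rp_zero[of N] E_zero E_add E_mult K_subset_E fr_closed[of _ 1] fr_zero[of 1]
      by (auto simp: rp_add rp_smult K_closed)
    then have T: "frob_subspace ?T" using orbit_ker_subspace[OF \<phi>'] by (intro frob_subspace_Int)
    \<comment> \<open>The last nonzero iterate of \<open>?r\<close> on x is killed by
      \<open>?r\<close>, hence lies in \<open>S\<close>. It also lies in the stable subspace
      \<open>?T\<close>, so by minimality all of \<open>S\<close> does, against
      \<open>\<psi>\<close> being nonzero at \<open>s\<close>.\<close>
    define k where "k = (LEAST k. (?r ^^ k) x = \<zero>)"
    have k: "(?r ^^ k) x = \<zero>" unfolding k_def using x(2) by (rule LeastI)
    then obtain k' where k': "k = Suc k'" using \<open>x \<noteq> \<zero>\<close> by (cases k) auto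
    define y where "y = (?r ^^ k') x"
    have "y \<noteq> \<zero>" using not_less_Least[of k' "\<lambda>k. (?r ^^ k) x = \<zero>"] k' by (auto simp: y_def k_def)
    moreover have "x \<in> ?T" using x W'E by simp
    then have "y \<in> ?T" unfolding y_def by (rule rp_sub[OF T])
    moreover have "?r y = \<zero>" using k k' by (simp add: y_def)
    ultimately have "S \<subseteq> ?T" using minimal[OF T, of y] ker by auto
    then have "\<psi> (fr 0 s) = \<zero>" using \<psi>_vanish s(1) by blast
    then show False using \<delta>(2) sE by (simp add: \<psi>_def)
  qed
  \<comment> \<open>Idempotence sends the component \<open>x \<ominus> ?h x\<close> to zero, and
    stability keeps it in \<open>?W'\<close>, so \<open>trivial\<close> removes it.\<close>
  have fixed: "?h x = x" if x: "x \<in> ?W'" for x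
  proof -
    note xE = W'E[OF x]
    have "x \<ominus> ?h x \<in> ?W'"
      using orbit_ker_subspace[OF \<phi>'] x rp_sub by (intro frob_subspace_minus)
    moreover have "?h (x \<ominus> ?h x) \<oplus> ?h (?h x) = ?h x"
    proof -
      have "?h ((x \<ominus> ?h x) \<oplus> ?h x) = ?h (x \<ominus> ?h x) \<oplus> ?h (?h x)"
        using xE by (intro rp_add E_minus rpE)
      moreover have "(x \<ominus> ?h x) \<oplus> ?h x = x" using cl xE by (intro minus_add_cancel)
      ultimately show ?thesis by (simp only:)
    qed
    then have "?h (x \<ominus> ?h x) \<oplus> ?h x = \<zero> \<oplus> ?h x"
      using N(2)[OF xE] cl xE by simp
    then have "?h (x \<ominus> ?h x) = \<zero>"
      using cl xE E_minus rpE by (subst (asm) add.right_cancel) auto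
    ultimately have "x \<ominus> ?h x = \<zero>" by (rule trivial)
    then show ?thesis using cl xE by simp
  qed
  have "?W' \<subseteq> ?W"
  proof
    fix x assume x: "x \<in> ?W'"
    have "\<phi> (fr d x) = \<zero>" for d
    proof -
      have fx: "fr d x \<in> ?W'" using frob_subspace_fr[OF orbit_ker_subspace[OF \<phi>'] x] .
      then have "\<phi>' (fr 0 (fr d x)) = \<zero>" unfolding orbit_ker_def by blast
      then have "\<phi>' (fr d x) = \<zero>" using W'E[OF fx] E_closed by simp
      then show ?thesis
        using fixed[OF fx] W'E[OF fx] E_closed \<psi>_zero K_closed[OF \<phi>E(1)] by (simp add: \<phi>'_def r_neg minus_eq)
    qed
    then show "x \<in> ?W" using W'E[OF x] by (simp add: orbit_ker_def)
  qed
  moreover have "s \<notin> ?W'"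
  proof
    assume "s \<in> ?W'"
    \<comment> \<open>Since \<open>0 < N\<close>, one factor \<open>?r\<close> can act on
      \<open>s\<close> first, and it kills \<open>s\<close>.\<close>
    moreover have "?h s = (?r ^^ (N - 1)) (?r s)" using N(1) by (metis Suc_diff_1 funpow_Suc_right comp_apply)
    then have "?h s = \<zero>" using c(3) rp_zero by simp
    ultimately show False using trivial s(2) by blast
  qed
  ultimately show ?thesis using \<phi>' s(1) S(2) by blast
qed

text \<open>\<open>tr_form_surj\<close> matches the values on the basis, and linearity carries the
  agreement to all of \<open>E\<close>.\<close>

lemma functional_eq_tr:
  assumes "functional \<phi>"
  shows "\<exists>g\<in>E. \<forall>x\<in>E. \<phi> x = tr (g \<otimes> x)"
proof -
  have \<phi>: "\<And>x. x \<in> E \<Longrightarrow> \<phi> x \<in> K" "\<And>x y. x \<in> E \<Longrightarrow> y \<in> E \<Longrightarrow> \<phi> (x \<oplus> y) = \<phi> x \<oplus> \<phi> y"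
    "\<And>c x. c \<in> K \<Longrightarrow> x \<in> E \<Longrightarrow> \<phi> (c \<otimes> x) = c \<otimes> \<phi> x"
    using assms by (auto simp: functional_def)
  obtain g where g: "g \<in> E" "\<And>k. k < m \<Longrightarrow> tr (g \<otimes> u k) = \<phi> (u k)"
    using tr_form_surj[of "\<lambda>k. \<phi> (u k)"] \<phi>(1) u_in_E by auto
  have "\<phi> (\<Oplus>k\<in>A. x k \<otimes> u k) = tr (g \<otimes> (\<Oplus>k\<in>A. x k \<otimes> u k))"
    if "finite A" "A \<subseteq> {..<m}" "\<And>k. x k \<in> K" for A x
    using that(1,2)
  proof (induction A rule: finite_induct)
    case empty
    then show ?case using functional_zero[OF assms] E_closed[OF g(1)] by (simp add: tr_def fr_zero)
  next
    case (insert k A)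
    then have k: "k < m" "A \<subseteq> {..<m}" by auto
    have E: "x i \<otimes> u i \<in> E" if "i < m" for i
      using that \<open>\<And>k. x k \<in> K\<close> u_in_E K_subset_E by (intro E_mult) auto
    have AE: "(\<Oplus>k\<in>A. x k \<otimes> u k) \<in> E" using insert k(2) E by (intro E_finsum) auto
    have sum: "(\<Oplus>i\<in>insert k A. x i \<otimes> u i) = x k \<otimes> u k \<oplus> (\<Oplus>i\<in>A. x i \<otimes> u i)"
      using insert k E_closed[OF E] by (intro finsum_insert) auto
    have "g \<otimes> (x k \<otimes> u k \<oplus> (\<Oplus>i\<in>A. x i \<otimes> u i)) =
        x k \<otimes> (g \<otimes> u k) \<oplus> g \<otimes> (\<Oplus>i\<in>A. x i \<otimes> u i)"
      using E_closed[OF g(1)] K_closed[OF that(3)] u_closed[OF k(1)] E_closed[OF AE]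
      by (simp add: r_distr m_lcomm)
    then show ?case
      unfolding sum using insert.IH[OF k(2)] \<phi> E[OF k(1)] AE g that(3) u_in_E[OF k(1)] k(1) K_subset_E
      by (simp add: tr_add tr_smult E_mult)
  qed
  from this[of "{..<m}"] have "\<phi> (val x) = tr (g \<otimes> val x)" if "\<And>k. x k \<in> K" for x
    using that unfolding val_def by blast
  then show ?thesis using g(1) coords_exist by metis
qed

text \<open>Shrinking \<open>orbit_ker\<close> ends at zero, so no nonzero element is orthogonal
  under the trace form to all conjugates of the representative \<open>\<gamma>\<close>. The
  conclusion has the form of two mutually inverse matrices, as required for inverting
  transforms.\<close>

lemma dual_normal_bases:
  obtains \<beta> \<gamma> where "\<beta> \<in> E" "\<gamma> \<in> E"
    "\<And>i j. i < m \<Longrightarrow> j < m \<Longrightarrow>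
       (\<Oplus>l\<in>{..<m}. fr (i + l) \<gamma> \<otimes> fr (j + l) \<beta>) = (if i = j then \<one> else \<zero>)"
proof -
  define \<phi> where "\<phi> = arg_min (\<lambda>\<phi>. card (orbit_ker \<phi>)) functional"
  have "functional (\<lambda>_. \<zero>)"
    using subringE(2)[OF K_subring] K_closed by (auto simp: functional_def)
  then have \<phi>: "functional \<phi>" and min: "\<And>\<phi>'. functional \<phi>' \<Longrightarrow> card (orbit_ker \<phi>) \<le> card (orbit_ker \<phi>')"
    unfolding \<phi>_def using arg_min_natI[of functional _ "\<lambda>\<phi>. card (orbit_ker \<phi>)"]
      arg_min_nat_le[of functional _ "\<lambda>\<phi>. card (orbit_ker \<phi>)"] by blast+
  have ker: "orbit_ker \<phi> = {\<zero>}"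
  proof (rule ccontr)
    assume "orbit_ker \<phi> \<noteq> {\<zero>}"
    then obtain \<phi>' where "functional \<phi>'" "orbit_ker \<phi>' \<subset> orbit_ker \<phi>"
      using functional_avoiding[OF \<phi>] by blast
    moreover have "finite (orbit_ker \<phi>)"
      using finite_E by (auto simp: orbit_ker_def intro: finite_subset)
    ultimately show False using min[of \<phi>'] psubset_card_mono by (metis not_less)
  qed
  obtain \<gamma> where \<gamma>: "\<gamma> \<in> E" "\<And>x. x \<in> E \<Longrightarrow> \<phi> x = tr (\<gamma> \<otimes> x)"
    using functional_eq_tr[OF \<phi>] by blast
  let ?F = "\<lambda>b. \<lambda>d\<in>{..<m}. tr (\<gamma> \<otimes> fr d b)"
  \<comment> \<open>By counting, this map is then onto the coordinate vectors, and
    \<open>\<beta>\<close> is a preimage of the unit vector at 0.\<close>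
  have "inj_on ?F E"
  proof (rule inj_onI)
    fix a b assume a: "a \<in> E" and b: "b \<in> E" and eq: "?F a = ?F b"
    have d: "a \<ominus> b \<in> E" using a b by (rule E_minus)
    have small: "tr (\<gamma> \<otimes> fr d (a \<ominus> b)) = \<zero>" if "d < m" for d
    proof -
      have "tr (\<gamma> \<otimes> fr d (a \<ominus> b)) \<oplus> tr (\<gamma> \<otimes> fr d b) = tr (\<gamma> \<otimes> fr d (a \<ominus> b) \<oplus> \<gamma> \<otimes> fr d b)"
        using \<gamma>(1) d b by (intro tr_add[symmetric] E_mult fr_closed)
      also have "\<gamma> \<otimes> fr d (a \<ominus> b) \<oplus> \<gamma> \<otimes> fr d b = \<gamma> \<otimes> fr d ((a \<ominus> b) \<oplus> b)"
        using E_closed[OF \<gamma>(1)] E_closed[OF a] E_closed[OF b]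
        by (simp add: frobenius_pow_add r_distr)
      also have "(a \<ominus> b) \<oplus> b = a" using a b E_closed by (simp add: minus_add_cancel)
      also have "tr (\<gamma> \<otimes> fr d a) = \<zero> \<oplus> tr (\<gamma> \<otimes> fr d b)"
        using fun_cong[OF eq, of d] that K_closed[OF tr_in_K] E_mult[OF \<gamma>(1)] fr_closed b by simp
      finally show ?thesis
        using K_closed[OF tr_in_K] E_mult[OF \<gamma>(1)] fr_closed b d by (subst (asm) add.right_cancel) auto
    qed
    have "\<phi> (fr d (a \<ominus> b)) = \<zero>" for d
      using small[of "d mod m"] m_pos fr_mod[OF d, of d] \<gamma>(2)[OF fr_closed[OF d]] by simp
    then have "a \<ominus> b = \<zero>" using ker d by (auto simp: orbit_ker_def)
    then show "a = b" using a b E_closed by simp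
  qed
  moreover have "?F ` E \<subseteq> {..<m} \<rightarrow>\<^sub>E K"
    by (rule image_subsetI) (simp add: restrict_PiE_iff tr_in_K E_mult \<gamma> fr_closed)
  moreover have "card E = card ({..<m} \<rightarrow>\<^sub>E K)"
    using card_E by (simp add: card_PiE)
  ultimately have "?F ` E = {..<m} \<rightarrow>\<^sub>E K"
    by (metis card_image card_subset_eq finite_K finite_PiE finite_lessThan)
  moreover have "(\<lambda>d\<in>{..<m}. if d = 0 then \<one> else \<zero>) \<in> {..<m} \<rightarrow>\<^sub>E K"
    using subringE(2,3)[OF K_subring] by (simp add: restrict_PiE_iff)
  ultimately have "(\<lambda>d\<in>{..<m}. if d = 0 then \<one> else \<zero>) \<in> ?F ` E" by (simp only:)
  then obtain \<beta> where \<beta>: "\<beta> \<in> E" "(\<lambda>d\<in>{..<m}. if d = 0 then \<one> else \<zero>) = ?F \<beta>" by (rule imageE)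
  have dual: "tr (\<gamma> \<otimes> fr d \<beta>) = (if d = 0 then \<one> else \<zero>)" if "d < m" for d
    using fun_cong[OF \<beta>(2), of d] that by simp
  have "(\<Oplus>l\<in>{..<m}. fr (i + l) \<gamma> \<otimes> fr (j + l) \<beta>) = (if i = j then \<one> else \<zero>)"
    if "i < m" "j < m" for i j
  proof -
    \<comment> \<open>With d = j - i modulo \<open>m\<close>, the summands become the conjugates of
      one element, \<open>\<gamma> \<otimes> fr d \<beta>\<close>, and the sum is its trace.\<close>
    define d where "d = (j + m - i) mod m"
    have d: "d < m" using m_pos by (simp add: d_def)
    have "(i + d) mod m = (i + (j + m - i)) mod m" unfolding d_def by (rule mod_add_right_eq)
    then have id: "(i + d) mod m = j" using that by simp
    have "d = 0 \<longleftrightarrow> i = j" using id that by (auto simp: d_def)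
    then have tr: "tr (\<gamma> \<otimes> fr d \<beta>) = (if i = j then \<one> else \<zero>)" using dual[OF d] by simp
    have w: "\<gamma> \<otimes> fr d \<beta> \<in> E" using \<gamma>(1) \<beta>(1) by (intro E_mult fr_closed)
    have "(\<Oplus>l\<in>{..<m}. fr (i + l) \<gamma> \<otimes> fr (j + l) \<beta>) = (\<Oplus>l\<in>{..<m}. fr (i + l) (\<gamma> \<otimes> fr d \<beta>))"
    proof (intro finsum_cong')
      fix l
      have "(i + l + d) mod m = ((i + d) mod m + l) mod m" by (simp add: mod_simps ac_simps)
      then have "(j + l) mod m = (i + l + d) mod m" unfolding id by simp
      then have "fr (j + l) \<beta> = fr (i + l) (fr d \<beta>)"
        using fr_cong[OF \<beta>(1)] fr_add[OF E_closed[OF \<beta>(1)]] by metis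
      then show "fr (i + l) \<gamma> \<otimes> fr (j + l) \<beta> = fr (i + l) (\<gamma> \<otimes> fr d \<beta>)"
        using E_closed[OF \<gamma>(1)] E_closed[OF \<beta>(1)] by (simp add: fr_mult del: nat_pow_pow)
    qed (use E_closed[OF w] in auto)
    then show ?thesis using tr_shift[OF w] tr by simp
  qed
  then show ?thesis using that \<beta>(1) \<gamma>(1) by blast
qed

end

section \<open>Transforms by skew products\<close>

text \<open>Both halves run over all of \<open>{..<m}\<close> with zero padding, the range of
  summation in a cyclic product.\<close>

lemma (in abelian_monoid) finsum_split_parity:
  fixes m :: nat
  assumes f: "\<And>k. k < m \<Longrightarrow> f k \<in> carrier G"
  shows "(\<Oplus>k\<in>{..<m}. f k) =
    (\<Oplus>j\<in>{..<m}. if 2 * j < m then f (2 * j) else \<zero>) \<oplus>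
    (\<Oplus>j\<in>{..<m}. if 2 * j + 1 < m then f (2 * j + 1) else \<zero>)"
proof -
  have part: "(\<Oplus>j\<in>{..<m}. if h j < m then f (h j) else \<zero>) = (\<Oplus>k\<in>{k. k < m \<and> P k}. f k)"
    if h: "bij_betw h UNIV {k. P k}" "\<And>j. j \<le> h j" for h P
  proof -
    have "(\<Oplus>j\<in>{..<m}. if h j < m then f (h j) else \<zero>) = (\<Oplus>j\<in>{j. h j < m}. f (h j))"
      using h(2) f by (intro add.finprod_mono_neutral_cong_right) (auto intro: le_less_trans)
    also have "\<dots> = (\<Oplus>k\<in>{k. k < m \<and> P k}. f k)"
      by (intro finsum_bij_betw) (use h(1) f in \<open>auto simp: bij_betw_def inj_on_def\<close>)
    finally show ?thesis .
  qed
  have ev: "bij_betw (\<lambda>j::nat. 2 * j) UNIV {k. even k}"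
    by (auto simp: bij_betw_def inj_on_def elim!: evenE)
  have od: "bij_betw (\<lambda>j::nat. 2 * j + 1) UNIV {k. odd k}"
    by (auto simp: bij_betw_def inj_on_def elim!: oddE)
  have "(\<Oplus>k\<in>{..<m}. f k) = (\<Oplus>k\<in>{k. k < m \<and> even k} \<union> {k. k < m \<and> odd k}. f k)"
    by (rule arg_cong[where f = "finsum G f"]) auto
  also have "\<dots> = (\<Oplus>k\<in>{k. k < m \<and> even k}. f k) \<oplus> (\<Oplus>k\<in>{k. k < m \<and> odd k}. f k)"
    using f by (intro finsum_Un_disjoint) auto
  finally show ?thesis using part[OF ev] part[OF od] by simp
qed

context basis_extension
begin

text \<open>The product modulo x^[m] - x. Adding \<open>m\<close> before subtracting j keeps the
  natural-number difference exact.\<close>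

definition cyc :: "(nat \<Rightarrow> 'a) \<Rightarrow> (nat \<Rightarrow> 'a) \<Rightarrow> nat \<Rightarrow> 'a" where
  "cyc a b i = (\<Oplus>j\<in>{..<m}. a j \<otimes> fr j (b ((i + m - j) mod m)))"

text \<open>The value at \<open>fr i g\<close> of the linearized polynomial with coefficients x. The
  matrix of conjugates depends on i + j only and is symmetric, so one formula serves for evaluation
  at conjugates of \<open>\<beta>\<close> and for interpolation with
  \<open>\<gamma>\<close>.\<close>

definition qtransform :: "'a \<Rightarrow> (nat \<Rightarrow> 'a) \<Rightarrow> nat \<Rightarrow> 'a" where
  "qtransform g x i = (\<Oplus>j\<in>{..<m}. x j \<otimes> fr (i + j) g)"

lemma qtransform_closed: "g \<in> E \<Longrightarrow> (\<And>j. j < m \<Longrightarrow> x j \<in> E) \<Longrightarrow> qtransform g x i \<in> E"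
  unfolding qtransform_def by (intro E_finsum E_mult fr_closed) auto

lemma cyc_closed: "(\<And>j. j < m \<Longrightarrow> a j \<in> E) \<Longrightarrow> (\<And>j. j < m \<Longrightarrow> b j \<in> E) \<Longrightarrow> cyc a b i \<in> E"
  unfolding cyc_def using m_pos by (intro E_finsum E_mult fr_closed) auto

lemma qtransform_inverse:
  assumes E: "\<beta> \<in> E" "\<gamma> \<in> E" "\<And>k. k < m \<Longrightarrow> x k \<in> E" and "j < m"
    and orth: "\<And>i j. i < m \<Longrightarrow> j < m \<Longrightarrow>
       (\<Oplus>l\<in>{..<m}. fr (i + l) \<gamma> \<otimes> fr (j + l) \<beta>) = (if i = j then \<one> else \<zero>)"
  shows "qtransform \<beta> (qtransform \<gamma> x) j = x j"
proof -
  note c = E(1,2)[THEN E_closed] E(3)[THEN E_closed]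
  have "qtransform \<beta> (qtransform \<gamma> x) j =
      (\<Oplus>l\<in>{..<m}. \<Oplus>k\<in>{..<m}. x k \<otimes> (fr (k + l) \<gamma> \<otimes> fr (j + l) \<beta>))"
    unfolding qtransform_def using c
    by (intro finsum_cong') (auto simp: finsum_ldistr Pi_iff m_assoc add.commute intro!: finsum_cong')
  also have "\<dots> = (\<Oplus>k\<in>{..<m}. \<Oplus>l\<in>{..<m}. x k \<otimes> (fr (k + l) \<gamma> \<otimes> fr (j + l) \<beta>))"
    using c by (intro finsum_swap) auto
  also have "\<dots> = (\<Oplus>k\<in>{..<m}. x k \<otimes> (\<Oplus>l\<in>{..<m}. fr (k + l) \<gamma> \<otimes> fr (j + l) \<beta>))"
    using c by (intro finsum_cong') (auto simp: finsum_rdistr Pi_iff)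
  also have "\<dots> = (\<Oplus>k\<in>{..<m}. if j = k then x k else \<zero>)"
    using c \<open>j < m\<close> by (intro finsum_cong') (auto simp: orth)
  also have "\<dots> = x j" using c \<open>j < m\<close> by (intro finsum_singleton) auto
  finally show ?thesis .
qed

text \<open>Evaluation turns products into compositions, and reduction modulo x^[m] - x does not
  change values on \<open>E\<close>. Concretely, the output index l is replaced by i + l modulo
  \<open>m\<close>.\<close>

lemma qtransform_cyc:
  assumes E: "\<beta> \<in> E" "\<And>k. k < m \<Longrightarrow> a k \<in> E" "\<And>k. k < m \<Longrightarrow> b k \<in> E"
  shows "qtransform \<beta> (cyc a b) j = (\<Oplus>i\<in>{..<m}. a i \<otimes> fr i (qtransform \<beta> b j))"
proof -
  note c = E(1)[THEN E_closed] E(2,3)[THEN E_closed]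
  have inner: "(\<Oplus>l\<in>{..<m}. fr i (b ((l + m - i) mod m)) \<otimes> fr (j + l) \<beta>) = fr i (qtransform \<beta> b j)"
    if i: "i < m" for i
  proof -
    let ?f = "\<lambda>l. fr i (b ((l + m - i) mod m)) \<otimes> fr (j + l) \<beta>"
    have "(\<Oplus>l\<in>{..<m}. ?f l) = (\<Oplus>l\<in>{..<m}. ?f ((i + l) mod m))"
      using c m_pos by (intro finsum_bij_betw[OF bij_betw_add_mod, symmetric]) auto
    also have "\<dots> = (\<Oplus>l\<in>{..<m}. fr i (b l \<otimes> fr (j + l) \<beta>))"
    proof (intro finsum_cong')
      fix l assume l: "l \<in> {..<m}"
      have "((i + l) mod m + m - i) mod m = l"
      proof (cases "i + l < m")
        case False
        then have "(i + l) mod m = i + l - m" using i l by (simp add: mod_if)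
        then show ?thesis using i l False by simp
      qed (use l in simp)
      moreover have "fr (j + (i + l) mod m) \<beta> = fr i (fr (j + l) \<beta>)"
        using fr_cong[OF E(1), of "j + (i + l) mod m" "i + (j + l)"] fr_add[OF c(1)]
        by (simp add: mod_simps ac_simps)
      ultimately show "?f ((i + l) mod m) = fr i (b l \<otimes> fr (j + l) \<beta>)"
        using c l by (simp add: fr_mult)
    qed (use c in auto)
    also have "\<dots> = fr i (qtransform \<beta> b j)"
      unfolding qtransform_def using c by (intro frobenius_pow_finsum[symmetric]) auto
    finally show ?thesis .
  qed
  have "qtransform \<beta> (cyc a b) j =
      (\<Oplus>l\<in>{..<m}. \<Oplus>i\<in>{..<m}. a i \<otimes> (fr i (b ((l + m - i) mod m)) \<otimes> fr (j + l) \<beta>))"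
    unfolding qtransform_def cyc_def using c m_pos
    by (intro finsum_cong') (auto simp: finsum_ldistr Pi_iff m_assoc intro!: finsum_cong')
  also have "\<dots> = (\<Oplus>i\<in>{..<m}. \<Oplus>l\<in>{..<m}. a i \<otimes> (fr i (b ((l + m - i) mod m)) \<otimes> fr (j + l) \<beta>))"
    using c m_pos by (intro finsum_swap) auto
  also have "\<dots> = (\<Oplus>i\<in>{..<m}. a i \<otimes> (\<Oplus>l\<in>{..<m}. fr i (b ((l + m - i) mod m)) \<otimes> fr (j + l) \<beta>))"
    using c m_pos by (intro finsum_cong') (auto simp: finsum_rdistr Pi_iff)
  also have "\<dots> = (\<Oplus>i\<in>{..<m}. a i \<otimes> fr i (qtransform \<beta> b j))"
    using c E_closed[OF qtransform_closed[OF E(1,3)]] by (intro finsum_cong') (auto simp: inner)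
  finally show ?thesis .
qed

text \<open>By linearity over \<open>K\<close>: if the second factor hits a combination of the v k
  and the first sends each v k to w k, then the w k are combined with the same scalars. It serves
  first for v the given basis and then for v the conjugates of \<open>\<beta>\<close>.\<close>

lemma qtransform_cyc_eq_combination:
  assumes E: "\<beta> \<in> E" "\<And>i. i < m \<Longrightarrow> a i \<in> E" "\<And>i. i < m \<Longrightarrow> b i \<in> E"
    and v: "\<And>k. k < m \<Longrightarrow> v k \<in> E" and w: "\<And>k. k < m \<Longrightarrow> (\<Oplus>i\<in>{..<m}. a i \<otimes> fr i (v k)) = w k"
    and M: "\<And>k. k < m \<Longrightarrow> M k \<in> K"
    and b: "qtransform \<beta> b j = (\<Oplus>k\<in>{..<m}. M k \<otimes> v k)"
  shows "qtransform \<beta> (cyc a b) j = (\<Oplus>k\<in>{..<m}. M k \<otimes> w k)"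
proof -
  note c = E[THEN E_closed] v[THEN E_closed] M[THEN K_closed]
  have wc: "w k \<in> carrier L" if "k < m" for k
    unfolding w[OF that, symmetric] using c that by auto
  have "qtransform \<beta> (cyc a b) j = (\<Oplus>i\<in>{..<m}. a i \<otimes> fr i (\<Oplus>k\<in>{..<m}. M k \<otimes> v k))"
    unfolding b[symmetric] using E by (rule qtransform_cyc)
  also have "\<dots> = (\<Oplus>i\<in>{..<m}. \<Oplus>k\<in>{..<m}. M k \<otimes> (a i \<otimes> fr i (v k)))"
  proof (intro finsum_cong')
    fix i assume i: "i \<in> {..<m}"
    have "fr i (\<Oplus>k\<in>{..<m}. M k \<otimes> v k) = (\<Oplus>k\<in>{..<m}. fr i (M k \<otimes> v k))"
      using c by (intro frobenius_pow_finsum) auto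
    also have "\<dots> = (\<Oplus>k\<in>{..<m}. M k \<otimes> fr i (v k))"
      using c M by (intro finsum_cong') (auto simp: fr_mult K_pow_pow)
    finally have "a i \<otimes> fr i (\<Oplus>k\<in>{..<m}. M k \<otimes> v k) = (\<Oplus>k\<in>{..<m}. a i \<otimes> (M k \<otimes> fr i (v k)))"
      using c i by (simp add: finsum_rdistr Pi_iff)
    also have "\<dots> = (\<Oplus>k\<in>{..<m}. M k \<otimes> (a i \<otimes> fr i (v k)))"
      using c i by (intro finsum_cong') (auto simp: m_lcomm)
    finally show "a i \<otimes> fr i (\<Oplus>k\<in>{..<m}. M k \<otimes> v k) = (\<Oplus>k\<in>{..<m}. M k \<otimes> (a i \<otimes> fr i (v k)))" .
  qed (use c in auto)
  also have "\<dots> = (\<Oplus>k\<in>{..<m}. \<Oplus>i\<in>{..<m}. M k \<otimes> (a i \<otimes> fr i (v k)))"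
    using c by (intro finsum_swap) auto
  also have "\<dots> = (\<Oplus>k\<in>{..<m}. M k \<otimes> w k)"
    using c w wc by (intro finsum_cong') (auto simp: finsum_rdistr[symmetric] Pi_iff)
  finally show ?thesis .
qed

definition part :: "nat \<Rightarrow> (nat \<Rightarrow> 'a) \<Rightarrow> nat \<Rightarrow> 'a" where
  "part e x j = (if 2 * j + e < m then x (2 * j + e) else \<zero>)"

text \<open>The conjugate of g with exponent e - l, raised by \<open>m\<close> to stay a natural
  number; on \<open>E\<close> exponents count modulo \<open>m\<close>.\<close>

definition rot :: "nat \<Rightarrow> 'a \<Rightarrow> nat \<Rightarrow> 'a" where
  "rot e g l = fr (e + m - l) g"

text \<open>At output index -i the second factor is read at -i - j and has exponent e + i + j; the
  twist by j makes this i + 2j + e.\<close>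

lemma cyc_part_rot:
  assumes g: "g \<in> E" and i: "i < m" and x: "\<And>j. j < m \<Longrightarrow> x j \<in> E"
  shows "cyc (part e x) (rot e g) ((m - i) mod m) =
    (\<Oplus>j\<in>{..<m}. if 2 * j + e < m then x (2 * j + e) \<otimes> fr (i + (2 * j + e)) g else \<zero>)"
  unfolding cyc_def
proof (intro finsum_cong')
  fix j assume "j \<in> {..<m}"
  then have j: "j < m" by simp
  define i' where "i' = (m - i) mod m"
  define l where "l = (i' + m - j) mod m"
  have i': "i = 0 \<and> i' = 0 \<or> 0 < i \<and> i' = m - i" using i by (cases "i = 0") (auto simp: i'_def)
  have "i' < m" using i by (auto simp: i'_def)
  have "j \<le> i' \<and> l = i' - j \<or> i' < j \<and> l = i' + m - j"
  proof (cases "j \<le> i'")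
    case True
    then have "l = (i' - j + m) mod m" by (simp add: l_def add.commute)
    also have "\<dots> = i' - j" using \<open>i' < m\<close> by (simp only: mod_add_self2 mod_less less_imp_diff_less)
    finally show ?thesis using True by simp
  next
    case False
    then show ?thesis using j by (simp add: l_def)
  qed
  \<comment> \<open>The three multiples of \<open>m\<close> arise from whether i is 0 and whether
    the index -i - j wraps around; only additions occur, so no difference is truncated.\<close>
  then have "j + (e + m - l) + 1 * m = i + (2 * j + e) + 2 * m \<or>
      j + (e + m - l) + 2 * m = i + (2 * j + e) + 2 * m \<or>
      j + (e + m - l) + 3 * m = i + (2 * j + e) + 2 * m"
    using i' j i by linarith
  then obtain k where "j + (e + m - l) + k * m = i + (2 * j + e) + 2 * m" by metis
  then have "(j + (e + m - l)) mod m = (i + (2 * j + e)) mod m"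
    by (metis mod_mult_self1)
  then have "fr j (rot e g l) = fr (i + (2 * j + e)) g"
    using fr_cong[OF g] fr_add[OF E_closed[OF g]] by (metis rot_def)
  then show "part e x j \<otimes> fr j (rot e g (((m - i) mod m + m - j) mod m)) =
      (if 2 * j + e < m then x (2 * j + e) \<otimes> fr (i + (2 * j + e)) g else \<zero>)"
    using E_closed[OF g] by (simp add: part_def l_def i'_def)
qed (use E_closed[OF g] E_closed[OF x] in auto)

lemma qtransform_eq_cyc:
  assumes "g \<in> E" "i < m" "\<And>j. j < m \<Longrightarrow> x j \<in> E"
  shows "qtransform g x i =
    cyc (part 0 x) (rot 0 g) ((m - i) mod m) \<oplus> cyc (part 1 x) (rot 1 g) ((m - i) mod m)"
proof -
  have "qtransform g x i =
    (\<Oplus>j\<in>{..<m}. if 2 * j < m then x (2 * j) \<otimes> fr (i + 2 * j) g else \<zero>) \<oplus>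
    (\<Oplus>j\<in>{..<m}. if 2 * j + 1 < m then x (2 * j + 1) \<otimes> fr (i + (2 * j + 1)) g else \<zero>)"
    unfolding qtransform_def using assms E_closed by (intro finsum_split_parity) auto
  moreover have "cyc (part e x) (rot e g) ((m - i) mod m) =
    (\<Oplus>j\<in>{..<m}. if 2 * j + e < m then x (2 * j + e) \<otimes> fr (i + (2 * j + e)) g else \<zero>)" for e
    using assms by (rule cyc_part_rot)
  from this[of 0] this[of 1] have
    "cyc (part 0 x) (rot 0 g) ((m - i) mod m) =
      (\<Oplus>j\<in>{..<m}. if 2 * j < m then x (2 * j) \<otimes> fr (i + 2 * j) g else \<zero>)"
    "cyc (part 1 x) (rot 1 g) ((m - i) mod m) =
      (\<Oplus>j\<in>{..<m}. if 2 * j + 1 < m then x (2 * j + 1) \<otimes> fr (i + (2 * j + 1)) g else \<zero>)"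
    by (simp_all only: add_0_right)
  ultimately show ?thesis by (simp only:)
qed

text \<open>Reduction folds coefficient i + m onto coefficient i. A summand j belongs to the lower
  one if \<open>j \<le> i\<close> and to the upper one otherwise.\<close>

lemma cyc_eq_linpoly_mult:
  assumes a: "a \<in> linpolys L K m m" and b: "b \<in> linpolys L K m m" and i: "i < m"
  shows "cyc a b i = linpoly_mult L K a b i \<oplus> linpoly_mult L K a b (i + m)"
proof -
  have E: "a j \<in> E" "b j \<in> E" for j using a b by (auto simp: linpolys_def)
  have z: "a j = \<zero>" "b j = \<zero>" if "m \<le> j" for j using that a b by (auto simp: linpolys_def)
  note c = E[THEN E_closed]
  have "linpoly_mult L K a b i = (\<Oplus>j\<in>{..<m}. if j \<le> i then a j \<otimes> fr j (b (i - j)) else \<zero>)"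
    unfolding linpoly_mult_def using c i
    by (intro add.finprod_mono_neutral_cong_left) auto
  moreover have "linpoly_mult L K a b (i + m) =
      (\<Oplus>j\<in>{..<m}. if j \<le> i then \<zero> else a j \<otimes> fr j (b (i + m - j)))"
    unfolding linpoly_mult_def using c i z fr_zero
    by (intro add.finprod_mono_neutral_cong_right) (auto simp: not_less)
  ultimately have "linpoly_mult L K a b i \<oplus> linpoly_mult L K a b (i + m) =
      (\<Oplus>j\<in>{..<m}. (if j \<le> i then a j \<otimes> fr j (b (i - j)) else \<zero>) \<oplus>
        (if j \<le> i then \<zero> else a j \<otimes> fr j (b (i + m - j))))"
    using c by (simp add: finsum_addf Pi_iff)
  also have "\<dots> = cyc a b i"
    unfolding cyc_def using c i by (intro finsum_cong') (auto simp: mod_if)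
  finally show ?thesis ..
qed

text \<open>Folding the row m - 1 asks for coefficient 2 m - 1, the first one beyond the output
  rows.\<close>

lemma linpoly_mult_zero:
  assumes a: "a \<in> linpolys L K m m" and b: "b \<in> linpolys L K m m" and i: "2 * m - 1 \<le> i"
  shows "linpoly_mult L K a b i = \<zero>"
  unfolding linpoly_mult_def
proof (rule add.finprod_one_eqI)
  fix j
  have "m \<le> j \<or> m \<le> i - j" using i m_pos by linarith
  then have "a j = \<zero> \<or> b (i - j) = \<zero>" using a b by (auto simp: linpolys_def)
  moreover have "a j \<in> carrier L" "b (i - j) \<in> carrier L"
    using a b E_closed by (auto simp: linpolys_def)
  ultimately show "a j \<otimes> fr j (b (i - j)) = \<zero>" using fr_zero by auto
qed

lemma linpoly_mult_closed:
  assumes "a \<in> linpolys L K m n" "b \<in> linpolys L K m n"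
  shows "linpoly_mult L K a b i \<in> E"
  unfolding linpoly_mult_def using assms
  by (intro E_finsum E_mult fr_closed) (auto simp: linpolys_def)

end

section \<open>The cost of multiplying linearized polynomials\<close>

lemma flatten_Suc: "flatten (Suc r) c A = flatten r c A @ map (A r) [0..<c]"
  by (simp add: flatten_def)

lemma length_flatten [simp]: "length (flatten r c A) = r * c"
  by (induction r) (simp_all add: flatten_Suc, simp add: flatten_def)

lemma flatten_index_less:
  fixes i j r c :: nat
  assumes "i < r" "j < c"
  shows "i * c + j < r * c"
proof -
  have "i * c + j < Suc i * c" using assms(2) by simp
  also have "\<dots> \<le> r * c" using assms(1) by (intro mult_le_mono) auto
  finally show ?thesis .
qed

lemma nth_flatten:
  assumes "i < r" "j < c"
  shows "flatten r c A ! (i * c + j) = A i j"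
  using assms(1)
proof (induction r)
  case (Suc r)
  show ?case
  proof (cases "i = r")
    case True
    then show ?thesis using assms(2) by (simp add: flatten_Suc nth_append)
  next
    case False
    then have "i < r" using Suc.prems by simp
    then show ?thesis
      using Suc.IH flatten_index_less[OF \<open>i < r\<close> assms(2)] by (simp add: flatten_Suc nth_append)
  qed
qed simp

lemma map_flatten: "map f (flatten r c A) = flatten r c (\<lambda>i j. f (A i j))"
  by (simp add: flatten_def map_concat comp_def)

lemma set_flatten: "set (flatten r c A) = {A i j |i j. i < r \<and> j < c}"
  by (auto simp: flatten_def) blast

lemma nth_flatten_const: "r < n * c \<Longrightarrow> flatten n c (\<lambda>_ _. a) ! r = a"
  using nth_mem[of r "flatten n c (\<lambda>_ _. a)"] by (auto simp: set_flatten)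

lemma flatten_cong:
  assumes "\<And>i j. i < r \<Longrightarrow> j < c \<Longrightarrow> A i j = B i j"
  shows "flatten r c A = flatten r c B"
proof -
  have "map (\<lambda>i. map (A i) [0..<c]) [0..<r] = map (\<lambda>i. map (B i) [0..<c]) [0..<r]"
    using assms by simp
  then show ?thesis by (simp only: flatten_def)
qed

lemma flatten_eqD:
  assumes "flatten r c A = flatten r c B" "i < r" "j < c"
  shows "A i j = B i j"
  using nth_flatten[OF assms(2,3), of A] nth_flatten[OF assms(2,3), of B] assms(1) by simp

context basis_extension
begin

section \<open>Inputs and outputs of the multiplication problem\<close>

abbreviation F :: "'a ring" where "F \<equiv> L\<lparr>carrier := K\<rparr>"

lemma field_F: "field F"
  by (rule subfield_iff(2)[OF K])

lemma finsum_F: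
  assumes "finite A" "\<And>a. a \<in> A \<Longrightarrow> f a \<in> K"
  shows "finsum F f A = finsum L f A"
  using assms
proof (induction A rule: finite_induct)
  interpret F: field F by (rule field_F)
  case empty
  show ?case using F.finsum_empty by simp
next
  interpret F: field F by (rule field_F)
  case (insert a A)
  then have "finsum F f (insert a A) = f a \<oplus>\<^bsub>F\<^esub> finsum F f A"
    by (intro F.finsum_insert) auto
  moreover have "finsum L f (insert a A) = f a \<oplus> finsum L f A"
    using insert K_closed by (intro finsum_insert) auto
  ultimately show ?case using insert by simp
qed

text \<open>\<open>linpolys\<close> constrains all indices while coordinates fix only those below
  \<open>m\<close>; zero padding makes the polynomial unique.\<close>

definition extend :: "(nat \<Rightarrow> 'a) \<Rightarrow> nat \<Rightarrow> 'a" where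
  "extend a i = (if i < m then a i else \<zero>)"

lemma extend_linpolys: "(\<And>i. i < m \<Longrightarrow> a i \<in> E) \<Longrightarrow> extend a \<in> linpolys L K m m"
  using E_zero by (auto simp: linpolys_def extend_def)

lemma cyc_cong:
  assumes "\<And>i. i < m \<Longrightarrow> a i = a' i" "\<And>i. i < m \<Longrightarrow> b i = b' i"
    "\<And>i. i < m \<Longrightarrow> a' i \<in> E" "\<And>i. i < m \<Longrightarrow> b' i \<in> E"
  shows "cyc a b i = cyc a' b' i"
  unfolding cyc_def using assms E_closed m_pos by (intro finsum_cong') auto

lemma represents_iff:
  "represents L K m u n x a \<longleftrightarrow> (\<forall>i<n. (\<forall>k<m. x i k \<in> K) \<and> a i = val (x i))"
  unfolding represents_def val_def ..

lemma linpoly_problemI: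
  assumes x: "\<And>i k. i < m \<Longrightarrow> k < m \<Longrightarrow> x i k \<in> K" and y: "\<And>i k. i < m \<Longrightarrow> k < m \<Longrightarrow> y i k \<in> K"
  shows "\<exists>z. (\<forall>i k. z i k \<in> K) \<and>
    (flatten m m x @ flatten m m y, flatten (2 * m - 1) m z) \<in> linpoly_problem L K m u"
proof -
  let ?a = "extend (\<lambda>i. val (x i))" and ?b = "extend (\<lambda>i. val (y i))"
  have a: "?a \<in> linpolys L K m m" and b: "?b \<in> linpolys L K m m"
    using x y by (auto intro!: extend_linpolys val_closed)
  have "\<exists>z. \<forall>i. (\<forall>k. z i k \<in> K) \<and> val (z i) = linpoly_mult L K ?a ?b i"
    using coords_exist[OF linpoly_mult_closed[OF a b]] by metis
  then obtain z where "\<And>i. (\<forall>k. z i k \<in> K) \<and> val (z i) = linpoly_mult L K ?a ?b i" by blast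
  then have "(\<forall>i k. z i k \<in> K) \<and> represents L K m u m x ?a \<and> represents L K m u m y ?b \<and>
      represents L K m u (2 * m - 1) z (linpoly_mult L K ?a ?b)"
    using x y by (simp add: represents_iff extend_def)
  then show ?thesis unfolding linpoly_problem_def using a b by blast
qed

text \<open>The problem hides its polynomials behind existential quantifiers. A flattened list
  determines its entries and these determine the polynomials, so the output is the product of the
  expected ones.\<close>

lemma linpoly_problemD:
  assumes "(flatten m m x @ flatten m m y, zs) \<in> linpoly_problem L K m u"
  shows "\<exists>z. zs = flatten (2 * m - 1) m z \<and> (\<forall>i<2 * m - 1. \<forall>k<m. z i k \<in> K) \<and>
    (\<forall>i<2 * m - 1. val (z i) =
       linpoly_mult L K (extend (\<lambda>i. val (x i))) (extend (\<lambda>i. val (y i))) i)"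
proof -
  obtain x' y' z a b where *: "flatten m m x @ flatten m m y = flatten m m x' @ flatten m m y'"
    "zs = flatten (2 * m - 1) m z" "a \<in> linpolys L K m m" "b \<in> linpolys L K m m"
    "represents L K m u m x' a" "represents L K m u m y' b"
    "represents L K m u (2 * m - 1) z (linpoly_mult L K a b)"
    using assms unfolding linpoly_problem_def by blast
  have "flatten m m x = flatten m m x'" "flatten m m y = flatten m m y'" using *(1) by simp_all
  then have xy: "x i k = x' i k" "y i k = y' i k" if "i < m" "k < m" for i k
    using flatten_eqD that by metis+
  have ext: "c = extend (\<lambda>i. val (w i))"
    if "c \<in> linpolys L K m m" "represents L K m u m w' c"
      "\<And>i k. i < m \<Longrightarrow> k < m \<Longrightarrow> w i k = w' i k" for c w w'
  proof
    fix i
    show "c i = extend (\<lambda>i. val (w i)) i"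
    proof (cases "i < m")
      case True
      then have w': "\<And>k. k < m \<Longrightarrow> w' i k \<in> K" "c i = val (w' i)"
        using that(2) by (auto simp: represents_iff)
      have "val (w i) = val (w' i)"
        unfolding val_def using that(3)[OF True] w'(1) K_closed u_closed by (intro finsum_cong') auto
      then show ?thesis using True w' by (simp add: extend_def)
    next
      case False
      then show ?thesis using that(1) by (simp add: extend_def linpolys_def)
    qed
  qed
  have "a = extend (\<lambda>i. val (x i))" using *(3,5) xy(1) by (rule ext)
  moreover have "b = extend (\<lambda>i. val (y i))" using *(4,6) xy(2) by (rule ext)
  ultimately have "represents L K m u (2 * m - 1) z
      (linpoly_mult L K (extend (\<lambda>i. val (x i))) (extend (\<lambda>i. val (y i))))"
    using *(7) by (simp only:)
  then show ?thesis using *(2) unfolding represents_iff by (intro exI[of _ z]) simp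
qed

lemma linpoly_Domain_iff:
  "xs \<in> Domain (linpoly_problem L K m u) \<longleftrightarrow>
    (\<exists>x y. xs = flatten m m x @ flatten m m y \<and> (\<forall>i<m. \<forall>k<m. x i k \<in> K) \<and> (\<forall>i<m. \<forall>k<m. y i k \<in> K))"
  (is "_ \<longleftrightarrow> ?R")
proof
  assume "xs \<in> Domain (linpoly_problem L K m u)"
  then obtain zs where "(xs, zs) \<in> linpoly_problem L K m u" by blast
  then obtain x y z a b where "xs = flatten m m x @ flatten m m y"
    "represents L K m u m x a" "represents L K m u m y b"
    unfolding linpoly_problem_def by (simp only: mem_Collect_eq prod.inject) metis
  then show ?R unfolding represents_iff by (intro exI[of _ x] exI[of _ y]) simp
next
  assume ?R
  then obtain x y where "xs = flatten m m x @ flatten m m y"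
    "\<And>i k. i < m \<Longrightarrow> k < m \<Longrightarrow> x i k \<in> K" "\<And>i k. i < m \<Longrightarrow> k < m \<Longrightarrow> y i k \<in> K" by blast
  then show "xs \<in> Domain (linpoly_problem L K m u)" using linpoly_problemI[of x y] by blast
qed

lemma linpoly_slp_exists: "\<exists>P. slp_solves F P (linpoly_problem L K m u)"
proof (rule finite_field_slp_exists[OF field_F])
  show "finite (carrier F)" using finite_K by simp
  fix xs assume "xs \<in> Domain (linpoly_problem L K m u)"
  then obtain x y where xs: "xs = flatten m m x @ flatten m m y"
    and K: "\<And>i k. i < m \<Longrightarrow> k < m \<Longrightarrow> x i k \<in> K" "\<And>i k. i < m \<Longrightarrow> k < m \<Longrightarrow> y i k \<in> K"
    unfolding linpoly_Domain_iff by blast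
  then show "length xs = 2 * (m * m) \<and> set xs \<subseteq> carrier F"
    by (auto simp: set_flatten)
  show "\<exists>zs. (xs, zs) \<in> linpoly_problem L K m u \<and> length zs = (2 * m - 1) * m \<and> set zs \<subseteq> carrier F"
  proof -
    obtain z where z: "\<And>i k. z i k \<in> K"
      "(flatten m m x @ flatten m m y, flatten (2 * m - 1) m z) \<in> linpoly_problem L K m u"
      using linpoly_problemI[of x y] K by blast
    then have "set (flatten (2 * m - 1) m z) \<subseteq> carrier F" by (auto simp: set_flatten)
    then show ?thesis using z(2) unfolding xs by (intro exI[of _ "flatten (2 * m - 1) m z"]) simp
  qed
qed

section \<open>Lower bound by counting outputs\<close>

lemma val_zero: "val (\<lambda>_. \<zero>) = \<zero>"
  unfolding val_def using u_closed by (intro add.finprod_one_eqI) auto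

lemma linpoly_mult_one:
  assumes a: "a \<in> linpolys L K m m"
  shows "linpoly_mult L K a (extend (\<lambda>i. if i = 0 then \<one> else \<zero>)) i = a i"
proof -
  have c: "a j \<in> carrier L" for j using a E_closed by (auto simp: linpolys_def)
  have "linpoly_mult L K a (extend (\<lambda>i. if i = 0 then \<one> else \<zero>)) i =
      (\<Oplus>j\<in>{..i}. if i = j then a j else \<zero>)"
    unfolding linpoly_mult_def using c m_pos fr_zero
    by (intro finsum_cong') (auto simp: extend_def)
  also have "\<dots> = a i" using c by (intro finsum_singleton) auto
  finally show ?thesis .
qed

lemma linpoly_mult_zero_left:
  assumes "\<And>i. a i = \<zero>" "b \<in> linpolys L K m m"
  shows "linpoly_mult L K a b i = \<zero>"
  unfolding linpoly_mult_def using assms E_closed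
  by (intro add.finprod_one_eqI) (auto simp: linpolys_def)

lemma linpoly_mult_zero_right:
  assumes "\<And>i. b i = \<zero>" "a \<in> linpolys L K m m"
  shows "linpoly_mult L K a b i = \<zero>"
  unfolding linpoly_mult_def using assms E_closed fr_zero
  by (intro add.finprod_one_eqI) (auto simp: linpolys_def)

text \<open>Opens up a run as far as the lower bound requires: the total number of registers, the
  contents of the input registers and the operands behind the first \<open>m\<close> output
  rows.\<close>

lemma linpoly_slp_outputs:
  assumes P: "slp_solves F P (linpoly_problem L K m u)"
    and x: "\<And>i k. i < m \<Longrightarrow> k < m \<Longrightarrow> x i k \<in> K" and y: "\<And>i k. i < m \<Longrightarrow> k < m \<Longrightarrow> y i k \<in> K"
  obtains rs z where "length rs = 2 * (m * m) + length (fst P)"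
    "\<And>r. r < 2 * (m * m) \<Longrightarrow> rs ! r = (flatten m m x @ flatten m m y) ! r"
    "\<And>i k. i < m \<Longrightarrow> k < m \<Longrightarrow> operand_val rs (snd P ! (i * m + k)) = Some (z i k)"
    "\<And>i k. i < m \<Longrightarrow> k < m \<Longrightarrow> z i k \<in> K"
    "\<And>i. i < m \<Longrightarrow> val (z i) =
       linpoly_mult L K (extend (\<lambda>i. val (x i))) (extend (\<lambda>i. val (y i))) i"
proof -
  let ?xs = "flatten m m x @ flatten m m y"
  have "?xs \<in> Domain (linpoly_problem L K m u)" unfolding linpoly_Domain_iff using x y by blast
  then obtain zs where zs: "slp_run F P ?xs = Some zs" "(?xs, zs) \<in> linpoly_problem L K m u"
    using P unfolding slp_solves_def by blast
  obtain rs where rs: "exec F (fst P) ?xs = Some rs" "map (operand_val rs) (snd P) = map Some zs"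
    using zs(1) unfolding slp_run_def by (auto simp: bind_eq_Some_conv those_map_eq_Some)
  obtain ts where ts: "rs = ?xs @ ts" "length ts = length (fst P)" using exec_prefix[OF rs(1)] by blast
  obtain z where z: "zs = flatten (2 * m - 1) m z" "\<forall>i<2 * m - 1. \<forall>k<m. z i k \<in> K"
    "\<forall>i<2 * m - 1. val (z i) = linpoly_mult L K (extend (\<lambda>i. val (x i))) (extend (\<lambda>i. val (y i))) i"
    using linpoly_problemD[OF zs(2)] by blast
  show ?thesis
  proof (rule that)
    show "length rs = 2 * (m * m) + length (fst P)" using ts by simp
    show "rs ! r = ?xs ! r" if "r < 2 * (m * m)" for r
      unfolding ts(1) using that by (subst nth_append) simp
    fix i assume i: "i < m"
    then have i': "i < 2 * m - 1" by simp
    show "val (z i) = linpoly_mult L K (extend (\<lambda>i. val (x i))) (extend (\<lambda>i. val (y i))) i"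
      using z(3) i' by blast
    fix k assume k: "k < m"
    show "z i k \<in> K" using z(2) i' k by blast
    have "length (snd P) = (2 * m - 1) * m"
      using arg_cong[OF rs(2), of length] z(1) by simp
    then have "i * m + k < length (snd P)" "i * m + k < length zs"
      using z(1) flatten_index_less[OF i' k] by simp_all
    then have "operand_val rs (snd P ! (i * m + k)) = Some (zs ! (i * m + k))"
      using arg_cong[OF rs(2), of "\<lambda>l. l ! (i * m + k)"] by simp
    then show "operand_val rs (snd P ! (i * m + k)) = Some (z i k)"
      using nth_flatten[OF i' k] z(1) by simp
  qed
qed

text \<open>The \<open>m\<^sup>2\<close> coordinates of the coefficients of \<open>a \<cdot> b\<close> of index less than \<open>m\<close> are pairwise
  distinct, not constant and not inputs, so each of them needs an instruction of its own.\<close>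

lemma square_le_slp_length:
  assumes P: "slp_solves F P (linpoly_problem L K m u)"
  shows "m * m \<le> length (fst P)"
proof -
  have zK: "\<zero> \<in> K" and oK: "\<one> \<in> K" using subringE(2,3)[OF K_subring] by auto
  obtain one where one: "\<And>k. one k \<in> K" "val one = \<one>" using coords_exist[OF E_one] by blast
  \<comment> \<open>The coordinates of the identity polynomial x^[0]; multiplying by it makes the
    first \<open>m\<close> output rows an arbitrary matrix.\<close>
  define y1 where "y1 i = (if i = 0 then one else (\<lambda>_. \<zero>))" for i :: nat
  have y1: "extend (\<lambda>i. val (y1 i)) = extend (\<lambda>i. if i = 0 then \<one> else \<zero>)"
    using one(2) val_zero by (auto simp: extend_def fun_eq_iff y1_def)
  have y1K: "y1 i k \<in> K" for i k using one(1) zK by (auto simp: y1_def)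
  have times_one: "\<exists>rs. \<forall>i<m. \<forall>k<m. operand_val rs (snd P ! (i * m + k)) = Some (x i k)"
    if x: "\<And>i k. x i k \<in> K" for x
  proof -
    obtain rs z where z: "\<And>i k. i < m \<Longrightarrow> k < m \<Longrightarrow> operand_val rs (snd P ! (i * m + k)) = Some (z i k)"
      "\<And>i k. i < m \<Longrightarrow> k < m \<Longrightarrow> z i k \<in> K"
      "\<And>i. i < m \<Longrightarrow> val (z i) = linpoly_mult L K (extend (\<lambda>i. val (x i))) (extend (\<lambda>i. val (y1 i))) i"
      by (rule linpoly_slp_outputs[OF P, of x y1]) (use x y1K in auto)
    have "extend (\<lambda>i. val (x i)) \<in> linpolys L K m m"
      using x by (intro extend_linpolys val_closed)
    then have "val (z i) = val (x i)" if "i < m" for i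
      using z(3)[OF that] that unfolding y1 by (simp add: extend_def linpoly_mult_one)
    then have "z i k = x i k" if "i < m" "k < m" for i k
      using coords_unique[of "z i" "x i" k] z(2) x that by blast
    then show ?thesis using z(1) by metis
  qed
  \<comment> \<open>A zero factor forces zero outputs while the other factor's input registers may
    all hold 1, so that no input register can serve as an output.\<close>
  have times_zero: "\<exists>rs. length rs = 2 * (m * m) + length (fst P) \<and>
     (\<forall>r<2 * (m * m). rs ! r = (flatten m m (\<lambda>_ _. a) @ flatten m m (\<lambda>_ _. b)) ! r) \<and>
     (\<forall>i<m. \<forall>k<m. operand_val rs (snd P ! (i * m + k)) = Some \<zero>)"
    if ab: "a \<in> K" "b \<in> K" "a = \<zero> \<or> b = \<zero>" for a b
  proof -
    let ?a = "extend (\<lambda>i. val (\<lambda>_. a))" and ?b = "extend (\<lambda>i. val (\<lambda>_. b))"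
    obtain rs z where z: "length rs = 2 * (m * m) + length (fst P)"
      "\<And>r. r < 2 * (m * m) \<Longrightarrow> rs ! r = (flatten m m (\<lambda>_ _. a) @ flatten m m (\<lambda>_ _. b)) ! r"
      "\<And>i k. i < m \<Longrightarrow> k < m \<Longrightarrow> operand_val rs (snd P ! (i * m + k)) = Some (z i k)"
      "\<And>i k. i < m \<Longrightarrow> k < m \<Longrightarrow> z i k \<in> K"
      "\<And>i. i < m \<Longrightarrow> val (z i) = linpoly_mult L K ?a ?b i"
      by (rule linpoly_slp_outputs[OF P, of "\<lambda>_ _. a" "\<lambda>_ _. b"]) (use ab in auto)
    have "?a \<in> linpolys L K m m" "?b \<in> linpolys L K m m"
      using ab by (auto intro!: extend_linpolys val_closed)
    moreover have "(\<forall>i. ?a i = \<zero>) \<or> (\<forall>i. ?b i = \<zero>)"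
      using ab(3) val_zero by (auto simp: extend_def)
    ultimately have "linpoly_mult L K ?a ?b i = \<zero>" for i
      using linpoly_mult_zero_left linpoly_mult_zero_right by blast
    then have "val (z i) = val (\<lambda>_. \<zero>)" if "i < m" for i
      using z(5)[OF that] val_zero by simp
    then have "z i k = \<zero>" if "i < m" "k < m" for i k
      using coords_unique[of "z i" "\<lambda>_. \<zero>" k] z(4) zK that by blast
    then show ?thesis using z(1-3) by (intro exI[of _ rs]) simp
  qed
  define out where "out = (\<lambda>(i, k). snd P ! (i * m + k))"
  have reg: "\<exists>r. out p = Reg r \<and> r \<in> {2 * (m * m)..<2 * (m * m) + length (fst P)}"
    if p: "p \<in> {..<m} \<times> {..<m}" for p
  proof -
    obtain i k where ik: "p = (i, k)" "i < m" "k < m" using p by auto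
    obtain rs1 where rs1: "operand_val rs1 (out p) = Some \<one>"
      using times_one[of "\<lambda>_ _. \<one>"] oK ik by (auto simp: out_def)
    obtain rs2 where rs2: "length rs2 = 2 * (m * m) + length (fst P)" "operand_val rs2 (out p) = Some \<zero>"
      "\<And>r. r < 2 * (m * m) \<Longrightarrow> rs2 ! r = (flatten m m (\<lambda>_ _. \<one>) @ flatten m m (\<lambda>_ _. \<zero>)) ! r"
      using times_zero[of \<one> \<zero>] oK zK ik by (auto simp: out_def)
    obtain rs3 where rs3: "length rs3 = 2 * (m * m) + length (fst P)" "operand_val rs3 (out p) = Some \<zero>"
      "\<And>r. r < 2 * (m * m) \<Longrightarrow> rs3 ! r = (flatten m m (\<lambda>_ _. \<zero>) @ flatten m m (\<lambda>_ _. \<one>)) ! r"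
      using times_zero[of \<zero> \<one>] oK zK ik by (auto simp: out_def)
    \<comment> \<open>A constant operand could not give both 1 and 0.\<close>
    obtain r where r: "out p = Reg r" using rs1 rs2(2) by (cases "out p") auto
    have len: "r < 2 * (m * m) + length (fst P)" and r2: "rs2 ! r = \<zero>" and r3: "rs3 ! r = \<zero>"
      using rs2(1,2) rs3(1,2) r by (auto split: if_splits)
    have "\<not> r < m * m"
      using rs2(3)[of r] r2 nth_flatten_const[of r m m \<one>] by (auto simp: nth_append)
    moreover have "\<not> r < 2 * (m * m)" if "m * m \<le> r"
      using rs3(3)[of r] r3 nth_flatten_const[of "r - m * m" m m \<one>] that by (auto simp: nth_append)
    ultimately show ?thesis using r len by auto
  qed
  have inj: "inj_on out ({..<m} \<times> {..<m})"
  proof (rule inj_onI)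
    fix p p' assume p: "p \<in> {..<m} \<times> {..<m}" and p': "p' \<in> {..<m} \<times> {..<m}" and eq: "out p = out p'"
    \<comment> \<open>The matrix with its single 1 at position \<open>p\<close> tells the operand at
      \<open>p\<close> apart from all others.\<close>
    have "(if (i, k) = p then \<one> else \<zero>) \<in> K" for i k using oK zK by simp
    then obtain rs where rs: "\<forall>i<m. \<forall>k<m. operand_val rs (snd P ! (i * m + k)) =
        Some (if (i, k) = p then \<one> else \<zero>)"
      using times_one[of "\<lambda>i k. if (i, k) = p then \<one> else \<zero>"] by blast
    have out: "operand_val rs (out p'') = Some (if p'' = p then \<one> else \<zero>)"
      if "p'' \<in> {..<m} \<times> {..<m}" for p''
      using rs that by (auto simp: out_def)
    have "Some \<one> = Some (if p' = p then \<one> else \<zero>)"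
      using out[OF p] out[OF p'] unfolding eq by (simp only: refl if_True)
    then show "p = p'" by (metis option.inject zero_not_one)
  qed
  have "card ({..<m} \<times> {..<m}) \<le> card (Reg ` {2 * (m * m)..<2 * (m * m) + length (fst P)} :: 'a operand set)"
    by (rule card_inj_on_le[OF inj]) (use reg in \<open>force simp: image_iff\<close>)+
  also have "\<dots> \<le> length (fst P)"
    using card_image_le[of "{2 * (m * m)..<2 * (m * m) + length (fst P)}" "Reg :: nat \<Rightarrow> 'a operand"] by simp
  finally show ?thesis by simp
qed


text \<open>For the basis d dual to u under the trace form, the trace of d j times x is coordinate j
  of x. Summing these traces times w j gives the wanted map, and expanding them gives the
  coefficients t.\<close>

lemma linearized_interpolation:
  assumes w: "\<And>k. k < m \<Longrightarrow> w k \<in> E"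
  obtains t where "\<And>i. t i \<in> E" "\<And>k. k < m \<Longrightarrow> (\<Oplus>i\<in>{..<m}. t i \<otimes> fr i (u k)) = w k"
proof -
  have "\<exists>g\<in>E. \<forall>k<m. tr (g \<otimes> u k) = (if k = j then \<one> else \<zero>)" for j
    using subringE(2,3)[OF K_subring] by (intro tr_form_surj) auto
  then obtain d where d: "\<And>j. d j \<in> E" "\<And>j k. k < m \<Longrightarrow> tr (d j \<otimes> u k) = (if k = j then \<one> else \<zero>)"
    by metis
  define t where "t i = (\<Oplus>j\<in>{..<m}. w j \<otimes> fr i (d j))" for i
  note c = w[THEN E_closed] d(1)[THEN E_closed] u_closed
  show ?thesis
  proof (rule that)
    show "t i \<in> E" for i unfolding t_def using w d(1) by (intro E_finsum E_mult fr_closed) auto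
    fix k assume k: "k < m"
    have "(\<Oplus>i\<in>{..<m}. t i \<otimes> fr i (u k)) = (\<Oplus>i\<in>{..<m}. \<Oplus>j\<in>{..<m}. w j \<otimes> fr i (d j \<otimes> u k))"
      unfolding t_def using c k
      by (intro finsum_cong') (auto simp: finsum_ldistr Pi_iff m_assoc fr_mult intro!: finsum_cong')
    also have "\<dots> = (\<Oplus>j\<in>{..<m}. \<Oplus>i\<in>{..<m}. w j \<otimes> fr i (d j \<otimes> u k))"
      using c k by (intro finsum_swap) auto
    also have "\<dots> = (\<Oplus>j\<in>{..<m}. w j \<otimes> tr (d j \<otimes> u k))"
      unfolding tr_def using c k by (intro finsum_cong') (auto simp: finsum_rdistr Pi_iff)
    also have "\<dots> = (\<Oplus>j\<in>{..<m}. if k = j then w j else \<zero>)"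
      using c k d(2)[OF k] by (intro finsum_cong') auto
    also have "\<dots> = w k" using c k by (intro finsum_singleton) auto
    finally show "(\<Oplus>i\<in>{..<m}. t i \<otimes> fr i (u k)) = w k" .
  qed
qed

section \<open>Vectors over \<open>E\<close> as computed quantities\<close>

lemma val_add:
  assumes "\<And>k. k < m \<Longrightarrow> x k \<in> K" "\<And>k. k < m \<Longrightarrow> y k \<in> K"
  shows "val (\<lambda>k. x k \<oplus> y k) = val x \<oplus> val y"
proof -
  note c = assms[THEN K_closed] u_closed
  have "val (\<lambda>k. x k \<oplus> y k) = (\<Oplus>k\<in>{..<m}. x k \<otimes> u k \<oplus> y k \<otimes> u k)"
    unfolding val_def using c by (intro finsum_cong') (auto simp: l_distr)
  then show ?thesis unfolding val_def using c by (simp add: finsum_addf Pi_iff)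
qed

lemma val_cong:
  assumes "\<And>k. k < m \<Longrightarrow> x k = y k" "\<And>k. k < m \<Longrightarrow> y k \<in> K"
  shows "val x = val y"
  unfolding val_def using assms K_closed u_closed by (intro finsum_cong') auto

text \<open>Registers hold elements of \<open>K\<close>, so an element of \<open>E\<close> is at
  hand once its \<open>m\<close> coordinates are.\<close>

definition holds_vec :: "'a list set \<Rightarrow> ('a list \<Rightarrow> 'a) set \<Rightarrow> ('a list \<Rightarrow> nat \<Rightarrow> 'a) \<Rightarrow> bool" where
  "holds_vec D V f \<longleftrightarrow> (\<exists>A. (\<forall>i<m. \<forall>k<m. A i k \<in> V) \<and>
     (\<forall>x\<in>D. \<forall>i<m. (\<forall>k<m. A i k x \<in> K) \<and> f x i = val (\<lambda>k. A i k x)))"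

text \<open>\<open>V\<close> contains everything that is free, so constant vectors and zero padding
  need no instruction.\<close>

definition vec_computable :: "'a list set \<Rightarrow> nat \<Rightarrow> ('a list \<Rightarrow> nat \<Rightarrow> 'a) set \<Rightarrow> bool" where
  "vec_computable D c W \<longleftrightarrow>
     (\<exists>V. avail F D [] \<subseteq> V \<and> computable F D c V \<and> (\<forall>f\<in>W. holds_vec D V f))"

lemma holds_vecE:
  assumes "holds_vec D V f"
  obtains A where "\<And>i k. i < m \<Longrightarrow> k < m \<Longrightarrow> A i k \<in> V"
    "\<And>x i k. x \<in> D \<Longrightarrow> i < m \<Longrightarrow> k < m \<Longrightarrow> A i k x \<in> K"
    "\<And>x i. x \<in> D \<Longrightarrow> i < m \<Longrightarrow> f x i = val (\<lambda>k. A i k x)"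
  using assms unfolding holds_vec_def by metis

lemma holds_vecI:
  assumes "\<And>i k. i < m \<Longrightarrow> k < m \<Longrightarrow> A i k \<in> V"
    "\<And>x i k. x \<in> D \<Longrightarrow> i < m \<Longrightarrow> k < m \<Longrightarrow> A i k x \<in> K"
    "\<And>x i. x \<in> D \<Longrightarrow> i < m \<Longrightarrow> f x i = val (\<lambda>k. A i k x)"
  shows "holds_vec D V f"
  unfolding holds_vec_def using assms by (intro exI[of _ A]) simp

lemma holds_vec_mono: "holds_vec D V f \<Longrightarrow> V \<subseteq> V' \<Longrightarrow> holds_vec D V' f"
  by (erule holds_vecE, rule holds_vecI) (blast, simp_all)

lemma holds_vec_cong:
  assumes "holds_vec D V f" "\<And>x i. x \<in> D \<Longrightarrow> i < m \<Longrightarrow> g x i = f x i"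
  shows "holds_vec D V g"
  using assms(1) by (rule holds_vecE, intro holds_vecI) (simp_all add: assms(2))

lemma holds_vec_E: "holds_vec D V f \<Longrightarrow> x \<in> D \<Longrightarrow> i < m \<Longrightarrow> f x i \<in> E"
  by (erule holds_vecE) (simp add: val_closed)

lemma holds_vec_const:
  assumes "avail F D [] \<subseteq> V" "\<And>i. i < m \<Longrightarrow> v i \<in> E"
  shows "holds_vec D V (\<lambda>_. v)"
proof -
  have "\<exists>x. (\<forall>k. x k \<in> K) \<and> (i < m \<longrightarrow> val x = v i)" for i
    using coords_exist[of "v i"] coords_exist[OF E_zero] assms(2)[of i] by (cases "i < m") auto
  then obtain x where x: "\<And>i k. x i k \<in> K" "\<And>i. i < m \<Longrightarrow> val (x i) = v i" by metis
  have "(\<lambda>_. x i k) \<in> V" for i k using avail_const[of "x i k" F D] x(1) assms(1) by auto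
  then show ?thesis using x by (intro holds_vecI[of "\<lambda>i k _. x i k"]) simp_all
qed

text \<open>Selecting, permuting and zero padding of entries only choose other operands and cost
  nothing.\<close>

lemma holds_vec_reindex:
  assumes V: "avail F D [] \<subseteq> V" and f: "holds_vec D V f" and h: "\<And>i. i < m \<Longrightarrow> P i \<Longrightarrow> h i < m"
  shows "holds_vec D V (\<lambda>x i. if P i then f x (h i) else \<zero>)"
proof -
  have zK: "\<zero> \<in> K" by (rule subringE(2)[OF K_subring])
  obtain A where A: "\<And>i k. i < m \<Longrightarrow> k < m \<Longrightarrow> A i k \<in> V"
    "\<And>x i k. x \<in> D \<Longrightarrow> i < m \<Longrightarrow> k < m \<Longrightarrow> A i k x \<in> K"
    "\<And>x i. x \<in> D \<Longrightarrow> i < m \<Longrightarrow> f x i = val (\<lambda>k. A i k x)"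
    using f by (rule holds_vecE) blast
  have "(\<lambda>_. \<zero>) \<in> V" using avail_const[of \<zero> F D] zK V by auto
  then show ?thesis
    using A h zK by (intro holds_vecI[of "\<lambda>i k. if P i then A (h i) k else (\<lambda>_. \<zero>)"]) (auto simp: val_zero)
qed

lemma vec_computableE:
  assumes "vec_computable D c W"
  obtains V where "avail F D [] \<subseteq> V" "computable F D c V" "\<And>f. f \<in> W \<Longrightarrow> holds_vec D V f"
  using assms unfolding vec_computable_def by blast

lemma vec_computable_mono:
  assumes "vec_computable D c W" "c \<le> c'" "W' \<subseteq> W"
  shows "vec_computable D c' W'"
  using assms(1)
proof (rule vec_computableE)
  fix V assume V: "avail F D [] \<subseteq> V" "computable F D c V" "\<And>f. f \<in> W \<Longrightarrow> holds_vec D V f"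
  show ?thesis
    unfolding vec_computable_def
    using V(1) computable_mono[OF V(2) assms(2) subset_refl] V(3) assms(3) by (intro exI[of _ V]) auto
qed

lemma vec_computable_insert:
  assumes "vec_computable D c W"
    and g: "\<And>V. avail F D [] \<subseteq> V \<Longrightarrow> (\<And>f. f \<in> W \<Longrightarrow> holds_vec D V f) \<Longrightarrow> holds_vec D V g"
  shows "vec_computable D c (insert g W)"
  using assms(1)
proof (rule vec_computableE)
  fix V assume V: "avail F D [] \<subseteq> V" "computable F D c V" "\<And>f. f \<in> W \<Longrightarrow> holds_vec D V f"
  show ?thesis
    unfolding vec_computable_def using V g[OF V(1,3)] by (intro exI[of _ V]) auto
qed

lemma vec_computable_const:
  assumes "vec_computable D c W" "\<And>i. i < m \<Longrightarrow> v i \<in> E"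
  shows "vec_computable D c (insert (\<lambda>_. v) W)"
  using assms(1) by (rule vec_computable_insert) (rule holds_vec_const, assumption, rule assms(2))

lemma vec_computable_reindex:
  assumes "vec_computable D c W" "f \<in> W" "\<And>i. i < m \<Longrightarrow> P i \<Longrightarrow> h i < m"
  shows "vec_computable D c (insert (\<lambda>x i. if P i then f x (h i) else \<zero>) W)"
  using assms(1)
proof (rule vec_computable_insert)
  fix V assume "avail F D [] \<subseteq> V" "\<And>f. f \<in> W \<Longrightarrow> holds_vec D V f"
  then show "holds_vec D V (\<lambda>x i. if P i then f x (h i) else \<zero>)"
    using assms(2,3) by (intro holds_vec_reindex) simp_all
qed

lemma vec_computable_cong:
  assumes "vec_computable D c W" "f \<in> W" "\<And>x i. x \<in> D \<Longrightarrow> i < m \<Longrightarrow> g x i = f x i"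
  shows "vec_computable D c (insert g W)"
  using assms(1)
proof (rule vec_computable_insert)
  fix V assume "\<And>f. f \<in> W \<Longrightarrow> holds_vec D V f"
  from this[OF assms(2)] show "holds_vec D V g" using assms(3) by (rule holds_vec_cong)
qed

lemma vec_computable_E: "vec_computable D c W \<Longrightarrow> f \<in> W \<Longrightarrow> x \<in> D \<Longrightarrow> i < m \<Longrightarrow> f x i \<in> E"
  by (erule vec_computableE) (blast intro: holds_vec_E)

lemma vec_computable_add:
  assumes W: "vec_computable D c W" "f \<in> W" "g \<in> W" and n: "\<forall>x\<in>D. length x = n"
  shows "vec_computable D (c + m * m) (insert (\<lambda>x i. f x i \<oplus> g x i) W)"
proof -
  obtain V where V: "avail F D [] \<subseteq> V" "computable F D c V" "\<And>f. f \<in> W \<Longrightarrow> holds_vec D V f"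
    using W(1) by (rule vec_computableE) blast
  obtain A where A: "\<And>i k. i < m \<Longrightarrow> k < m \<Longrightarrow> A i k \<in> V"
    "\<And>x i k. x \<in> D \<Longrightarrow> i < m \<Longrightarrow> k < m \<Longrightarrow> A i k x \<in> K"
    "\<And>x i. x \<in> D \<Longrightarrow> i < m \<Longrightarrow> f x i = val (\<lambda>k. A i k x)"
    using V(3)[OF W(2)] by (rule holds_vecE) blast
  obtain B where B: "\<And>i k. i < m \<Longrightarrow> k < m \<Longrightarrow> B i k \<in> V"
    "\<And>x i k. x \<in> D \<Longrightarrow> i < m \<Longrightarrow> k < m \<Longrightarrow> B i k x \<in> K"
    "\<And>x i. x \<in> D \<Longrightarrow> i < m \<Longrightarrow> g x i = val (\<lambda>k. B i k x)"
    using V(3)[OF W(3)] by (rule holds_vecE) blast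
  let ?Z = "\<lambda>i k x. A i k x \<oplus> B i k x"
  let ?V = "V \<union> (\<lambda>(i, k). ?Z i k) ` ({..<m} \<times> {..<m})"
  have "computable F D (c + card ({..<m} \<times> {..<m}))
     (V \<union> (\<lambda>p x. (case p of (i, k) \<Rightarrow> A i k) x \<oplus>\<^bsub>F\<^esub> (case p of (i, k) \<Rightarrow> B i k) x) ` ({..<m} \<times> {..<m}))"
    using A(1) B(1) by (intro computable_add[OF _ V(2) n]) auto
  then have "computable F D (c + m * m) ?V"
    by (rule computable_mono) (auto simp: split_def image_def)
  moreover have "holds_vec D ?V (\<lambda>x i. f x i \<oplus> g x i)"
    using A(2,3) B(2,3) subringE(7)[OF K_subring]
    by (intro holds_vecI[of ?Z]) (auto simp: val_add)
  ultimately show ?thesis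
    unfolding vec_computable_def using V(1,3) holds_vec_mono[of D V _ ?V]
    by (intro exI[of _ ?V]) auto
qed

abbreviation c0 :: nat where "c0 \<equiv> linpoly_cost L K m u"

text \<open>One product, followed by (m - 1) m additions that fold its upper coefficients onto the
  lower ones.\<close>

lemma vec_computable_cyc:
  assumes W: "vec_computable D c W" "f \<in> W" "g \<in> W" and n: "\<forall>x\<in>D. length x = n"
  shows "vec_computable D (c + c0 + m * m) (insert (\<lambda>x. cyc (f x) (g x)) W)"
proof (cases "D = {}")
  case True
  then have "vec_computable D c (insert (\<lambda>x. cyc (f x) (g x)) W)"
    using W by (intro vec_computable_cong[of _ _ _ f]) auto
  then show ?thesis by (rule vec_computable_mono) auto
next
  case False
  obtain V where V: "avail F D [] \<subseteq> V" "computable F D c V" "\<And>f. f \<in> W \<Longrightarrow> holds_vec D V f"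
    using W(1) by (rule vec_computableE) blast
  obtain A where A: "\<And>i k. i < m \<Longrightarrow> k < m \<Longrightarrow> A i k \<in> V"
    "\<And>x i k. x \<in> D \<Longrightarrow> i < m \<Longrightarrow> k < m \<Longrightarrow> A i k x \<in> K"
    "\<And>x i. x \<in> D \<Longrightarrow> i < m \<Longrightarrow> f x i = val (\<lambda>k. A i k x)"
    using V(3)[OF W(2)] by (rule holds_vecE) blast
  obtain B where B: "\<And>i k. i < m \<Longrightarrow> k < m \<Longrightarrow> B i k \<in> V"
    "\<And>x i k. x \<in> D \<Longrightarrow> i < m \<Longrightarrow> k < m \<Longrightarrow> B i k x \<in> K"
    "\<And>x i. x \<in> D \<Longrightarrow> i < m \<Longrightarrow> g x i = val (\<lambda>k. B i k x)"
    using V(3)[OF W(3)] by (rule holds_vecE) blast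
  obtain P where P: "slp_solves F P (linpoly_problem L K m u)" "length (fst P) = c0"
    using linpoly_slp_exists op_cost_attained unfolding linpoly_cost_def by blast
  let ?vs = "flatten m m A @ flatten m m B"
  have ev: "map (\<lambda>v. v x) ?vs = flatten m m (\<lambda>i k. A i k x) @ flatten m m (\<lambda>i k. B i k x)" for x
    by (simp add: map_flatten)
  have dom: "map (\<lambda>v. v x) ?vs \<in> Domain (linpoly_problem L K m u)" if "x \<in> D" for x
    unfolding ev linpoly_Domain_iff using A(2)[OF that] B(2)[OF that] by blast
  have "set ?vs \<subseteq> V" using A(1) B(1) by (auto simp: set_flatten)
  from computable_solve[OF V(2) n this P(1) ballI[OF dom]] obtain ws where
    sol: "computable F D (c + length (fst P)) (V \<union> set ws) \<and>
      (\<forall>x\<in>D. (map (\<lambda>v. v x) ?vs, map (\<lambda>v. v x) ws) \<in> linpoly_problem L K m u)" by (rule exE)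
  note ws = conjunct1[OF sol, unfolded P(2)] bspec[OF conjunct2[OF sol]]
  define Z where "Z i k = ws ! (i * m + k)" for i k
  let ?l = "\<lambda>x. linpoly_mult L K (extend (\<lambda>i. val (\<lambda>k. A i k x))) (extend (\<lambda>i. val (\<lambda>k. B i k x)))"
  have Zx: "Z i k \<in> set ws \<and> Z i k x \<in> K" "val (\<lambda>k. Z i k x) = ?l x i"
    if x: "x \<in> D" and i: "i < 2 * m - 1" and k: "k < m" for x i k
  proof -
    obtain z where z: "map (\<lambda>v. v x) ws = flatten (2 * m - 1) m z"
      "\<forall>i<2 * m - 1. \<forall>k<m. z i k \<in> K" "\<forall>i<2 * m - 1. val (z i) = ?l x i"
      using linpoly_problemD[OF ws(2)[OF x, unfolded ev]] by blast
    have len: "length ws = (2 * m - 1) * m" using arg_cong[OF z(1), of length] by simp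
    have Zz: "Z i k x = z i k" if "k < m" for k
      using arg_cong[OF z(1), of "\<lambda>l. l ! (i * m + k)"] nth_flatten[OF i that] len
        flatten_index_less[OF i that] by (simp add: Z_def)
    then have "val (\<lambda>k. Z i k x) = val (z i)" using z(2) i by (intro val_cong) auto
    then show "val (\<lambda>k. Z i k x) = ?l x i" using z(3) i by simp
    show "Z i k \<in> set ws \<and> Z i k x \<in> K"
      using len flatten_index_less[OF i k] Zz[OF k] z(2) i k by (auto simp: Z_def)
  qed
  \<comment> \<open>The length of the output list is read off an actual run, so membership of
    \<open>Z i k\<close> in it takes some input.\<close>
  obtain x0 where x0: "x0 \<in> D" using False by blast
  \<comment> \<open>Row m - 1 has no partner: coefficient 2 m - 1 is zero and not among the
    outputs.\<close>
  define G where "G i k = (if i < m - 1 then \<lambda>x. Z i k x \<oplus> Z (i + m) k x else Z i k)" for i k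
  let ?I = "{..<m - 1} \<times> {..<m}"
  let ?V = "V \<union> set ws \<union> (\<lambda>(i, k) x. Z i k x \<oplus> Z (i + m) k x) ` ?I"
  have "computable F D (c + c0 + card ?I)
     (V \<union> set ws \<union> (\<lambda>p x. (case p of (i, k) \<Rightarrow> Z i k) x \<oplus>\<^bsub>F\<^esub> (case p of (i, k) \<Rightarrow> Z (i + m) k) x) ` ?I)"
    using Zx(1)[OF x0] by (intro computable_add[OF _ ws(1) n]) auto
  moreover have "card ?I \<le> m * m" by (auto simp: card_cartesian_product)
  ultimately have comp: "computable F D (c + c0 + m * m) ?V"
    by (elim computable_mono) (auto simp: split_def image_def)
  have "holds_vec D ?V (\<lambda>x. cyc (f x) (g x))"
  proof (rule holds_vecI[of G])
    fix i k assume i: "i < m" and k: "k < m"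
    show "G i k \<in> ?V"
    proof (cases "i < m - 1")
      case True
      then have "G i k \<in> (\<lambda>(i, k) x. Z i k x \<oplus> Z (i + m) k x) ` ?I"
        using k by (intro image_eqI[of _ _ "(i, k)"]) (auto simp: G_def)
      then show ?thesis by blast
    next
      case False
      then show ?thesis using Zx(1)[OF x0 _ k, of i] i by (simp add: G_def)
    qed
  next
    fix x i k assume x: "x \<in> D" and i: "i < m" and k: "k < m"
    show "G i k x \<in> K"
      using Zx(1)[OF x _ k, of i] Zx(1)[OF x _ k, of "i + m"] i subringE(7)[OF K_subring]
      by (auto simp: G_def)
  next
    fix x i assume x: "x \<in> D" and i: "i < m"
    let ?a = "extend (\<lambda>i. val (\<lambda>k. A i k x))" and ?b = "extend (\<lambda>i. val (\<lambda>k. B i k x))"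
    have ab: "?a \<in> linpolys L K m m" "?b \<in> linpolys L K m m"
      using A(2)[OF x] B(2)[OF x] by (auto intro!: extend_linpolys val_closed)
    have "cyc (f x) (g x) i = cyc ?a ?b i"
      using A(2,3)[OF x] B(2,3)[OF x] by (intro cyc_cong) (auto simp: extend_def val_closed)
    also have "\<dots> = ?l x i \<oplus> ?l x (i + m)" by (rule cyc_eq_linpoly_mult[OF ab i])
    also have "\<dots> = val (\<lambda>k. G i k x)"
    proof (cases "i < m - 1")
      case True
      then have "val (\<lambda>k. G i k x) = val (\<lambda>k. Z i k x) \<oplus> val (\<lambda>k. Z (i + m) k x)"
        using Zx(1)[OF x, of i] Zx(1)[OF x, of "i + m"] i by (simp add: G_def val_add)
      then show ?thesis
        using Zx(2)[OF x _ m_pos, of i] Zx(2)[OF x _ m_pos, of "i + m"] i True by simp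
    next
      case False
      then have "?l x (i + m) = \<zero>" by (intro linpoly_mult_zero[OF ab]) linarith
      then show ?thesis
        using Zx(2)[OF x _ m_pos, of i] i False E_closed[OF linpoly_mult_closed[OF ab]]
        by (simp add: G_def)
    qed
    finally show "cyc (f x) (g x) i = val (\<lambda>k. G i k x)" .
  qed
  then show ?thesis
    unfolding vec_computable_def using comp V(1,3) holds_vec_mono[of D V _ ?V]
    by (intro exI[of _ ?V]) auto
qed

text \<open>Two cyclic products at \<open>c0 + m * m\<close> each, one per parity, and
  \<open>m * m\<close> additions to join them. The index reversal \<open>?s\<close> is free.\<close>

lemma vec_computable_qtransform:
  assumes W: "vec_computable D c W" "f \<in> W" and n: "\<forall>x\<in>D. length x = n" and g: "g \<in> E"
  shows "vec_computable D (c + (2 * c0 + 3 * (m * m))) (insert (\<lambda>x. qtransform g (f x)) W)"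
proof -
  let ?p = "\<lambda>e x. part e (f x)" and ?s = "\<lambda>(h :: 'a list \<Rightarrow> nat \<Rightarrow> 'a) x i. if True then h x ((m - i) mod m) else \<zero>"
  let ?c = "\<lambda>e x. cyc (part e (f x)) (rot e g)"
  have part: "?p e = (\<lambda>x i. if 2 * i + e < m then f x (2 * i + e) else \<zero>)" for e
    by (simp add: part_def fun_eq_iff)
  have rot: "rot e g i \<in> E" for e i using g by (auto simp: rot_def intro: fr_closed)
  let ?W1 = "insert (?p 0) (insert (?p 1) (insert (\<lambda>_. rot 0 g) (insert (\<lambda>_. rot 1 g) W)))"
  have "vec_computable D c ?W1"
    unfolding part using W rot
    by (intro vec_computable_reindex vec_computable_const) auto
  then have "vec_computable D (c + c0 + m * m) (insert (?c 0) ?W1)"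
    by (rule vec_computable_cyc[OF _ _ _ n, where g = "\<lambda>_. rot 0 g"]) auto
  then have "vec_computable D (c + c0 + m * m + c0 + m * m) (insert (?c 1) (insert (?c 0) ?W1))"
    by (rule vec_computable_cyc[OF _ _ _ n, where g = "\<lambda>_. rot 1 g"]) auto
  then have "vec_computable D (c + c0 + m * m + c0 + m * m)
      (insert (?s (?c 0)) (insert (?s (?c 1)) (insert (?c 1) (insert (?c 0) ?W1))))" (is "vec_computable D _ ?W2")
    using m_pos by (intro vec_computable_reindex[where P = "\<lambda>_. True"]) auto
  then have "vec_computable D (c + c0 + m * m + c0 + m * m + m * m)
      (insert (\<lambda>x i. ?s (?c 0) x i \<oplus> ?s (?c 1) x i) ?W2)"
    by (rule vec_computable_add[OF _ _ _ n]) auto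
  then have "vec_computable D (c + c0 + m * m + c0 + m * m + m * m)
      (insert (\<lambda>x. qtransform g (f x)) (insert (\<lambda>x i. ?s (?c 0) x i \<oplus> ?s (?c 1) x i) ?W2))"
    by (rule vec_computable_cong)
      (use qtransform_eq_cyc[OF g] vec_computable_E[OF W] in auto)
  then show ?thesis by (rule vec_computable_mono) auto
qed

section \<open>Reduction of matrix multiplication\<close>


text \<open>Columns are coordinates of elements of \<open>E\<close>. The polynomial with
  coefficients \<open>a\<close> sends conjugate k of \<open>\<beta>\<close> to column k of A,
  \<open>b'\<close> sends conjugate j to column j of B, and the fixed polynomial \<open>t\<close>
  sends \<open>u k\<close> to conjugate k. Hence \<open>a\<close>, \<open>t\<close> and
  \<open>b'\<close> composed send conjugate j to column j of the product. The cost is 3 (2 c0 + 3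
  m^2) + 2 (c0 + m^2) = 8 c0 + 11 m^2.\<close>

lemma matmul_cost_le: "matmul_cost F m \<le> 19 * linpoly_cost L K m u"
proof -
  obtain P where P: "slp_solves F P (linpoly_problem L K m u)" "length (fst P) = c0"
    using linpoly_slp_exists op_cost_attained unfolding linpoly_cost_def by blast
  have m2: "m * m \<le> c0" using square_le_slp_length[OF P(1)] P(2) by simp
  obtain \<beta> \<gamma> where \<beta>\<gamma>: "\<beta> \<in> E" "\<gamma> \<in> E"
    and orth: "\<And>i j. i < m \<Longrightarrow> j < m \<Longrightarrow>
       (\<Oplus>l\<in>{..<m}. fr (i + l) \<gamma> \<otimes> fr (j + l) \<beta>) = (if i = j then \<one> else \<zero>)"
    by (rule dual_normal_bases) blast
  obtain t where t: "\<And>i. t i \<in> E" "\<And>k. k < m \<Longrightarrow> (\<Oplus>i\<in>{..<m}. t i \<otimes> fr i (u k)) = fr k \<beta>"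
    by (rule linearized_interpolation[of "\<lambda>k. fr k \<beta>"]) (use fr_closed[OF \<beta>\<gamma>(1)] in blast)+
  let ?R = "matmul_problem F m"
  let ?D = "Domain ?R"
  have D: "\<exists>A B. x = flatten m m A @ flatten m m B \<and> (x, flatten m m (mat_prod F m A B)) \<in> ?R \<and>
      (\<forall>i<m. \<forall>k<m. A i k \<in> K \<and> B i k \<in> K)" if "x \<in> ?D" for x
  proof -
    from that obtain zs where "(x, zs) \<in> ?R" by blast
    then obtain A B where AB: "x = flatten m m A @ flatten m m B" "zs = flatten m m (mat_prod F m A B)"
      "A \<in> mats F m m" "B \<in> mats F m m"
      unfolding matmul_problem_def by (simp only: mem_Collect_eq prod.inject) metis
    then show ?thesis
      using \<open>(x, zs) \<in> ?R\<close> by (intro exI[of _ A] exI[of _ B]) (simp add: mats_def)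
  qed
  have n: "\<forall>x\<in>?D. length x = 2 * (m * m)"
  proof
    fix x assume "x \<in> ?D"
    from D[OF this] obtain A B where "x = flatten m m A @ flatten m m B" by blast
    then show "length x = 2 * (m * m)" by simp
  qed
  define f where "f x k = val (\<lambda>i. x ! (i * m + k))" for x k
  define g where "g x j = val (\<lambda>k. x ! (m * m + (k * m + j)))" for x j
  have entries: "x ! (i * m + k) = A i k" "x ! (m * m + (i * m + k)) = B i k"
    if "x = flatten m m A @ flatten m m B" "i < m" "k < m" for x A B i k
    using that flatten_index_less[OF that(2,3)] nth_flatten[OF that(2,3)] by (simp_all add: nth_append)
  have xK: "x ! (i * m + k) \<in> K" "x ! (m * m + (i * m + k)) \<in> K"
    if x: "x \<in> ?D" and ik: "i < m" "k < m" for x i k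
  proof -
    obtain A B where AB: "x = flatten m m A @ flatten m m B" "A i k \<in> K" "B i k \<in> K"
      using D[OF x] ik by blast
    show "x ! (i * m + k) \<in> K" "x ! (m * m + (i * m + k)) \<in> K"
      unfolding entries[OF AB(1) ik] using AB(2,3) by simp_all
  qed
  have inp: "(\<lambda>x. x ! p) \<in> avail F ?D []" if "p < 2 * (m * m)" for p
    using that n by (intro avail_input) simp
  have "holds_vec ?D (avail F ?D []) f"
  proof (rule holds_vecI[of "\<lambda>k i x. x ! (i * m + k)"])
    fix k i assume "k < m" "i < m"
    from flatten_index_less[OF this(2,1)] show "(\<lambda>x. x ! (i * m + k)) \<in> avail F ?D []"
      by (intro inp) simp
  qed (simp_all add: xK f_def)
  moreover have "holds_vec ?D (avail F ?D []) g"
  proof (rule holds_vecI[of "\<lambda>j k x. x ! (m * m + (k * m + j))"])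
    fix j k assume "j < m" "k < m"
    from flatten_index_less[OF this(2,1)] show "(\<lambda>x. x ! (m * m + (k * m + j))) \<in> avail F ?D []"
      by (intro inp) simp
  qed (simp_all add: xK g_def)
  ultimately have V0: "vec_computable ?D 0 {f, g}"
    unfolding vec_computable_def by (intro exI[of _ "avail F ?D []"]) (auto intro: computable_base)
  let ?q = "2 * c0 + 3 * (m * m)"
  define a where "a x = qtransform \<gamma> (f x)" for x
  define b' where "b' x = qtransform \<gamma> (g x)" for x
  define b where "b x = cyc t (b' x)" for x
  define c where "c x = cyc (a x) (b x)" for x
  define out where "out x = qtransform \<beta> (c x)" for x
  have "vec_computable ?D (0 + ?q) (insert a {f, g})"
    unfolding a_def by (rule vec_computable_qtransform[OF V0 _ n \<beta>\<gamma>(2)]) simp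
  then have "vec_computable ?D (0 + ?q + ?q) (insert b' (insert a {f, g}))"
    unfolding b'_def by (rule vec_computable_qtransform[OF _ _ n \<beta>\<gamma>(2)]) simp
  then have "vec_computable ?D (0 + ?q + ?q) (insert (\<lambda>_. t) (insert b' (insert a {f, g})))"
    by (rule vec_computable_const) (rule t(1))
  then have "vec_computable ?D (0 + ?q + ?q + c0 + m * m)
      (insert b (insert (\<lambda>_. t) (insert b' (insert a {f, g}))))"
    unfolding b_def by (rule vec_computable_cyc[OF _ _ _ n, where f = "\<lambda>_. t"]) simp_all
  then have "vec_computable ?D (0 + ?q + ?q + c0 + m * m + c0 + m * m)
      (insert c (insert b (insert (\<lambda>_. t) (insert b' (insert a {f, g})))))"
    unfolding c_def by (rule vec_computable_cyc[OF _ _ _ n]) simp_all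
  then have "vec_computable ?D (0 + ?q + ?q + c0 + m * m + c0 + m * m + ?q)
      (insert out (insert c (insert b (insert (\<lambda>_. t) (insert b' (insert a {f, g}))))))"
    unfolding out_def by (rule vec_computable_qtransform[OF _ _ n \<beta>\<gamma>(1)]) simp
  then have "vec_computable ?D (19 * c0) {out}"
    by (rule vec_computable_mono) (use m2 in auto)
  then obtain V where V: "computable F ?D (19 * c0) V" "holds_vec ?D V out"
    by (rule vec_computableE) blast
  from V(2) obtain Z where Z: "\<And>i k. i < m \<Longrightarrow> k < m \<Longrightarrow> Z i k \<in> V"
    "\<And>x i k. x \<in> ?D \<Longrightarrow> i < m \<Longrightarrow> k < m \<Longrightarrow> Z i k x \<in> K"
    "\<And>x i. x \<in> ?D \<Longrightarrow> i < m \<Longrightarrow> out x i = val (\<lambda>k. Z i k x)"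
    by (rule holds_vecE) blast
  \<comment> \<open>The indices are exchanged since \<open>out x j\<close> carries column j, with
    the row index as coordinate.\<close>
  have Z_eq: "Z j i x = mat_prod F m A B i j"
    if x: "x \<in> ?D" "x = flatten m m A @ flatten m m B" and i: "i < m" and j: "j < m" for x A B i j
  proof -
    have AB: "A i k \<in> K" "B i k \<in> K" if "i < m" "k < m" for i k
      using xK[OF x(1) that] entries[OF x(2) that] by simp_all
    note c = AB[THEN K_closed] u_closed
    have AB': "A i k \<otimes> B k j \<in> K" if "i < m" "k < m" for i k
      using AB that j subringE(6)[OF K_subring] by blast
    have prod: "mat_prod F m A B i j = (\<Oplus>k\<in>{..<m}. A i k \<otimes> B k j)" if "i < m" for i
      unfolding mat_prod_def using AB'[OF that] by (subst finsum_F) auto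
    have MK: "mat_prod F m A B i j \<in> K" if "i < m" for i
      unfolding prod[OF that]
    proof -
      interpret F: field F by (rule field_F)
      have "finsum F (\<lambda>k. A i k \<otimes> B k j) {..<m} \<in> carrier F"
        using AB'[OF that] by (intro F.finsum_closed) auto
      then show "(\<Oplus>k\<in>{..<m}. A i k \<otimes> B k j) \<in> K"
        using finsum_F[of "{..<m}" "\<lambda>k. A i k \<otimes> B k j"] AB'[OF that] by simp
    qed
    have fx: "f x k = val (\<lambda>i. A i k)" and gx: "g x k = val (\<lambda>i. B i k)" if "k < m" for k
      unfolding f_def g_def using AB entries[OF x(2)] that by (auto intro!: val_cong)
    have fE: "f x k \<in> E" and gE: "g x k \<in> E" if "k < m" for k
      using that AB by (auto simp: fx gx intro!: val_closed)
    have aE: "a x i \<in> E" for i unfolding a_def by (rule qtransform_closed[OF \<beta>\<gamma>(2)]) (rule fE)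
    have b'E: "b' x i \<in> E" for i unfolding b'_def by (rule qtransform_closed[OF \<beta>\<gamma>(2)]) (rule gE)
    have bE: "b x i \<in> E" for i unfolding b_def by (rule cyc_closed) (rule t(1) b'E)+
    \<comment> \<open>Column j of B is expanded in the basis u, so that \<open>t\<close> can replace
      each \<open>u k\<close> by a conjugate of \<open>\<beta>\<close>.\<close>
    have "qtransform \<beta> (b' x) j = g x j"
      unfolding b'_def by (rule qtransform_inverse[OF \<beta>\<gamma> gE j orth])
    also have "\<dots> = (\<Oplus>k\<in>{..<m}. B k j \<otimes> u k)" unfolding gx[OF j] val_def ..
    finally have "qtransform \<beta> (b x) j = (\<Oplus>k\<in>{..<m}. B k j \<otimes> fr k \<beta>)"
      unfolding b_def using t b'E u_in_E AB j
      by (intro qtransform_cyc_eq_combination[OF \<beta>\<gamma>(1), where v = u]) auto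
    moreover have "(\<Oplus>i\<in>{..<m}. a x i \<otimes> fr i (fr k \<beta>)) = f x k" if "k < m" for k
    proof -
      have "(\<Oplus>i\<in>{..<m}. a x i \<otimes> fr i (fr k \<beta>)) = qtransform \<beta> (a x) k"
        unfolding qtransform_def using E_closed[OF aE] E_closed[OF \<beta>\<gamma>(1)]
        by (intro finsum_cong') (simp_all only: fr_add add.commute, auto)
      then show ?thesis unfolding a_def using qtransform_inverse[OF \<beta>\<gamma> fE that orth] by simp
    qed
    ultimately have "out x j = (\<Oplus>k\<in>{..<m}. B k j \<otimes> f x k)"
      unfolding out_def c_def using aE bE AB j fr_closed[OF \<beta>\<gamma>(1)]
      by (intro qtransform_cyc_eq_combination[OF \<beta>\<gamma>(1), where v = "\<lambda>k. fr k \<beta>"]) auto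
    also have "\<dots> = (\<Oplus>k\<in>{..<m}. \<Oplus>i\<in>{..<m}. (A i k \<otimes> B k j) \<otimes> u i)"
      using c j by (intro finsum_cong')
        (auto simp: fx val_def finsum_rdistr Pi_iff m_ac intro!: finsum_cong')
    also have "\<dots> = (\<Oplus>i\<in>{..<m}. \<Oplus>k\<in>{..<m}. (A i k \<otimes> B k j) \<otimes> u i)"
      using c j by (intro finsum_swap) auto
    also have "\<dots> = val (\<lambda>i. \<Oplus>k\<in>{..<m}. A i k \<otimes> B k j)"
      unfolding val_def using c j by (intro finsum_cong') (auto simp: finsum_ldistr Pi_iff)
    also have "\<dots> = val (\<lambda>i. mat_prod F m A B i j)"
      using prod MK by (intro val_cong) auto
    finally have eq: "val (\<lambda>i. Z j i x) = val (\<lambda>i. mat_prod F m A B i j)" using Z(3)[OF x(1) j] by simp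
    show ?thesis by (rule coords_unique[OF _ MK eq i]) (rule Z(2)[OF x(1) j])
  qed
  let ?ws = "flatten m m (\<lambda>i j. Z j i)"
  have "set ?ws \<subseteq> V" using Z(1) by (auto simp: set_flatten)
  moreover have "(x, map (\<lambda>v. v x) ?ws) \<in> ?R" if x: "x \<in> ?D" for x
  proof -
    obtain A B where AB: "x = flatten m m A @ flatten m m B" "(x, flatten m m (mat_prod F m A B)) \<in> ?R"
      using D[OF x] by blast
    have "map (\<lambda>v. v x) ?ws = flatten m m (mat_prod F m A B)"
      unfolding map_flatten using Z_eq[OF x AB(1)] by (intro flatten_cong)
    then show ?thesis using AB(2) by simp
  qed
  ultimately obtain Q where "slp_solves F Q ?R" "length (fst Q) \<le> 19 * c0"
    using computable_imp_slp[OF V(1)] by blast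
  then show ?thesis unfolding matmul_cost_def using op_cost_le order_trans by blast
qed

end

lemma enb_instance_basis_extension:
  assumes "(L, K, m, u) \<in> enb_instances"
  shows "basis_extension L K m u"
proof -
  have *: "algebraic_closure L K" "finite K" "elliptic_normal_basis L K m u"
    using assms by (auto simp: enb_instances_def)
  then have "field L" "subfield K L"
    by (auto simp: algebraic_closure_def)
  then show ?thesis
    using *(2,3) unfolding elliptic_normal_basis_def normal_basis_def
    by (simp add: basis_extension_def basis_extension_axioms_def finite_subfield_def finite_subfield_axioms_def)
qed

theorem lemma22:
  fixes \<omega> :: real
    and S :: "('a ring \<times> 'a set \<times> nat \<times> (nat \<Rightarrow> 'a)) set"
  assumes "\<omega> \<le> 3"
    and "(\<lambda>(F, N). real (matmul_cost F N))
           \<in> O[principal {(F :: 'a ring, N). field F \<and> finite (carrier F) \<and> N > 0}](\<lambda>(F, N). real N powr \<omega>)"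
    and "S \<subseteq> enb_instances"
  shows
    "(\<lambda>(L, K, m, u). real (matmul_cost (L\<lparr>carrier := K\<rparr>) m))
       \<in> O[principal S](\<lambda>(L, K, m, u). real m powr \<omega>)
     \<and> (\<lambda>(L, K, m, u). real (matmul_cost (L\<lparr>carrier := K\<rparr>) m))
       \<in> O[principal S](\<lambda>(L, K, m, u). real (linpoly_cost L K m u))
     \<and> ((\<lambda>(L, K, m, u). real m powr \<omega>)
          \<in> O[principal S](\<lambda>(L, K, m, u). real (matmul_cost (L\<lparr>carrier := K\<rparr>) m))
        \<longrightarrow> O[principal S](\<lambda>(L, K, m, u). real m powr \<omega>)
            \<subseteq> O[principal S](\<lambda>(L, K, m, u). real (linpoly_cost L K m u)))"
    (is "?mm \<in> O[_](?p) \<and> _ \<in> O[_](?l) \<and> _")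
proof -
  have basis: "basis_extension L K m u" if "(L, K, m, u) \<in> S" for L :: "'a ring" and K m u
    using that assms(3) enb_instance_basis_extension by blast
  \<comment> \<open>One constant serves all finite fields and sizes, which makes the bound uniform
    over \<open>S\<close>.\<close>
  obtain c where c: "c > 0" "\<And>F N. field F \<Longrightarrow> finite (carrier F) \<Longrightarrow> N > 0 \<Longrightarrow>
      real (matmul_cost (F :: 'a ring) N) \<le> c * real N powr \<omega>"
    using assms(2) by (elim landau_o.bigE) (auto simp: eventually_principal)
  have 1: "?mm \<in> O[principal S](?p)"
  proof (rule landau_o.bigI[OF c(1)], unfold eventually_principal, safe)
    fix L :: "'a ring" and K m u assume "(L, K, m, u) \<in> S"
    then interpret basis_extension L K m u by (rule basis)
    show "norm (real (matmul_cost (L\<lparr>carrier := K\<rparr>) m)) \<le> c * norm (real m powr \<omega>)"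
      using c(2)[OF field_F _ m_pos] finite_K by simp
  qed
  have 2: "?mm \<in> O[principal S](?l)"
  proof (rule landau_o.bigI[of 19], simp, unfold eventually_principal, safe)
    fix L :: "'a ring" and K m u assume "(L, K, m, u) \<in> S"
    then interpret basis_extension L K m u by (rule basis)
    show "norm (real (matmul_cost (L\<lparr>carrier := K\<rparr>) m)) \<le> 19 * norm (real (linpoly_cost L K m u))"
      using matmul_cost_le by simp
  qed
  \<comment> \<open>If the exponent is attained up to a constant, the inclusion of classes follows
    by transitivity through the cost of matrices.\<close>
  have "O[principal S](?p) \<subseteq> O[principal S](?l)" if "?p \<in> O[principal S](?mm)"
    using landau_o.big_trans[OF _ landau_o.big_trans[OF that 2]] by blast
  with 1 2 show ?thesis by blast
qed

end
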